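(* Let $n\ge1$ and let $\lambda,\mu$ be partitions with $\lambda_1\le n$, $\mu_1\le n$. Let $v_{\widetilde\mu}$ be a highest weight vector of the irreducible $gl(n)$-module $Schur_\mu(n)$ of highest weight $\widetilde\mu$. Then: (i) if $|\mu|<|\lambda|$, then $\mathbf{S}_\lambda(n)(v_{\widetilde\mu})=0$; (ii) if $|\mu|=|\lambda|$, then $\mathbf{S}_\lambda(n)(v_{\widetilde\mu})=\delta_{\lambda,\mu}\cdot H(\lambda)\cdot v_{\widetilde\mu}$, where $H(\lambda)$ is the product of the hook lengths of the cells of the Ferrers diagram of $\lambda$.
   Context: Virtual method. $gl(m_0|m_1+n)$ ($m_0,m_1$ sufficiently large) is the complex general linear Lie superalgebra with basis $e_{a,b}$, $a,b\in A_0\cup A_1\cup L$, $A_0=\{\alpha_1,\dots,\alpha_{m_0}\}$ (parity $0$), $A_1=\{\beta_1,\dots,\beta_{m_1}\}$ (parity $1$), $L=\{1,\dots,n\}$ (parity $1$), $|e_{a,b}|=|a|+|b|$, and $[e_{a,b},e_{c,d}]=\delta_{bc}e_{a,d}-(-1)^{(|a|+|b|)(|c|+|d|)}\delta_{ad}e_{c,b}$. Symbols in $A_0\cup A_1$ are virtual. $gl(n)$ is the subalgebra spanned by $e_{i,j}$, $i,j\in L$, so $\mathbf{U}(gl(n))\subset\mathbf{U}(gl(m_0|m_1+n))$. A product $e_{a_M,b_M}\cdots e_{a_1,b_1}$ is irregular if there are $i\le M$ and a virtual symbol $\gamma$ with $\#\{j\le i: b_j=\gamma\}>\#\{j<i: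 a_j=\gamma\}$. Let $\mathbf{Irr}$ be the left ideal of $\mathbf{U}(gl(m_0|m_1+n))$ generated by irregular products. The sum $Virt(m_0+m_1,n)=\mathbf{U}(gl(n))\oplus\mathbf{Irr}$ is direct and is a subalgebra in which $\mathbf{Irr}$ is a two-sided ideal; $\mathfrak p:Virt(m_0+m_1,n)\to\mathbf{U}(gl(n))$ is the projection with kernel $\mathbf{Irr}$ (an algebra epimorphism). All monomials to which $\mathfrak p$ is applied here lie in $Virt(m_0+m_1,n)$. Tableaux. For two Young tableaux $S,T$ of the same shape $\lambda$ (row $i$ has $\lambda_i$ cells), $e_{S,T}$ is the product of the $e_{s,t}$, $s,t$ being the entries of $S,T$ in the same cell, the cells being read row by row from top to bottom and from left to right in each row. $C^*_\lambda$ is the tableau of shape $\lambda$ whose entries in row $i$ all equal $\alpha_i$; $D^*_\lambda$ is the tableau of shape $\lambda$ whose entries in column $j$ all equal $\beta_j$ ($m_0\ge\widetilde\lambda_1$, $m_1\ge\lambda_1$). For $\lambda_1\le n$, $$\mathbf{S}_\lambda(n)=\frac1{H(\lambda)}\sum_S\mathfrak p\big(e_{S,C^*_\lambda}\cdot e_{C^*_\lambda,D^*_\lambda}\cdot e_{D^*_\lambda,C^*_\lambda}\cdot e_{C^*_\lambda,S}\big)\in\mathbf{U}(gl(n)),$$ the sum being over all tableaux $S$ of shape $\lambda$ with entries in $\{1,\dots,n\}$ whose rows are strictly increasing; $\mathbf{S}_\emptyset(n)=1$. These elements are central in $\mathbf{U}(gl(n))$. For a partition $\mu$ with $\mu_1\le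 n$, $Schur_\mu(n)$ is the irreducible $gl(n)$-module of highest weight $\widetilde\mu$ (the conjugate partition, padded by zeros to length $n$). *)

theory Defs
  imports Complex_Main "HOL-Library.FuncSet" "HOL-Algebra.QuotRing"
begin

section \<open>The free associative algebra over the complex numbers\<close>

text \<open>An element is its finitely supported coefficient function on words; the product is
  concatenation of words extended bilinearly, i.e. convolution over all splittings of a word.\<close>

definition word_elt :: "'a list \<Rightarrow> 'a list \<Rightarrow> complex" where
  "word_elt w = (\<lambda>u. if u = w then 1 else 0)"

definition free_alg :: "'a set \<Rightarrow> ('a list \<Rightarrow> complex) ring" where
  "free_alg G =
     \<lparr>carrier = {f. finite {w. f w \<noteq> 0} \<and> {w. f w \<noteq> 0} \<subseteq> lists G},
      monoid.mult = (\<lambda>f g w. \<Sum>k\<le>length w. f (take k w) * g (drop k w)),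
      one = word_elt [],
      zero = (\<lambda>w. 0),
      add = (\<lambda>f g w. f w + g w)\<rparr>"


lemma conv_assoc:
  fixes f g h :: "'a list \<Rightarrow> complex"
  shows "(\<Sum>k\<le>length w. (\<Sum>l\<le>length (take k w). f (take l (take k w)) * g (drop l (take k w))) * h (drop k w))
   = (\<Sum>k\<le>length w. f (take k w) * (\<Sum>l\<le>length (drop k w). g (take l (drop k w)) * h (drop l (drop k w))))"
    (is "?l = ?r")
proof -
  let ?s1 = "\<Sum>(k,l)\<in>Sigma {..length w} (\<lambda>k. {..k}). f (take l w) * g (drop l (take k w)) * h (drop k w)"
  let ?s2 = "\<Sum>(k,l)\<in>Sigma {..length w} (\<lambda>k. {..length w - k}).
    f (take k w) * g (take l (drop k w)) * h (drop (k + l) w)"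
  have "?l = (\<Sum>k\<le>length w. \<Sum>l\<le>k. f (take l w) * g (drop l (take k w)) * h (drop k w))"
    by (rule sum.cong[OF refl]) (simp add: sum_distrib_right min_absorb1 min_absorb2)
  also have "\<dots> = ?s1" by (rule sum.Sigma) auto
  also have "?s1 = ?s2"
    by (rule sum.reindex_bij_witness[where i="\<lambda>(k,l). (k+l,k)" and j="\<lambda>(k,l). (l,k-l)"])
       (auto simp: drop_take)
  also have "?s2 = (\<Sum>k\<le>length w. \<Sum>l\<le>length w - k.
      f (take k w) * g (take l (drop k w)) * h (drop (k + l) w))"
    by (rule sum.Sigma[symmetric]) auto
  also have "\<dots> = ?r"
    by (simp add: sum_distrib_left mult.assoc add.commute)
  finally show ?thesis .
qed

lemma supp_mult:
  fixes f g :: "'a list \<Rightarrow> complex"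
  shows "{w. (\<Sum>k\<le>length w. f (take k w) * g (drop k w)) \<noteq> 0} \<subseteq> (\<lambda>(u,v). u @ v) ` ({w. f w \<noteq> 0} \<times> {w. g w \<noteq> 0})"
proof
  fix w assume "w \<in> {w. (\<Sum>k\<le>length w. f (take k w) * g (drop k w)) \<noteq> 0}"
  then have "(\<Sum>k\<le>length w. f (take k w) * g (drop k w)) \<noteq> 0" by simp
  then obtain k where "f (take k w) * g (drop k w) \<noteq> 0"
    by (meson sum.neutral)
  then have "(take k w, drop k w) \<in> {w. f w \<noteq> 0} \<times> {w. g w \<noteq> 0}" by simp
  moreover have "w = (\<lambda>(u,v). u @ v) (take k w, drop k w)" by simp
  ultimately show "w \<in> (\<lambda>(u,v). u @ v) ` ({w. f w \<noteq> 0} \<times> {w. g w \<noteq> 0})"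
    by (rule rev_image_eqI)
qed

lemma ring_free_alg: "ring (free_alg G)"
proof (rule ringI)
  show "abelian_group (free_alg G)"
  proof (rule abelian_groupI)
    fix x y assume "x \<in> carrier (free_alg G)" "y \<in> carrier (free_alg G)"
    then have "finite ({w. x w \<noteq> 0} \<union> {w. y w \<noteq> 0})"
      and "{w. x w \<noteq> 0} \<union> {w. y w \<noteq> 0} \<subseteq> lists G"
      by (auto simp: free_alg_def)
    moreover have sub: "{w. x w + y w \<noteq> 0} \<subseteq> {w. x w \<noteq> 0} \<union> {w. y w \<noteq> 0}" by auto
    ultimately have "finite {w. x w + y w \<noteq> 0}" and "{w. x w + y w \<noteq> 0} \<subseteq> lists G"
      using finite_subset[OF sub] order_trans[OF sub, of "lists G"] by blast+
    then show "x \<oplus>\<^bsub>free_alg G\<^esub> y \<in> carrier (free_alg G)"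
      by (simp add: free_alg_def)
  next
    fix x assume "x \<in> carrier (free_alg G)"
    then show "\<exists>y\<in>carrier (free_alg G). y \<oplus>\<^bsub>free_alg G\<^esub> x = \<zero>\<^bsub>free_alg G\<^esub>"
      by (intro bexI[where x="\<lambda>w. - x w"]) (auto simp: free_alg_def)
  qed (auto simp: free_alg_def add_ac)
  show "Group.monoid (free_alg G)"
  proof
    fix x y assume "x \<in> carrier (free_alg G)" "y \<in> carrier (free_alg G)"
    then have "finite {w. x w \<noteq> 0}" "finite {w. y w \<noteq> 0}"
      "{w. x w \<noteq> 0} \<subseteq> lists G" "{w. y w \<noteq> 0} \<subseteq> lists G" by (auto simp: free_alg_def)
    then have "finite ((\<lambda>(u,v). u @ v) ` ({w. x w \<noteq> 0} \<times> {w. y w \<noteq> 0}))"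
      and "(\<lambda>(u,v). u @ v) ` ({w. x w \<noteq> 0} \<times> {w. y w \<noteq> 0}) \<subseteq> lists G"
      by (auto simp: subset_iff in_lists_conv_set)
    then show "x \<otimes>\<^bsub>free_alg G\<^esub> y \<in> carrier (free_alg G)"
      using finite_subset[OF supp_mult[of x y]] order_trans[OF supp_mult[of x y], of "lists G"]
      by (simp add: free_alg_def)
  next
    fix x assume "x \<in> carrier (free_alg G)"
    have "(\<Sum>k\<le>length w. word_elt [] (take k w) * x (drop k w)) = x w" for w
    proof -
      have "(\<Sum>k\<le>length w. word_elt [] (take k w) * x (drop k w)) = (\<Sum>k\<in>{0}. word_elt [] (take k w) * x (drop k w))"
        by (rule sum.mono_neutral_right) (auto simp: word_elt_def)
      then show ?thesis by (simp add: word_elt_def)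
    qed
    then show "\<one>\<^bsub>free_alg G\<^esub> \<otimes>\<^bsub>free_alg G\<^esub> x = x" by (simp add: free_alg_def)
    have "(\<Sum>k\<le>length w. x (take k w) * word_elt [] (drop k w)) = x w" for w
    proof -
      have "(\<Sum>k\<le>length w. x (take k w) * word_elt [] (drop k w)) = (\<Sum>k\<in>{length w}. x (take k w) * word_elt [] (drop k w))"
        by (rule sum.mono_neutral_right) (auto simp: word_elt_def)
      then show ?thesis by (simp add: word_elt_def)
    qed
    then show "x \<otimes>\<^bsub>free_alg G\<^esub> \<one>\<^bsub>free_alg G\<^esub> = x" by (simp add: free_alg_def)
  next
    fix x y z assume "x \<in> carrier (free_alg G)" "y \<in> carrier (free_alg G)" "z \<in> carrier (free_alg G)"
    show "x \<otimes>\<^bsub>free_alg G\<^esub> y \<otimes>\<^bsub>free_alg G\<^esub> z = x \<otimes>\<^bsub>free_alg G\<^esub> (y \<otimes>\<^bsub>free_alg G\<^esub> z)"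
      unfolding free_alg_def monoid.simps by (rule ext) (rule conv_assoc)
  qed (auto simp: free_alg_def word_elt_def)
qed (auto simp: free_alg_def algebra_simps sum.distrib)


section \<open>The general linear Lie superalgebra and its enveloping algebra\<close>

datatype sym = Alpha (idx: nat) | Beta (idx: nat) | Lett (idx: nat)

fun parity :: "sym \<Rightarrow> nat" where
  "parity (Alpha i) = 0"
| "parity (Beta i) = 1"
| "parity (Lett i) = 1"

fun is_virtual :: "sym \<Rightarrow> bool" where
  "is_virtual (Alpha i) = True"
| "is_virtual (Beta i) = True"
| "is_virtual (Lett i) = False"

definition letters :: "nat \<Rightarrow> sym set" where
  "letters n = Lett ` {1..n}"

definition symbols :: "nat \<Rightarrow> nat \<Rightarrow> nat \<Rightarrow> sym set" where
  "symbols m0 m1 n = Alpha ` {1..m0} \<union> Beta ` {1..m1} \<union> letters n"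

definition gl_sign :: "sym \<times> sym \<Rightarrow> sym \<times> sym \<Rightarrow> complex" where
  "gl_sign x y = (- 1) ^ ((parity (fst x) + parity (snd x)) * (parity (fst y) + parity (snd y)))"

text \<open>The pair \<open>(a, b)\<close> stands for the basis element \<open>e\<^sub>a\<^sub>b\<close>; the superbracket of two basis
  elements is a linear combination of basis elements, i.e. of words of length one.\<close>

definition gl_bracket :: "sym \<times> sym \<Rightarrow> sym \<times> sym \<Rightarrow> (sym \<times> sym) list \<Rightarrow> complex" where
  "gl_bracket x y = (\<lambda>w.
     (if snd x = fst y then word_elt [(fst x, snd y)] w else 0)
     - gl_sign x y * (if fst x = snd y then word_elt [(fst y, snd x)] w else 0))"

definition gl_relator :: "sym \<times> sym \<Rightarrow> sym \<times> sym \<Rightarrow> (sym \<times> sym) list \<Rightarrow> complex" where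
  "gl_relator x y = (\<lambda>w. word_elt [x, y] w - gl_sign x y * word_elt [y, x] w - gl_bracket x y w)"

definition gl_ideal :: "sym set \<Rightarrow> ((sym \<times> sym) list \<Rightarrow> complex) set" where
  "gl_ideal X = genideal (free_alg (X \<times> X)) {gl_relator x y |x y. x \<in> X \<times> X \<and> y \<in> X \<times> X}"

text \<open>The enveloping algebra of the general linear Lie superalgebra with basis \<open>e\<^sub>a\<^sub>b\<close>, where
  \<open>a\<close> and \<open>b\<close> range over the set \<open>X\<close> of symbols. Its elements are cosets.\<close>

definition U :: "sym set \<Rightarrow> ((sym \<times> sym) list \<Rightarrow> complex) set ring" where
  "U X = free_alg (X \<times> X) Quot gl_ideal X"

definition U_scalar :: "sym set \<Rightarrow> complex \<Rightarrow> ((sym \<times> sym) list \<Rightarrow> complex) set" where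
  "U_scalar X c = gl_ideal X +>\<^bsub>free_alg (X \<times> X)\<^esub> (\<lambda>w. c * word_elt [] w)"

definition U_gen :: "sym set \<Rightarrow> sym \<times> sym \<Rightarrow> ((sym \<times> sym) list \<Rightarrow> complex) set" where
  "U_gen X x = gl_ideal X +>\<^bsub>free_alg (X \<times> X)\<^esub> word_elt [x]"

definition U_prod :: "sym set \<Rightarrow> (sym \<times> sym) list \<Rightarrow> ((sym \<times> sym) list \<Rightarrow> complex) set" where
  "U_prod X ws = foldr (\<lambda>x y. U_gen X x \<otimes>\<^bsub>U X\<^esub> y) ws \<one>\<^bsub>U X\<^esub>"


section \<open>Virtual projection\<close>

text \<open>A list \<open>[(a\<^sub>M, b\<^sub>M), \<dots>, (a\<^sub>1, b\<^sub>1)]\<close> stands for the product of the corresponding basis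
  elements written from left to right, so the factor number \<open>j\<close> is the entry \<open>j - 1\<close>
  of the reversed list.\<close>

definition irregular :: "(sym \<times> sym) list \<Rightarrow> bool" where
  "irregular ws \<longleftrightarrow> (\<exists>i < length ws. \<exists>\<gamma>. is_virtual \<gamma> \<and>
     card {j. j \<le> i \<and> snd (rev ws ! j) = \<gamma>} > card {j. j < i \<and> fst (rev ws ! j) = \<gamma>})"

definition gen_left_ideal :: "('a, 'b) ring_scheme \<Rightarrow> 'a set \<Rightarrow> 'a set" where
  "gen_left_ideal R S = \<Inter>{I. additive_subgroup I R \<and>
     (\<forall>r \<in> carrier R. \<forall>x \<in> I. r \<otimes>\<^bsub>R\<^esub> x \<in> I) \<and> S \<subseteq> I}"

definition Irr :: "nat \<Rightarrow> nat \<Rightarrow> nat \<Rightarrow> ((sym \<times> sym) list \<Rightarrow> complex) set set" where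
  "Irr m0 m1 n = (let X = symbols m0 m1 n in
     gen_left_ideal (U X) {U_prod X ws |ws. ws \<in> lists (X \<times> X) \<and> irregular ws})"

text \<open>The canonical map from the enveloping algebra of \<open>gl(n)\<close> (with the odd letters as its
  symbols) to the enveloping algebra over all symbols: it sends a coset to the coset of the
  larger ideal containing it.\<close>

definition U_embed :: "nat \<Rightarrow> nat \<Rightarrow> nat \<Rightarrow> ((sym \<times> sym) list \<Rightarrow> complex) set
    \<Rightarrow> ((sym \<times> sym) list \<Rightarrow> complex) set" where
  "U_embed m0 m1 n y = (let X = symbols m0 m1 n in gl_ideal X <+>\<^bsub>free_alg (X \<times> X)\<^esub> y)"

definition Virt :: "nat \<Rightarrow> nat \<Rightarrow> nat \<Rightarrow> ((sym \<times> sym) list \<Rightarrow> complex) set set" where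
  "Virt m0 m1 n =
     U_embed m0 m1 n ` carrier (U (letters n)) <+>\<^bsub>U (symbols m0 m1 n)\<^esub> Irr m0 m1 n"

text \<open>The projection of \<open>Virt\<close> onto its first summand. Since the canonical map is injective and
  the sum is direct, there is exactly one \<open>y\<close> as below for every \<open>x\<close> in \<open>Virt\<close>; outside
  \<open>Virt\<close> the value is arbitrary.\<close>

definition virt_proj :: "nat \<Rightarrow> nat \<Rightarrow> nat \<Rightarrow> ((sym \<times> sym) list \<Rightarrow> complex) set
    \<Rightarrow> ((sym \<times> sym) list \<Rightarrow> complex) set" where
  "virt_proj m0 m1 n x = (SOME y. y \<in> carrier (U (letters n)) \<and>
     x \<ominus>\<^bsub>U (symbols m0 m1 n)\<^esub> U_embed m0 m1 n y \<in> Irr m0 m1 n)"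


section \<open>Partitions and tableaux\<close>

text \<open>A partition is the weakly decreasing list of its nonzero parts. Rows and columns are
  numbered from 1.\<close>

definition is_partition :: "nat list \<Rightarrow> bool" where
  "is_partition p \<longleftrightarrow> sorted_wrt (\<ge>) p \<and> 0 \<notin> set p"

definition part :: "nat list \<Rightarrow> nat \<Rightarrow> nat" where
  "part p i = (if 1 \<le> i \<and> i \<le> length p then p ! (i - 1) else 0)"

definition conj_part :: "nat list \<Rightarrow> nat \<Rightarrow> nat" where
  "conj_part p j = card {i. 1 \<le> i \<and> i \<le> length p \<and> j \<le> part p i}"

definition cells :: "nat list \<Rightarrow> (nat \<times> nat) list" where
  "cells p = concat (map (\<lambda>i. map (\<lambda>j. (i, j)) [1..<Suc (part p i)]) [1..<Suc (length p)])"

definition hook_prod :: "nat list \<Rightarrow> nat" where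
  "hook_prod p = (\<Prod>(i, j) \<in> set (cells p). (part p i - j) + (conj_part p j - i) + 1)"

definition e_tab :: "sym set \<Rightarrow> nat list \<Rightarrow> (nat \<times> nat \<Rightarrow> sym) \<Rightarrow> (nat \<times> nat \<Rightarrow> sym)
    \<Rightarrow> ((sym \<times> sym) list \<Rightarrow> complex) set" where
  "e_tab X p S T = U_prod X (map (\<lambda>c. (S c, T c)) (cells p))"

definition tab_C :: "nat \<times> nat \<Rightarrow> sym" where
  "tab_C = (\<lambda>(i, j). Alpha i)"

definition tab_D :: "nat \<times> nat \<Rightarrow> sym" where
  "tab_D = (\<lambda>(i, j). Beta j)"

definition row_strict_tableaux :: "nat \<Rightarrow> nat list \<Rightarrow> (nat \<times> nat \<Rightarrow> nat) set" where
  "row_strict_tableaux n p = {S \<in> set (cells p) \<rightarrow>\<^sub>E {1..n}.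
     \<forall>i j k. (i, j) \<in> set (cells p) \<and> (i, k) \<in> set (cells p) \<and> j < k \<longrightarrow> S (i, j) < S (i, k)}"


section \<open>The elements \<open>S\<^sub>\<lambda>(n)\<close>\<close>

definition S_elt :: "nat \<Rightarrow> nat \<Rightarrow> nat \<Rightarrow> nat list \<Rightarrow> ((sym \<times> sym) list \<Rightarrow> complex) set" where
  "S_elt m0 m1 n p = (let X = symbols m0 m1 n in
     U_scalar (letters n) (1 / of_nat (hook_prod p)) \<otimes>\<^bsub>U (letters n)\<^esub>
     (\<Oplus>\<^bsub>U (letters n)\<^esub>S \<in> row_strict_tableaux n p.
        virt_proj m0 m1 n
          (e_tab X p (Lett \<circ> S) tab_C \<otimes>\<^bsub>U X\<^esub> e_tab X p tab_C tab_D \<otimes>\<^bsub>U X\<^esub>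
           e_tab X p tab_D tab_C \<otimes>\<^bsub>U X\<^esub> e_tab X p tab_C (Lett \<circ> S))))"


section \<open>Modules over \<open>gl(n)\<close>\<close>

text \<open>A module is a subspace \<open>V\<close> of a complex vector space with scalar multiplication \<open>scl\<close>,
  together with the operators \<open>E i j\<close> by which the basis elements \<open>e\<^sub>i\<^sub>j\<close> act on \<open>V\<close>. Carrying
  \<open>V\<close> as a set allows its dimension to depend on \<open>n\<close> and on the highest weight.\<close>

definition gl_module :: "nat \<Rightarrow> (complex \<Rightarrow> 'v::ab_group_add \<Rightarrow> 'v) \<Rightarrow> 'v set
    \<Rightarrow> (nat \<Rightarrow> nat \<Rightarrow> 'v \<Rightarrow> 'v) \<Rightarrow> bool" where
  "gl_module n scl V E \<longleftrightarrow>
     vector_space scl \<and> module.subspace scl V \<and>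
     (\<forall>i \<in> {1..n}. \<forall>j \<in> {1..n}.
        (\<forall>x \<in> V. E i j x \<in> V) \<and>
        (\<forall>x \<in> V. \<forall>y \<in> V. E i j (x + y) = E i j x + E i j y) \<and>
        (\<forall>c. \<forall>x \<in> V. E i j (scl c x) = scl c (E i j x))) \<and>
     (\<forall>i \<in> {1..n}. \<forall>j \<in> {1..n}. \<forall>k \<in> {1..n}. \<forall>l \<in> {1..n}. \<forall>x \<in> V.
        E i j (E k l x) - E k l (E i j x)
        = (if j = k then E i l x else 0) - (if i = l then E k j x else 0))"

definition irreducible_gl_module :: "nat \<Rightarrow> (complex \<Rightarrow> 'v::ab_group_add \<Rightarrow> 'v) \<Rightarrow> 'v set
    \<Rightarrow> (nat \<Rightarrow> nat \<Rightarrow> 'v \<Rightarrow> 'v) \<Rightarrow> bool" where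
  "irreducible_gl_module n scl V E \<longleftrightarrow>
     gl_module n scl V E \<and> V \<noteq> {0} \<and>
     (\<forall>W. W \<subseteq> V \<and> module.subspace scl W \<and>
        (\<forall>i \<in> {1..n}. \<forall>j \<in> {1..n}. \<forall>x \<in> W. E i j x \<in> W) \<longrightarrow> W = {0} \<or> W = V)"

definition highest_weight_vector :: "nat \<Rightarrow> (complex \<Rightarrow> 'v::ab_group_add \<Rightarrow> 'v) \<Rightarrow> 'v set
    \<Rightarrow> (nat \<Rightarrow> nat \<Rightarrow> 'v \<Rightarrow> 'v) \<Rightarrow> (nat \<Rightarrow> complex) \<Rightarrow> 'v \<Rightarrow> bool" where
  "highest_weight_vector n scl V E wt v \<longleftrightarrow>
     v \<in> V \<and> v \<noteq> 0 \<and>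
     (\<forall>i \<in> {1..n}. \<forall>j \<in> {1..n}. i < j \<longrightarrow> E i j v = 0) \<and>
     (\<forall>i \<in> {1..n}. E i i v = scl (wt i) v)"

definition schur_weight :: "nat list \<Rightarrow> nat \<Rightarrow> complex" where
  "schur_weight p i = of_nat (conj_part p i)"

definition is_Schur_module :: "nat \<Rightarrow> nat list \<Rightarrow> (complex \<Rightarrow> 'v::ab_group_add \<Rightarrow> 'v) \<Rightarrow> 'v set
    \<Rightarrow> (nat \<Rightarrow> nat \<Rightarrow> 'v \<Rightarrow> 'v) \<Rightarrow> bool" where
  "is_Schur_module n p scl V E \<longleftrightarrow>
     irreducible_gl_module n scl V E \<and>
     (\<exists>v. highest_weight_vector n scl V E (schur_weight p) v)"

text \<open>The action of the enveloping algebra of \<open>gl(n)\<close> on a module: words act by composition of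
  operators, the leftmost letter last. An element of the enveloping algebra acts by any of
  its representatives in the free algebra, as the defining ideal acts by zero.\<close>

definition free_action :: "(complex \<Rightarrow> 'v::ab_group_add \<Rightarrow> 'v) \<Rightarrow> (nat \<Rightarrow> nat \<Rightarrow> 'v \<Rightarrow> 'v)
    \<Rightarrow> ((sym \<times> sym) list \<Rightarrow> complex) \<Rightarrow> 'v \<Rightarrow> 'v" where
  "free_action scl E f v =
     (\<Sum>w | f w \<noteq> 0. scl (f w) (foldr (\<lambda>(a, b). E (idx a) (idx b)) w v))"

definition U_action :: "(complex \<Rightarrow> 'v::ab_group_add \<Rightarrow> 'v) \<Rightarrow> (nat \<Rightarrow> nat \<Rightarrow> 'v \<Rightarrow> 'v)
    \<Rightarrow> ((sym \<times> sym) list \<Rightarrow> complex) set \<Rightarrow> 'v \<Rightarrow> 'v" where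
  "U_action scl E x v = free_action scl E (SOME f. f \<in> x) v"

end

theory Submission
  imports Defs "HOL-Library.Function_Algebras" "HOL-Library.Product_Plus" "HOL-Library.Multiset"
    "HOL-Library.Countable"
begin

text \<open>Irregular products annihilate every vector without virtual symbols in a module on which the
  virtual symbols occur with nonnegative multiplicities. Hence the element \<open>S\<^sub>\<lambda>(n)\<close> acts on such
  vectors by the original virtual monomials, and its eigenvalue can be computed in a concrete
  module: a Fock space with one row of modes for each part of \<open>\<mu>\<close>. A highest weight vector \<open>w\<close> of
  weight \<open>conj \<mu>\<close> is obtained there by replacing, row by row, virtual symbols by letters.

  If \<open>|\<mu>| = |\<lambda>|\<close> and \<open>e\<^bsub>D,C\<^esub> e\<^bsub>C,S\<^esub> w\<close> is nonzero, row strictness of \<open>S\<close> and the exclusion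
  principle for the odd symbols \<open>\<beta>\<^sub>j\<close> force \<open>\<lambda> = \<mu>\<close> and \<open>S(i, j) = j\<close>. For this one tableau, both \<open>e\<^bsub>C,D\<^esub> e\<^bsub>D,C\<^esub>\<close> and
  \<open>e\<^bsub>S,C\<^esub> e\<^bsub>C,S\<^esub>\<close> act by the product of the hook lengths up to the same sign: each row contributes a
  Capelli product whose factors on a highest weight vector are the hook lengths of that row.

  Finally, an element of the enveloping algebra acting by a scalar on \<open>w\<close> acts by the same scalar on
  the highest weight vector of the irreducible module, by considering the submodule generated by
  the pair of the two vectors.\<close>

section \<open>The enveloping algebra\<close>

text \<open>The virtual symbols do not act on an abstract \<open>gl(n)\<close>-module, so the
  monomials under the projection can only be evaluated in a module of the large superalgebra; this
  is why a Fock space intervenes. Its modes are pairs (row, symbol). Letters are odd, so within a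
  row they form exterior powers, and filling row r with the letters 1, ..., \<mu>_r uses letter j
  once for every row of length at least j: the weight is the conjugate of \<mu>. The projection is
  reached only through its action: it is a chosen element differing from the monomial by an element
  of \<open>Irr\<close>, and every such element acts on \<open>hwv\<close> as the monomial does. The
  hook product arises twice, once for letters against rows and once for rows against columns. A
  Capelli factor is the current multiplicity of a symbol, which is leg + 1, plus the number of later
  symbols in its row, which is the arm. The coefficient 1/H then leaves a single H.\<close>

lemma free_alg_sel:
  "carrier (free_alg G) = {f. finite {w. f w \<noteq> 0} \<and> {w. f w \<noteq> 0} \<subseteq> lists G}"
  "f \<otimes>\<^bsub>free_alg G\<^esub> g = (\<lambda>w. \<Sum>k\<le>length w. f (take k w) * g (drop k w))"
  "\<one>\<^bsub>free_alg G\<^esub> = word_elt []"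
  "\<zero>\<^bsub>free_alg G\<^esub> = (\<lambda>w. 0)"
  "f \<oplus>\<^bsub>free_alg G\<^esub> g = (\<lambda>w. f w + g w)"
  by (simp_all add: free_alg_def)

lemma word_elt_closed [simp]: "w \<in> lists G \<Longrightarrow> word_elt w \<in> carrier (free_alg G)"
  by (auto simp: free_alg_sel word_elt_def)

lemma scaled_closed: "f \<in> carrier (free_alg G) \<Longrightarrow> (\<lambda>w. c * f w) \<in> carrier (free_alg G)"
  by (auto simp: free_alg_sel intro: finite_subset[of _ "{w. f w \<noteq> 0}"])

lemma add_closed: "f \<in> carrier (free_alg G) \<Longrightarrow> g \<in> carrier (free_alg G) \<Longrightarrow> (\<lambda>w. f w + g w) \<in> carrier (free_alg G)"
  using ring.ring_simprules(1)[OF ring_free_alg, of f G g] by (simp add: free_alg_sel(5))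

lemma diff_closed: "f \<in> carrier (free_alg G) \<Longrightarrow> g \<in> carrier (free_alg G) \<Longrightarrow> (\<lambda>w. f w - g w) \<in> carrier (free_alg G)"
  using add_closed[of f G "\<lambda>w. (-1) * g w"] scaled_closed[of g G "-1"] by simp

lemma free_alg_a_inv:
  assumes "f \<in> carrier (free_alg G)"
  shows "\<ominus>\<^bsub>free_alg G\<^esub> f = (\<lambda>w. - f w)"
proof -
  interpret F: ring "free_alg G" by (rule ring_free_alg)
  show ?thesis
    by (rule F.minus_equality) (use assms scaled_closed[OF assms, of "-1"] in \<open>auto simp: free_alg_sel(4,5)\<close>)
qed

lemma scalar_mult:
  "(\<lambda>w. c * word_elt [] w) \<otimes>\<^bsub>free_alg G\<^esub> f = (\<lambda>w. c * f w)"
  "f \<otimes>\<^bsub>free_alg G\<^esub> (\<lambda>w. c * word_elt [] w) = (\<lambda>w. c * f w)"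
proof -
  have "(\<Sum>k\<le>length w. c * word_elt [] (take k w) * f (drop k w))
      = (\<Sum>k\<in>{0}. c * word_elt [] (take k w) * f (drop k w))" for w
    by (rule sum.mono_neutral_right) (auto simp: word_elt_def)
  then show "(\<lambda>w. c * word_elt [] w) \<otimes>\<^bsub>free_alg G\<^esub> f = (\<lambda>w. c * f w)"
    by (simp add: free_alg_sel word_elt_def)
  have "(\<Sum>k\<le>length w. f (take k w) * (c * word_elt [] (drop k w)))
      = (\<Sum>k\<in>{length w}. f (take k w) * (c * word_elt [] (drop k w)))" for w
    by (rule sum.mono_neutral_right) (auto simp: word_elt_def)
  then show "f \<otimes>\<^bsub>free_alg G\<^esub> (\<lambda>w. c * word_elt [] w) = (\<lambda>w. c * f w)"
    by (simp add: free_alg_sel word_elt_def mult.commute)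
qed

lemma word_elt_mult: "word_elt u \<otimes>\<^bsub>free_alg G\<^esub> word_elt v = word_elt (u @ v)"
proof
  fix w
  have "(\<Sum>k\<le>length w. word_elt u (take k w) * word_elt v (drop k w))
      = (\<Sum>k\<le>length w. if k = length u then word_elt (u @ v) w else 0)"
  proof (rule sum.cong[OF refl])
    fix k assume "k \<in> {..length w}"
    moreover have "take k w = u \<and> drop k w = v \<longleftrightarrow> k = length u \<and> w = u @ v" if "k \<le> length w"
      using that by (metis append_eq_conv_conj append_take_drop_id length_take min.absorb2)
    moreover have "word_elt u (take k w) * word_elt v (drop k w) =
        (if take k w = u \<and> drop k w = v then 1 else 0)"
      by (simp add: word_elt_def)
    ultimately show "word_elt u (take k w) * word_elt v (drop k w) =
         (if k = length u then word_elt (u @ v) w else 0)"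
      by (simp add: word_elt_def)
  qed
  also have "\<dots> = word_elt (u @ v) w"
    by (auto simp: word_elt_def)
  finally show "(word_elt u \<otimes>\<^bsub>free_alg G\<^esub> word_elt v) w = word_elt (u @ v) w"
    by (simp add: free_alg_sel)
qed

lemma gl_relator_closed:
  assumes "x \<in> X \<times> X" "y \<in> X \<times> X"
  shows "gl_relator x y \<in> carrier (free_alg (X \<times> X))"
proof -
  have *: "(\<lambda>w. if P then f w else 0) \<in> carrier (free_alg (X \<times> X))"
    if "f \<in> carrier (free_alg (X \<times> X))" for P and f :: "(sym \<times> sym) list \<Rightarrow> complex"
    using that by (cases P) (auto simp: free_alg_sel)
  show ?thesis
    unfolding gl_relator_def gl_bracket_def
    by (intro diff_closed scaled_closed * word_elt_closed) (use assms in auto)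
qed

lemma gl_ideal_ideal: "ideal (gl_ideal X) (free_alg (X \<times> X))"
  unfolding gl_ideal_def
  by (rule ring.genideal_ideal[OF ring_free_alg]) (auto intro: gl_relator_closed simp del: mem_Sigma_iff)

lemma gl_relator_in_ideal:
  "x \<in> X \<times> X \<Longrightarrow> y \<in> X \<times> X \<Longrightarrow> gl_relator x y \<in> gl_ideal X"
  unfolding gl_ideal_def
  by (rule set_mp[OF ring.genideal_self[OF ring_free_alg]])
     (auto intro: gl_relator_closed simp del: mem_Sigma_iff)

lemma ring_U: "ring (U X)"
  unfolding U_def by (rule ideal.quotient_is_ring[OF gl_ideal_ideal])

definition U_of :: "sym set \<Rightarrow> ((sym \<times> sym) list \<Rightarrow> complex) \<Rightarrow> ((sym \<times> sym) list \<Rightarrow> complex) set" where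
  "U_of X f = gl_ideal X +>\<^bsub>free_alg (X \<times> X)\<^esub> f"

lemma U_of_hom: "ring_hom_ring (free_alg (X \<times> X)) (U X) (U_of X)"
  unfolding U_def U_of_def by (rule ideal.rcos_ring_hom_ring[OF gl_ideal_ideal])

lemma U_carrier: "carrier (U X) = U_of X ` carrier (free_alg (X \<times> X))"
  by (auto simp: U_def U_of_def FactRing_def A_RCOSETS_defs a_r_coset_def)

lemma U_of_closed [simp]: "f \<in> carrier (free_alg (X \<times> X)) \<Longrightarrow> U_of X f \<in> carrier (U X)"
  by (simp add: U_carrier)

lemma U_of_add:
  assumes "f \<in> carrier (free_alg (X \<times> X))" "g \<in> carrier (free_alg (X \<times> X))"
  shows "U_of X f \<oplus>\<^bsub>U X\<^esub> U_of X g = U_of X (\<lambda>w. f w + g w)"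
proof -
  interpret h: ring_hom_ring "free_alg (X \<times> X)" "U X" "U_of X" by (rule U_of_hom)
  show ?thesis using h.hom_add[OF assms] by (simp add: free_alg_sel(5))
qed

lemma U_of_minus:
  assumes "f \<in> carrier (free_alg (X \<times> X))" "g \<in> carrier (free_alg (X \<times> X))"
  shows "U_of X f \<ominus>\<^bsub>U X\<^esub> U_of X g = U_of X (\<lambda>w. f w - g w)"
proof -
  interpret h: ring_hom_ring "free_alg (X \<times> X)" "U X" "U_of X" by (rule U_of_hom)
  have "\<ominus>\<^bsub>U X\<^esub> U_of X g = U_of X (\<lambda>w. - g w)"
    using h.hom_a_inv[OF assms(2)] free_alg_a_inv[OF assms(2)] by simp
  then show ?thesis
    using U_of_add[OF assms(1), of "\<lambda>w. - g w"] scaled_closed[OF assms(2), of "-1"]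
    by (simp add: a_minus_def)
qed

lemma U_of_mult:
  assumes "f \<in> carrier (free_alg (X \<times> X))" "g \<in> carrier (free_alg (X \<times> X))"
  shows "U_of X f \<otimes>\<^bsub>U X\<^esub> U_of X g = U_of X (f \<otimes>\<^bsub>free_alg (X \<times> X)\<^esub> g)"
proof -
  interpret h: ring_hom_ring "free_alg (X \<times> X)" "U X" "U_of X" by (rule U_of_hom)
  show ?thesis using h.hom_mult[OF assms] by simp
qed

lemma U_of_one: "\<one>\<^bsub>U X\<^esub> = U_of X (word_elt [])"
proof -
  interpret h: ring_hom_ring "free_alg (X \<times> X)" "U X" "U_of X" by (rule U_of_hom)
  show ?thesis using h.hom_one by (simp add: free_alg_sel(3))
qed

lemma U_of_zero: "\<zero>\<^bsub>U X\<^esub> = U_of X (\<lambda>w. 0)"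
proof -
  interpret h: ring_hom_ring "free_alg (X \<times> X)" "U X" "U_of X" by (rule U_of_hom)
  show ?thesis using h.hom_zero by (simp add: free_alg_sel(4))
qed

lemma U_of_eqI:
  assumes "f \<in> carrier (free_alg (X \<times> X))" "g \<in> carrier (free_alg (X \<times> X))"
    and "(\<lambda>w. f w - g w) \<in> gl_ideal X"
  shows "U_of X f = U_of X g"
proof -
  interpret R: ring "U X" by (rule ring_U)
  interpret F: ring "free_alg (X \<times> X)" by (rule ring_free_alg)
  have "U_of X (\<lambda>w. f w - g w) = gl_ideal X"
    unfolding U_of_def by (rule F.a_rcos_zero[OF gl_ideal_ideal assms(3)])
  also have "\<dots> = \<zero>\<^bsub>U X\<^esub>" by (simp add: U_def FactRing_def)
  finally have "U_of X f \<ominus>\<^bsub>U X\<^esub> U_of X g = \<zero>\<^bsub>U X\<^esub>"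
    using assms by (simp add: U_of_minus)
  then have "\<ominus>\<^bsub>U X\<^esub> (\<ominus>\<^bsub>U X\<^esub> U_of X g) = U_of X f"
    by (intro R.minus_equality) (use assms in \<open>auto simp: a_minus_def\<close>)
  then show ?thesis using assms by simp
qed

lemma U_gen_U_of: "U_gen X x = U_of X (word_elt [x])"
  by (simp add: U_gen_def U_of_def)

lemma U_scalar_U_of: "U_scalar X c = U_of X (\<lambda>w. c * word_elt [] w)"
  by (simp add: U_scalar_def U_of_def)

lemma U_prod_U_of: "ws \<in> lists (X \<times> X) \<Longrightarrow> U_prod X ws = U_of X (word_elt ws)"
proof (induction ws)
  case Nil
  then show ?case by (simp add: U_prod_def U_of_one)
next
  case (Cons x ws)
  then have "U_prod X (x # ws) = U_of X (word_elt [x]) \<otimes>\<^bsub>U X\<^esub> U_of X (word_elt ws)"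
    by (simp add: U_prod_def U_gen_U_of)
  also have "\<dots> = U_of X (word_elt (x # ws))"
    using Cons by (subst U_of_mult) (auto simp: word_elt_mult)
  finally show ?case .
qed

lemma U_scalar_closed [simp]: "U_scalar X c \<in> carrier (U X)"
  unfolding U_scalar_U_of by (intro U_of_closed scaled_closed word_elt_closed) simp

lemma U_scalar_mult:
  assumes "f \<in> carrier (free_alg (X \<times> X))"
  shows "U_scalar X c \<otimes>\<^bsub>U X\<^esub> U_of X f = U_of X (\<lambda>w. c * f w)"
    and "U_of X f \<otimes>\<^bsub>U X\<^esub> U_scalar X c = U_of X (\<lambda>w. c * f w)"
  using assms scaled_closed[OF word_elt_closed[of "[]" "X \<times> X"], of c]
  by (simp_all add: U_scalar_U_of U_of_mult scalar_mult)

section \<open>Representations of general linear Lie superalgebras\<close>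

definition word_act :: "(sym \<Rightarrow> sym \<Rightarrow> 'v \<Rightarrow> 'v) \<Rightarrow> (sym \<times> sym) list \<Rightarrow> 'v \<Rightarrow> 'v" where
  "word_act act ws = foldr (\<lambda>(a, b). act a b) ws"

lemma word_act_simps [simp]:
  "word_act act [] x = x"
  "word_act act ((a, b) # ws) x = act a b (word_act act ws x)"
  "word_act act (us @ ws) x = word_act act us (word_act act ws x)"
  by (simp_all add: word_act_def)

definition comb_act :: "(complex \<Rightarrow> 'v::ab_group_add \<Rightarrow> 'v) \<Rightarrow> (sym \<Rightarrow> sym \<Rightarrow> 'v \<Rightarrow> 'v)
    \<Rightarrow> ((sym \<times> sym) list \<Rightarrow> complex) \<Rightarrow> 'v \<Rightarrow> 'v" where
  "comb_act scl act f x = (\<Sum>w | f w \<noteq> 0. scl (f w) (word_act act w x))"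

text \<open>\<open>U_action\<close> passes only indices to the operators and so cannot tell virtual
  symbols from letters; keeping the symbols gives one notion for both algebras.\<close>

definition U_act :: "(complex \<Rightarrow> 'v::ab_group_add \<Rightarrow> 'v) \<Rightarrow> (sym \<Rightarrow> sym \<Rightarrow> 'v \<Rightarrow> 'v)
    \<Rightarrow> ((sym \<times> sym) list \<Rightarrow> complex) set \<Rightarrow> 'v \<Rightarrow> 'v" where
  "U_act scl act y = comb_act scl act (SOME f. f \<in> y)"

lemma U_action_U_act: "U_action scl E y v = U_act scl (\<lambda>a b. E (idx a) (idx b)) y v"
  by (simp add: U_action_def U_act_def free_action_def comb_act_def word_act_def)

text \<open>The bracket relation is solved for the product \<open>act a b (act c d x)\<close>, the
  form in which the relators of \<open>gl_ideal\<close> act by zero. The symbol set is a parameter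
  because the same Fock operators serve for all symbols and for the letters alone.\<close>

locale super_rep = vector_space scl
  for scl :: "complex \<Rightarrow> 'v::ab_group_add \<Rightarrow> 'v" +
  fixes X :: "sym set" and V :: "'v set" and act :: "sym \<Rightarrow> sym \<Rightarrow> 'v \<Rightarrow> 'v"
  assumes subspace_V: "subspace V"
    and act_closed [simp]: "a \<in> X \<Longrightarrow> b \<in> X \<Longrightarrow> x \<in> V \<Longrightarrow> act a b x \<in> V"
    and act_add: "a \<in> X \<Longrightarrow> b \<in> X \<Longrightarrow> x \<in> V \<Longrightarrow> y \<in> V \<Longrightarrow> act a b (x + y) = act a b x + act a b y"
    and act_scale: "a \<in> X \<Longrightarrow> b \<in> X \<Longrightarrow> x \<in> V \<Longrightarrow> act a b (scl k x) = scl k (act a b x)"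
    and act_bracket: "a \<in> X \<Longrightarrow> b \<in> X \<Longrightarrow> c \<in> X \<Longrightarrow> d \<in> X \<Longrightarrow> x \<in> V \<Longrightarrow>
      act a b (act c d x) = scl (gl_sign (a, b) (c, d)) (act c d (act a b x))
        + ((if b = c then act a d x else 0) - scl (gl_sign (a, b) (c, d)) (if a = d then act c b x else 0))"
begin

abbreviation "F \<equiv> free_alg (X \<times> X)"
abbreviation "word \<equiv> word_act act"
abbreviation "comb \<equiv> comb_act scl act"

lemma V_intros [simp]: "0 \<in> V" "x \<in> V \<Longrightarrow> y \<in> V \<Longrightarrow> x + y \<in> V" "x \<in> V \<Longrightarrow> scl c x \<in> V"
  "x \<in> V \<Longrightarrow> y \<in> V \<Longrightarrow> x - y \<in> V" "(\<And>i. i \<in> A \<Longrightarrow> g i \<in> V) \<Longrightarrow> sum g A \<in> V"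
  using subspace_V by (auto simp: subspace_0 subspace_add subspace_scale subspace_diff subspace_sum)

lemma word_closed [simp]: "ws \<in> lists (X \<times> X) \<Longrightarrow> x \<in> V \<Longrightarrow> word ws x \<in> V"
  by (induction ws) auto

lemma word_linear:
  assumes "ws \<in> lists (X \<times> X)"
  shows "x \<in> V \<Longrightarrow> y \<in> V \<Longrightarrow> word ws (x + y) = word ws x + word ws y"
    and "x \<in> V \<Longrightarrow> word ws (scl c x) = scl c (word ws x)"
  using assms by (induction ws) (simp_all add: act_add act_scale split_paired_all)

lemma word_zero: "ws \<in> lists (X \<times> X) \<Longrightarrow> word ws 0 = 0"
  using word_linear(2)[of ws 0 0] by simp

lemma word_sum:
  assumes "ws \<in> lists (X \<times> X)" "\<And>i. i \<in> A \<Longrightarrow> g i \<in> V"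
  shows "word ws (sum g A) = (\<Sum>i\<in>A. word ws (g i))"
  using assms(2)
  by (induction A rule: infinite_finite_induct) (auto simp: word_zero[OF assms(1)] word_linear(1)[OF assms(1)])

lemma comb_superset:
  assumes "finite A" "{w. f w \<noteq> 0} \<subseteq> A"
  shows "comb f x = (\<Sum>w\<in>A. scl (f w) (word w x))"
  unfolding comb_act_def by (rule sum.mono_neutral_left) (use assms in auto)

lemma comb_closed [simp]: "f \<in> carrier F \<Longrightarrow> x \<in> V \<Longrightarrow> comb f x \<in> V"
  unfolding comb_act_def by (rule V_intros(5)) (auto simp: free_alg_sel subset_iff)

lemma comb_add:
  assumes "f \<in> carrier F" "g \<in> carrier F"
  shows "comb (\<lambda>w. f w + g w) x = comb f x + comb g x"
proof -
  let ?A = "{w. f w \<noteq> 0} \<union> {w. g w \<noteq> 0}"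
  have A: "finite ?A" using assms by (simp add: free_alg_sel)
  show ?thesis
    by (subst (1 2 3) comb_superset[OF A]) (auto simp: sum.distrib scale_left_distrib)
qed

lemma comb_scale:
  assumes "f \<in> carrier F"
  shows "comb (\<lambda>w. c * f w) x = scl c (comb f x)"
proof -
  let ?A = "{w. f w \<noteq> 0}"
  have A: "finite ?A" using assms by (simp add: free_alg_sel)
  show ?thesis
    by (subst (1 2) comb_superset[OF A]) (auto simp: scale_sum_right)
qed

lemma comb_diff:
  assumes "f \<in> carrier F" "g \<in> carrier F"
  shows "comb (\<lambda>w. f w - g w) x = comb f x - comb g x"
  using comb_add[OF assms(1) scaled_closed[OF assms(2), of "-1"]] comb_scale[OF assms(2), of "-1"]
  by simp

lemma comb_word [simp]: "comb (word_elt w) x = word w x"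
  by (subst comb_superset[of "{w}"]) (auto simp: word_elt_def)

lemma comb_zero [simp]: "comb (\<lambda>w. 0) x = 0"
  by (subst comb_superset[of "{}"]) auto

lemma comb_linear:
  assumes f: "f \<in> carrier F"
  shows "x \<in> V \<Longrightarrow> y \<in> V \<Longrightarrow> comb f (x + y) = comb f x + comb f y"
    and "x \<in> V \<Longrightarrow> comb f (scl c x) = scl c (comb f x)"
proof -
  have *: "w \<in> lists (X \<times> X)" if "f w \<noteq> 0" for w
    using f that by (auto simp: free_alg_sel)
  show "comb f (x + y) = comb f x + comb f y" if "x \<in> V" "y \<in> V"
    unfolding comb_act_def sum.distrib[symmetric]
    by (rule sum.cong) (auto simp: word_linear(1)[OF * that] scale_right_distrib)
  show "comb f (scl c x) = scl c (comb f x)" if "x \<in> V"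
    unfolding comb_act_def scale_sum_right
    by (rule sum.cong) (auto simp: word_linear(2)[OF * that] mult.commute)
qed

text \<open>Convolution sums over a word and a cut position, composition over two words. The
  bijection (u, v) -> (u @ v, length u) matches them, and the remaining cut positions contribute
  zero.\<close>

lemma comb_mult:
  assumes f: "f \<in> carrier F" and g: "g \<in> carrier F" and x: "x \<in> V"
  shows "comb (f \<otimes>\<^bsub>F\<^esub> g) x = comb f (comb g x)"
proof -
  let ?f = "{w. f w \<noteq> 0}" and ?g = "{w. g w \<noteq> 0}"
  let ?A = "(\<lambda>(u, v). u @ v) ` (?f \<times> ?g)"
  let ?T = "{(w, k). w \<in> ?A \<and> k \<le> length w \<and> f (take k w) \<noteq> 0 \<and> g (drop k w) \<noteq> 0}"
  have fin: "finite ?f" "finite ?g" and lf: "?f \<subseteq> lists (X \<times> X)" and lg: "?g \<subseteq> lists (X \<times> X)"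
    using f g by (auto simp: free_alg_sel)
  have A: "finite ?A" using fin by simp
  have split: "take (length u) (u @ v) = u" "drop (length u) (u @ v) = v" for u v :: "(sym \<times> sym) list"
    by simp_all
  have "comb f (comb g x) = (\<Sum>u\<in>?f. \<Sum>v\<in>?g. scl (f u * g v) (word (u @ v) x))"
    unfolding comb_act_def
  proof (rule sum.cong[OF refl])
    fix u assume "u \<in> ?f"
    then have u: "u \<in> lists (X \<times> X)" using lf by auto
    have "word u (\<Sum>w\<in>?g. scl (g w) (word w x)) = (\<Sum>w\<in>?g. word u (scl (g w) (word w x)))"
      by (rule word_sum[OF u]) (use lg x in \<open>blast intro: V_intros word_closed\<close>)
    also have "\<dots> = (\<Sum>w\<in>?g. scl (g w) (word (u @ w) x))"
    proof (rule sum.cong[OF refl])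
      fix w assume "w \<in> ?g"
      then have "word w x \<in> V" using lg x by (blast intro: word_closed)
      then show "word u (scl (g w) (word w x)) = scl (g w) (word (u @ w) x)"
        by (simp add: word_linear(2)[OF u])
    qed
    finally show "scl (f u) (word u (\<Sum>w\<in>?g. scl (g w) (word w x)))
        = (\<Sum>v\<in>?g. scl (f u * g v) (word (u @ v) x))"
      by (simp add: scale_sum_right)
  qed
  also have "\<dots> = (\<Sum>(u, v)\<in>?f \<times> ?g. scl (f u * g v) (word (u @ v) x))"
    by (rule sum.cartesian_product)
  also have "\<dots> = (\<Sum>(w, k)\<in>?T. scl (f (take k w) * g (drop k w)) (word w x))"
    by (rule sum.reindex_bij_witness
          [where i = "\<lambda>(w, k). (take k w, drop k w)" and j = "\<lambda>(u, v). (u @ v, length u)"])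
       (auto simp: split simp del: drop_append take_append intro: rev_image_eqI)
  also have "\<dots> = (\<Sum>(w, k)\<in>Sigma ?A (\<lambda>w. {..length w}).
      scl (f (take k w) * g (drop k w)) (word w x))"
  proof (rule sum.mono_neutral_left)
    show "finite (Sigma ?A (\<lambda>w. {..length w}))" using A by (intro finite_SigmaI) auto
    show "?T \<subseteq> Sigma ?A (\<lambda>w. {..length w})" by blast
    show "\<forall>i\<in>Sigma ?A (\<lambda>w. {..length w}) - ?T.
        (case i of (w, k) \<Rightarrow> scl (f (take k w) * g (drop k w)) (word w x)) = 0"
      by auto
  qed
  also have "\<dots> = (\<Sum>w\<in>?A. \<Sum>k\<le>length w. scl (f (take k w) * g (drop k w)) (word w x))"
    by (rule sum.Sigma[symmetric]) (use A in auto)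
  also have "\<dots> = (\<Sum>w\<in>?A. scl (\<Sum>k\<le>length w. f (take k w) * g (drop k w)) (word w x))"
    by (simp add: scale_sum_left)
  also have "\<dots> = comb (f \<otimes>\<^bsub>F\<^esub> g) x"
    by (subst comb_superset[OF A]) (use supp_mult[of f g] in \<open>auto simp: free_alg_sel\<close>)
  finally show ?thesis by simp
qed

lemma comb_relator:
  assumes "p \<in> X \<times> X" "q \<in> X \<times> X" "x \<in> V"
  shows "comb (gl_relator p q) x = 0"
proof -
  obtain a b c d where pq: "p = (a, b)" "q = (c, d)" by (cases p, cases q)
  have cl: "word_elt [p, q] \<in> carrier F" "word_elt [q, p] \<in> carrier F"
    using assms by auto
  have if_cl: "(\<lambda>w. if P then word_elt [(k, l)] w else 0) \<in> carrier F" if "k \<in> X" "l \<in> X" for P k l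
    using that by (cases P) (simp_all add: free_alg_sel(1) word_elt_def)
  have if_comb: "comb (\<lambda>w. if P then word_elt u w else 0) x = (if P then word u x else 0)" for P u
    by (cases P) simp_all
  have X: "a \<in> X" "b \<in> X" "c \<in> X" "d \<in> X" using assms pq by auto
  have bc: "gl_bracket p q \<in> carrier F"
    unfolding gl_bracket_def pq fst_conv snd_conv using X by (intro diff_closed scaled_closed if_cl)
  have b: "comb (gl_bracket p q) x
      = (if b = c then act a d x else 0) - scl (gl_sign p q) (if a = d then act c b x else 0)"
    unfolding gl_bracket_def pq fst_conv snd_conv
    by (simp only: comb_diff comb_scale scaled_closed if_cl if_comb X word_act_simps)
  have "comb (gl_relator p q) x = word [p, q] x - scl (gl_sign p q) (word [q, p] x) - comb (gl_bracket p q) x"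
    unfolding gl_relator_def by (simp only: comb_diff comb_scale diff_closed scaled_closed cl bc comb_word)
  then show ?thesis
    unfolding b using act_bracket[OF X assms(3)] by (simp only: pq word_act_simps) simp
qed

text \<open>The combinations acting by zero on \<open>V\<close> form a two-sided ideal containing
  the relators, hence contain the ideal generated by them.\<close>

lemma comb_ideal:
  assumes "f \<in> gl_ideal X" "x \<in> V"
  shows "comb f x = 0"
proof -
  interpret R: ring F by (rule ring_free_alg)
  let ?K = "{f \<in> carrier F. \<forall>x\<in>V. comb f x = 0}"
  have "ideal ?K F"
  proof (rule idealI[OF ring_free_alg])
    show "subgroup ?K (add_monoid F)"
    proof
      show "?K \<subseteq> carrier (add_monoid F)" by auto
      show "f \<otimes>\<^bsub>add_monoid F\<^esub> g \<in> ?K" if "f \<in> ?K" "g \<in> ?K" for f g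
        using that by (auto simp: free_alg_sel(5) comb_add add_closed)
      show "\<one>\<^bsub>add_monoid F\<^esub> \<in> ?K" using R.zero_closed by (auto simp: free_alg_sel(4))
      show "inv\<^bsub>add_monoid F\<^esub> f \<in> ?K" if "f \<in> ?K" for f
      proof -
        have "inv\<^bsub>add_monoid F\<^esub> f = (\<lambda>w. (-1) * f w)"
          using that free_alg_a_inv[of f "X \<times> X"] by (auto simp: a_inv_def)
        then show ?thesis
          using that comb_scale[of f "-1"] scaled_closed[of f "X \<times> X" "-1"] by auto
      qed
    qed
    show "f \<otimes>\<^bsub>F\<^esub> a \<in> ?K" "a \<otimes>\<^bsub>F\<^esub> f \<in> ?K" if "a \<in> ?K" "f \<in> carrier F" for a f
      using that comb_linear(2)[OF that(2), of 0 0] by (auto simp: comb_mult)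
  qed
  then have "gl_ideal X \<subseteq> ?K"
    unfolding gl_ideal_def
    by (rule R.genideal_minimal) (use comb_relator gl_relator_closed in blast)
  then show ?thesis using assms by auto
qed

abbreviation "uact \<equiv> U_act scl act"

text \<open>The representative hidden in \<open>SOME\<close> differs from \<open>f\<close> by an
  element of the ideal, which acts by zero.\<close>

lemma uact_U_of:
  assumes f: "f \<in> carrier F" and x: "x \<in> V"
  shows "uact (U_of X f) x = comb f x"
proof -
  interpret I: ideal "gl_ideal X" F by (rule gl_ideal_ideal)
  define g where "g = (SOME g. g \<in> U_of X f)"
  have "f \<in> U_of X f"
    unfolding U_of_def by (rule I.a_rcos_self[OF f])
  then have "g \<in> U_of X f" unfolding g_def by (metis someI)
  then obtain i where i: "i \<in> gl_ideal X" "g = i \<oplus>\<^bsub>F\<^esub> f"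
    by (auto simp: U_of_def a_r_coset_def')
  then have "comb g x = comb i x + comb f x"
    using comb_add[OF I.a_Hcarr[OF i(1)] f] by (simp add: free_alg_sel(5))
  then show ?thesis
    using comb_ideal[OF i(1) x] by (simp add: U_act_def g_def)
qed

lemma uact_closed [simp]: "y \<in> carrier (U X) \<Longrightarrow> x \<in> V \<Longrightarrow> uact y x \<in> V"
  by (auto simp: U_carrier uact_U_of)

lemma uact_add: "y \<in> carrier (U X) \<Longrightarrow> z \<in> carrier (U X) \<Longrightarrow> x \<in> V \<Longrightarrow>
    uact (y \<oplus>\<^bsub>U X\<^esub> z) x = uact y x + uact z x"
  by (auto simp: U_carrier uact_U_of U_of_add add_closed comb_add)

lemma uact_minus: "y \<in> carrier (U X) \<Longrightarrow> z \<in> carrier (U X) \<Longrightarrow> x \<in> V \<Longrightarrow>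
    uact (y \<ominus>\<^bsub>U X\<^esub> z) x = uact y x - uact z x"
  by (auto simp: U_carrier uact_U_of U_of_minus diff_closed comb_diff)

lemma uact_mult: "y \<in> carrier (U X) \<Longrightarrow> z \<in> carrier (U X) \<Longrightarrow> x \<in> V \<Longrightarrow>
    uact (y \<otimes>\<^bsub>U X\<^esub> z) x = uact y (uact z x)"
  by (auto simp: U_carrier uact_U_of U_of_mult comb_mult ring.ring_simprules(5)[OF ring_free_alg])

lemma uact_zero: "x \<in> V \<Longrightarrow> uact \<zero>\<^bsub>U X\<^esub> x = 0"
  by (simp add: U_of_zero uact_U_of free_alg_sel)

lemma uact_scalar: "x \<in> V \<Longrightarrow> uact (U_scalar X c) x = scl c x"
  by (simp add: U_scalar_U_of uact_U_of scaled_closed comb_scale)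

lemma uact_prod: "ws \<in> lists (X \<times> X) \<Longrightarrow> x \<in> V \<Longrightarrow> uact (U_prod X ws) x = word ws x"
  by (simp add: U_prod_U_of uact_U_of)

lemma uact_finsum:
  assumes "finite S" "\<And>s. s \<in> S \<Longrightarrow> g s \<in> carrier (U X)" "x \<in> V"
  shows "uact (\<Oplus>\<^bsub>U X\<^esub>s\<in>S. g s) x = (\<Sum>s\<in>S. uact (g s) x)"
proof -
  interpret R: ring "U X" by (rule ring_U)
  show ?thesis
    using assms(1,2)
  proof (induction S)
    case empty
    then show ?case using assms(3) by (simp add: uact_zero)
  next
    case (insert s S)
    then show ?case
      using assms(3) by (simp add: R.finsum_insert R.finsum_closed Pi_iff uact_add)
  qed
qed

end

section \<open>Straightening modulo irregular products\<close>

text \<open>The defining relation with a tail \<open>Y\<close>, ready to rewrite inside longer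
  products. Coefficients appear as \<open>U_scalar\<close> elements because \<open>U X\<close> is
  treated as a ring.\<close>

lemma U_bracket:
  assumes "a \<in> X" "b \<in> X" "c \<in> X" "d \<in> X" "Y \<in> carrier (U X)"
  shows "U_gen X (a, b) \<otimes>\<^bsub>U X\<^esub> (U_gen X (c, d) \<otimes>\<^bsub>U X\<^esub> Y)
    = U_scalar X (gl_sign (a, b) (c, d)) \<otimes>\<^bsub>U X\<^esub> (U_gen X (c, d) \<otimes>\<^bsub>U X\<^esub> (U_gen X (a, b) \<otimes>\<^bsub>U X\<^esub> Y))
      \<oplus>\<^bsub>U X\<^esub> ((if b = c then U_gen X (a, d) \<otimes>\<^bsub>U X\<^esub> Y else \<zero>\<^bsub>U X\<^esub>)
      \<oplus>\<^bsub>U X\<^esub> U_scalar X (- gl_sign (a, b) (c, d)) \<otimes>\<^bsub>U X\<^esub> (if a = d then U_gen X (c, b) \<otimes>\<^bsub>U X\<^esub> Y else \<zero>\<^bsub>U X\<^esub>))"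
proof -
  interpret R: ring "U X" by (rule ring_U)
  let ?F = "free_alg (X \<times> X)" and ?g = "gl_sign (a, b) (c, d)"
  let ?k = "\<lambda>w. (if b = c then word_elt [(a, d)] w else (0::complex))"
  let ?m = "\<lambda>w. (if a = d then word_elt [(c, b)] w else (0::complex))"
  have cl: "word_elt [(x, y)] \<in> carrier ?F" "word_elt [(x, y), (x', y')] \<in> carrier ?F"
    if "x \<in> X" "y \<in> X" "x' \<in> X" "y' \<in> X" for x y x' y'
    using that by simp_all
  have k: "?k \<in> carrier ?F" and m: "?m \<in> carrier ?F"
    using cl(1)[of a d a d] cl(1)[of c b c b] assms ring.ring_simprules(2)[OF ring_free_alg, of "X \<times> X"]
    by (cases "b = c"; cases "a = d"; simp add: free_alg_sel(4))+
  have G: "U_gen X (x, y) \<in> carrier (U X)" if "x \<in> X" "y \<in> X" for x y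
    using that by (simp add: U_gen_U_of cl)
  have Uk: "U_of X ?k = (if b = c then U_gen X (a, d) else \<zero>\<^bsub>U X\<^esub>)"
    and Um: "U_of X ?m = (if a = d then U_gen X (c, b) else \<zero>\<^bsub>U X\<^esub>)"
    by (simp_all add: U_gen_U_of U_of_zero)
  have "U_gen X (a, b) \<otimes>\<^bsub>U X\<^esub> U_gen X (c, d) = U_of X (word_elt [(a, b), (c, d)])"
    using assms by (simp add: U_gen_U_of U_of_mult cl word_elt_mult)
  also have "\<dots> = U_of X (\<lambda>w. ?g * word_elt [(c, d), (a, b)] w + (?k w + (- ?g) * ?m w))"
  proof (rule U_of_eqI)
    show "word_elt [(a, b), (c, d)] \<in> carrier ?F" by (rule cl(2)) (use assms in auto)
    show "(\<lambda>w. ?g * word_elt [(c, d), (a, b)] w + (?k w + (- ?g) * ?m w)) \<in> carrier ?F"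
      by (intro add_closed scaled_closed k m cl(2)) (use assms in auto)
    have "(\<lambda>w. word_elt [(a, b), (c, d)] w - (?g * word_elt [(c, d), (a, b)] w + (?k w + (- ?g) * ?m w)))
        = gl_relator (a, b) (c, d)"
      by (auto simp: gl_relator_def gl_bracket_def fun_eq_iff)
    then show "(\<lambda>w. word_elt [(a, b), (c, d)] w - (?g * word_elt [(c, d), (a, b)] w + (?k w + (- ?g) * ?m w))) \<in> gl_ideal X"
      using gl_relator_in_ideal[of "(a, b)" X "(c, d)"] assms by simp
  qed
  also have "\<dots> = U_of X (\<lambda>w. ?g * word_elt [(c, d), (a, b)] w) \<oplus>\<^bsub>U X\<^esub> (U_of X ?k \<oplus>\<^bsub>U X\<^esub> U_of X (\<lambda>w. (- ?g) * ?m w))"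
    using cl(2)[of c d a b] assms k m by (simp only: U_of_add scaled_closed add_closed)
  also have "U_of X (\<lambda>w. ?g * word_elt [(c, d), (a, b)] w)
      = U_scalar X ?g \<otimes>\<^bsub>U X\<^esub> (U_gen X (c, d) \<otimes>\<^bsub>U X\<^esub> U_gen X (a, b))"
    using assms cl by (simp add: U_gen_U_of U_of_mult word_elt_mult U_scalar_mult)
  also have "U_of X (\<lambda>w. (- ?g) * ?m w) = U_scalar X (- ?g) \<otimes>\<^bsub>U X\<^esub> U_of X ?m"
    using m by (simp only: U_scalar_mult)
  finally have "U_gen X (a, b) \<otimes>\<^bsub>U X\<^esub> U_gen X (c, d) \<otimes>\<^bsub>U X\<^esub> Y
      = (U_scalar X ?g \<otimes>\<^bsub>U X\<^esub> (U_gen X (c, d) \<otimes>\<^bsub>U X\<^esub> U_gen X (a, b))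
        \<oplus>\<^bsub>U X\<^esub> (U_of X ?k \<oplus>\<^bsub>U X\<^esub> U_scalar X (- ?g) \<otimes>\<^bsub>U X\<^esub> U_of X ?m)) \<otimes>\<^bsub>U X\<^esub> Y"
    by simp
  then show ?thesis
    using assms unfolding Uk Um
    by (cases "b = c"; cases "a = d") (simp_all add: R.m_assoc R.l_distr G)
qed

lemma gen_left_ideal_closed:
  shows "s \<in> S \<Longrightarrow> s \<in> gen_left_ideal R S"
    and "x \<in> gen_left_ideal R S \<Longrightarrow> y \<in> gen_left_ideal R S \<Longrightarrow> x \<oplus>\<^bsub>R\<^esub> y \<in> gen_left_ideal R S"
    and "r \<in> carrier R \<Longrightarrow> x \<in> gen_left_ideal R S \<Longrightarrow> r \<otimes>\<^bsub>R\<^esub> x \<in> gen_left_ideal R S"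
    and "\<zero>\<^bsub>R\<^esub> \<in> gen_left_ideal R S"
  unfolding gen_left_ideal_def
  by (auto simp: additive_subgroup.zero_closed intro: additive_subgroup.a_closed)

lemma gen_left_ideal_minimal:
  assumes "additive_subgroup I R" "\<And>r x. r \<in> carrier R \<Longrightarrow> x \<in> I \<Longrightarrow> r \<otimes>\<^bsub>R\<^esub> x \<in> I" "S \<subseteq> I"
  shows "gen_left_ideal R S \<subseteq> I"
  using assms unfolding gen_left_ideal_def by blast

lemma U_gen_closed: "a \<in> X \<Longrightarrow> b \<in> X \<Longrightarrow> U_gen X (a, b) \<in> carrier (U X)"
  by (simp add: U_gen_U_of)

lemma U_prod_closed: "ws \<in> lists (X \<times> X) \<Longrightarrow> U_prod X ws \<in> carrier (U X)"
  by (simp add: U_prod_U_of)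

lemma Irr_carrier: "Irr m0 m1 n \<subseteq> carrier (U (symbols m0 m1 n))"
proof -
  interpret R: ring "U (symbols m0 m1 n)" by (rule ring_U)
  have "additive_subgroup (carrier (U (symbols m0 m1 n))) (U (symbols m0 m1 n))"
    by (rule additive_subgroup.intro) (rule R.add.subgroup_self)
  then show ?thesis
    unfolding Irr_def Let_def by (rule gen_left_ideal_minimal) (use U_prod_closed in blast)+
qed

lemma letters_subset: "letters n \<subseteq> symbols m0 m1 n"
  by (auto simp: symbols_def)

lemma U_prod_Cons: "U_prod X (p # ws) = U_gen X p \<otimes>\<^bsub>U X\<^esub> U_prod X ws"
  by (simp add: U_prod_def)

lemma U_prod_append:
  assumes "us \<in> lists (X \<times> X)" "ws \<in> lists (X \<times> X)"
  shows "U_prod X us \<otimes>\<^bsub>U X\<^esub> U_prod X ws = U_prod X (us @ ws)"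
proof -
  have "us @ ws \<in> lists (X \<times> X)" using assms by (simp only: append_in_lists_conv)
  then show ?thesis using assms by (simp only: U_prod_U_of U_of_mult word_elt_closed word_elt_mult)
qed

lemma virtual_not_letter: "is_virtual \<gamma> \<Longrightarrow> a \<in> letters n \<Longrightarrow> \<gamma> \<noteq> a"
  by (auto simp: letters_def)

definition content :: "(sym \<times> sym) list \<Rightarrow> sym \<Rightarrow> int" where
  "content ws \<gamma> = int (length (filter (\<lambda>p. fst p = \<gamma>) ws))"

text \<open>Combinations, modulo \<open>Irr\<close>, of normal words: factors turning letters into
  virtual symbols on the left, factors between letters on the right. \<open>\<kappa>\<close> fixes
  how often each virtual symbol occurs, so if it vanishes on virtual symbols, only words in letters
  remain.\<close>

inductive_set straight :: "nat \<Rightarrow> nat \<Rightarrow> nat \<Rightarrow> (sym \<Rightarrow> int) \<Rightarrow> ((sym \<times> sym) list \<Rightarrow> complex) set set"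
  for m0 m1 n \<kappa> where
  irr: "x \<in> Irr m0 m1 n \<Longrightarrow> x \<in> straight m0 m1 n \<kappa>"
| add: "x \<in> straight m0 m1 n \<kappa> \<Longrightarrow> y \<in> straight m0 m1 n \<kappa> \<Longrightarrow>
    x \<oplus>\<^bsub>U (symbols m0 m1 n)\<^esub> y \<in> straight m0 m1 n \<kappa>"
| scale: "x \<in> straight m0 m1 n \<kappa> \<Longrightarrow>
    U_scalar (symbols m0 m1 n) c \<otimes>\<^bsub>U (symbols m0 m1 n)\<^esub> x \<in> straight m0 m1 n \<kappa>"
| word: "us \<in> lists ({\<gamma> \<in> symbols m0 m1 n. is_virtual \<gamma>} \<times> letters n) \<Longrightarrow> ws \<in> lists (letters n \<times> letters n) \<Longrightarrow>
    (\<And>\<gamma>. is_virtual \<gamma> \<Longrightarrow> content us \<gamma> = \<kappa> \<gamma>) \<Longrightarrow>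
    U_prod (symbols m0 m1 n) (us @ ws) \<in> straight m0 m1 n \<kappa>"

context
  fixes m0 m1 n :: nat and X L and R
  defines "X \<equiv> symbols m0 m1 n" and "L \<equiv> letters n" and "R \<equiv> U X"
begin

interpretation R: ring R unfolding R_def by (rule ring_U)

abbreviation "straight' \<equiv> straight m0 m1 n"

lemmas straight_rules = straight.intros[where ?m0.0 = m0 and ?m1.0 = m1 and n = n, folded X_def L_def, folded R_def]

lemma sub: "L \<subseteq> X" unfolding L_def X_def by (rule letters_subset)

lemma words_in_X: "us \<in> lists ({\<gamma> \<in> X. is_virtual \<gamma>} \<times> L) \<Longrightarrow> ws \<in> lists (L \<times> L) \<Longrightarrow> us @ ws \<in> lists (X \<times> X)"
  using sub by (fastforce simp: in_lists_conv_set)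

lemma straight_cong:
  assumes "x \<in> straight' \<kappa>" "\<And>\<gamma>. is_virtual \<gamma> \<Longrightarrow> \<kappa> \<gamma> = \<kappa>' \<gamma>"
  shows "x \<in> straight' \<kappa>'"
  using assms(1)
  by (induction rule: straight.induct) (use assms(2) in \<open>auto intro: straight.intros\<close>)

lemma straight_carrier: "x \<in> straight' \<kappa> \<Longrightarrow> x \<in> carrier R"
proof (induction rule: straight.induct[where ?m0.0 = m0 and ?m1.0 = m1 and n = n, folded X_def L_def, folded R_def, consumes 1, case_names irr add scale word])
  case (irr x)
  then show ?case using Irr_carrier[of m0 m1 n] by (auto simp: R_def X_def)
next
  case (add x y)
  then show ?case by simp
next
  case (scale x c)
  have "U_scalar X c \<in> carrier R" by (simp add: R_def)
  with scale show ?case by simp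
next
  case (word us ws)
  then show ?case unfolding R_def by (intro U_prod_closed words_in_X)
qed

lemma scalar_left_commute:
  assumes "x \<in> carrier R" "y \<in> carrier R"
  shows "x \<otimes>\<^bsub>R\<^esub> (U_scalar X c \<otimes>\<^bsub>R\<^esub> y) = U_scalar X c \<otimes>\<^bsub>R\<^esub> (x \<otimes>\<^bsub>R\<^esub> y)"
proof -
  have "x \<otimes>\<^bsub>R\<^esub> U_scalar X c = U_scalar X c \<otimes>\<^bsub>R\<^esub> x"
    using assms(1) by (auto simp: R_def U_carrier U_scalar_mult)
  moreover have "U_scalar X c \<in> carrier R" by (simp add: R_def)
  ultimately show ?thesis using assms by (metis R.m_assoc)
qed

text \<open>\<open>Irr\<close> is a left ideal and scalars are central, so left multiplication by
  \<open>g\<close> has to be examined on normal words only.\<close>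

lemma straight_mult:
  assumes g: "g \<in> carrier R"
    and words: "\<And>us ws. us \<in> lists ({\<gamma> \<in> X. is_virtual \<gamma>} \<times> L) \<Longrightarrow> ws \<in> lists (L \<times> L) \<Longrightarrow>
      (\<And>\<gamma>. is_virtual \<gamma> \<Longrightarrow> content us \<gamma> = \<kappa> \<gamma>) \<Longrightarrow> g \<otimes>\<^bsub>R\<^esub> U_prod X (us @ ws) \<in> straight' \<kappa>'"
    and x: "x \<in> straight' \<kappa>"
  shows "g \<otimes>\<^bsub>R\<^esub> x \<in> straight' \<kappa>'"
  using x
proof (induction rule: straight.induct[where ?m0.0 = m0 and ?m1.0 = m1 and n = n, folded X_def L_def, folded R_def, consumes 1, case_names irr add scale word])
  case (irr x)
  then have "g \<otimes>\<^bsub>R\<^esub> x \<in> Irr m0 m1 n"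
    using gen_left_ideal_closed(3)[of g R x] g unfolding Irr_def Let_def by (simp add: R_def X_def)
  then show ?case by (rule straight_rules(1))
next
  case (add x y)
  then show ?case using straight_carrier g by (simp add: R.r_distr straight_rules(2))
next
  case (scale x c)
  then show ?case using straight_carrier g by (simp add: scalar_left_commute straight_rules(3))
next
  case (word us ws)
  then show ?case by (rule words)
qed

text \<open>The factor moves to the right through the letters. As \<gamma> is not a letter, a
  commutator can only replace \<open>a\<close> by a letter and keeps \<gamma> as second index; at
  the right end the single factor is irregular.\<close>

lemma irr_right:
  assumes "ws \<in> lists (L \<times> L)" "a \<in> X" "\<gamma> \<in> X" "is_virtual \<gamma>"
  shows "U_gen X (a, \<gamma>) \<otimes>\<^bsub>R\<^esub> U_prod X ws \<in> Irr m0 m1 n"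
  using assms(1,2)
proof (induction ws arbitrary: a rule: list.induct)
  case Nil
  have "{j. j \<le> 0 \<and> snd (rev [(a, \<gamma>)] ! j) = \<gamma>} = {0}" by auto
  then have "irregular [(a, \<gamma>)]"
    using assms(4) unfolding irregular_def by (intro exI[of _ 0] conjI exI[of _ \<gamma>]) simp_all
  moreover have "[(a, \<gamma>)] \<in> lists (X \<times> X)" using Nil assms by simp
  ultimately have "U_prod X [(a, \<gamma>)] \<in> Irr m0 m1 n"
    unfolding Irr_def Let_def X_def by (intro gen_left_ideal_closed(1)) auto
  then show ?case by (simp add: U_prod_Cons R_def)
next
  case (Cons p ws)
  obtain s t where p: "p = (s, t)" by (cases p)
  have st: "s \<in> L" "t \<in> L" "s \<in> X" "t \<in> X" and ws: "ws \<in> lists (L \<times> L)" using Cons.prems(1) p sub by auto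
  have "\<gamma> \<noteq> s" using virtual_not_letter[OF assms(4)] st by (simp add: L_def)
  have Y: "U_prod X ws \<in> carrier R" using words_in_X[of "[]" ws] ws by (simp add: U_prod_closed R_def)
  have G: "U_gen X (s, t) \<in> carrier R" using st by (simp add: U_gen_closed R_def)
  have sc: "U_scalar X c \<in> carrier R" for c by (simp add: R_def)
  have cl: "x \<oplus>\<^bsub>R\<^esub> y \<in> Irr m0 m1 n" "r \<in> carrier R \<Longrightarrow> r \<otimes>\<^bsub>R\<^esub> x \<in> Irr m0 m1 n" "\<zero>\<^bsub>R\<^esub> \<in> Irr m0 m1 n"
    if "x \<in> Irr m0 m1 n" "y \<in> Irr m0 m1 n" for x y r
    using that gen_left_ideal_closed(2-4)[where R = R] unfolding Irr_def Let_def R_def X_def by auto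
  note IH = Cons.IH[OF ws]
  show ?case
    unfolding p U_prod_Cons R_def
    by (subst U_bracket)
       (use st Cons.prems(2) assms(3) Y \<open>\<gamma> \<noteq> s\<close> IH[OF Cons.prems(2)] IH[OF st(3)] cl sc G in \<open>auto simp: R_def\<close>)
qed

text \<open>The new factor passes the virtual factors of \<open>us\<close> one by one; each
  commutator term is a single factor times a shorter word, with the same count of first minus second
  indices. Behind \<open>us\<close>, a virtual \<open>b\<close> gives an element of
  \<open>Irr\<close>, and the other cases are normal words.\<close>

lemma gen_mult_word:
  assumes "us \<in> lists ({\<gamma> \<in> X. is_virtual \<gamma>} \<times> L)" "ws \<in> lists (L \<times> L)" "a \<in> X" "b \<in> X"
  shows "U_gen X (a, b) \<otimes>\<^bsub>R\<^esub> U_prod X (us @ ws)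
    \<in> straight' (\<lambda>\<gamma>. content us \<gamma> + of_bool (\<gamma> = a) - of_bool (\<gamma> = b))"
  using assms(1,3,4)
proof (induction us arbitrary: a b rule: list.induct)
  case Nil
  show ?case
  proof (cases "is_virtual b")
    case True
    then show ?thesis using irr_right[OF assms(2)] Nil by (auto intro: straight_rules(1))
  next
    case False
    have letter: "\<not> is_virtual x \<Longrightarrow> x \<in> X \<Longrightarrow> x \<in> L" for x
      by (auto simp: X_def L_def symbols_def)
    have b: "b \<in> L" using False Nil letter by auto
    show ?thesis
    proof (cases "is_virtual a")
      case True
      have "U_prod X ([(a, b)] @ ws) \<in> straight' (\<lambda>\<gamma>. content [] \<gamma> + of_bool (\<gamma> = a) - of_bool (\<gamma> = b))"
        by (rule straight_rules(4)) (use True Nil b False assms(2) in \<open>auto simp: content_def\<close>)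
      then show ?thesis by (simp add: U_prod_Cons R_def)
    next
      case na: False
      then have a: "a \<in> L" using Nil letter by auto
      have "U_prod X ([] @ ((a, b) # ws)) \<in> straight' (\<lambda>\<gamma>. content [] \<gamma> + of_bool (\<gamma> = a) - of_bool (\<gamma> = b))"
        by (rule straight_rules(4)) (use na Nil a b False assms(2) in \<open>auto simp: content_def\<close>)
      then show ?thesis by (simp add: U_prod_Cons R_def)
    qed
  qed
next
  case (Cons p us)
  obtain c d where p: "p = (c, d)" by (cases p)
  have cd: "c \<in> {\<gamma> \<in> X. is_virtual \<gamma>}" "d \<in> L" "c \<in> X" "d \<in> X" and us: "us \<in> lists ({\<gamma> \<in> X. is_virtual \<gamma>} \<times> L)" using Cons.prems(1) p sub by auto
  note IH = Cons.IH[OF us]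
  have Y: "U_prod X (us @ ws) \<in> carrier R" using words_in_X[OF us assms(2)] by (simp only: U_prod_closed R_def)
  have dv: "\<gamma> \<noteq> d" if "is_virtual \<gamma>" for \<gamma> using virtual_not_letter[OF that] cd(2) by (simp add: L_def)
  let ?\<kappa> = "\<lambda>\<gamma>. content (p # us) \<gamma> + of_bool (\<gamma> = a) - of_bool (\<gamma> = b)"
  \<comment> \<open>The swapped term: since \<open>c\<close> is virtual and \<open>d\<close> a
    letter, e_{c,d} may be put back in front of every normal word.\<close>
  have 1: "U_gen X (c, d) \<otimes>\<^bsub>R\<^esub> (U_gen X (a, b) \<otimes>\<^bsub>R\<^esub> U_prod X (us @ ws)) \<in> straight' ?\<kappa>"
  proof (rule straight_mult[OF _ _ IH[OF Cons.prems(2,3)]])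
    show "U_gen X (c, d) \<in> carrier R" using cd by (simp add: U_gen_closed R_def)
    fix us' ws' assume *: "us' \<in> lists ({\<gamma> \<in> X. is_virtual \<gamma>} \<times> L)" "ws' \<in> lists (L \<times> L)"
      "\<And>\<gamma>. is_virtual \<gamma> \<Longrightarrow> content us' \<gamma> = content us \<gamma> + of_bool (\<gamma> = a) - of_bool (\<gamma> = b)"
    have "U_prod X (((c, d) # us') @ ws') \<in> straight' ?\<kappa>"
    proof (rule straight_rules(4))
      show "(c, d) # us' \<in> lists ({\<gamma> \<in> X. is_virtual \<gamma>} \<times> L)" using cd *(1) by simp
      show "content ((c, d) # us') \<gamma> = ?\<kappa> \<gamma>" if "is_virtual \<gamma>" for \<gamma>
        using *(3)[OF that] by (simp add: content_def p)
    qed (rule *(2))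
    then show "U_gen X (c, d) \<otimes>\<^bsub>R\<^esub> U_prod X (us' @ ws') \<in> straight' ?\<kappa>"
      by (simp add: U_prod_Cons R_def)
  qed
  have 2: "U_gen X (a, d) \<otimes>\<^bsub>R\<^esub> U_prod X (us @ ws) \<in> straight' ?\<kappa>" if "b = c"
    by (rule straight_cong[OF IH[OF Cons.prems(2) cd(4)]]) (use that dv in \<open>auto simp: content_def p\<close>)
  have 3: "U_gen X (c, b) \<otimes>\<^bsub>R\<^esub> U_prod X (us @ ws) \<in> straight' ?\<kappa>" if "a = d"
    by (rule straight_cong[OF IH[OF cd(3) Cons.prems(3)]]) (use that dv in \<open>auto simp: content_def p\<close>)
  have 0: "\<zero>\<^bsub>R\<^esub> \<in> straight' ?\<kappa>"
    by (rule straight_rules(1)) (simp add: Irr_def Let_def R_def X_def gen_left_ideal_closed(4))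
  have "U_gen X (a, b) \<otimes>\<^bsub>R\<^esub> (U_gen X (c, d) \<otimes>\<^bsub>R\<^esub> U_prod X (us @ ws)) \<in> straight' ?\<kappa>"
    unfolding R_def
    by (subst U_bracket)
       (use cd Cons.prems(2,3) Y 0 1 2 3 in \<open>auto simp: R_def[symmetric] intro!: straight_rules(2,3)\<close>)
  then show ?case by (simp add: p U_prod_Cons R_def)
qed

lemma U_prod_straight:
  assumes "ws \<in> lists (X \<times> X)"
  shows "U_prod X ws \<in> straight' (\<lambda>\<gamma>. content ws \<gamma> - int (length (filter (\<lambda>p. snd p = \<gamma>) ws)))"
  using assms
proof (induction ws rule: list.induct)
  case Nil
  have "U_prod X ([] @ []) \<in> straight' (\<lambda>\<gamma>. content [] \<gamma> - int (length (filter (\<lambda>p. snd p = \<gamma>) [])))"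
    by (rule straight_rules(4)) auto
  then show ?case by simp
next
  case (Cons p ws)
  obtain a b where p: "p = (a, b)" by (cases p)
  have ab: "a \<in> X" "b \<in> X" and ws: "ws \<in> lists (X \<times> X)" using Cons.prems p by auto
  show ?case
    unfolding p U_prod_Cons
  proof (fold R_def, rule straight_mult[OF _ _ Cons.IH[OF ws]])
    show "U_gen X (a, b) \<in> carrier R" using ab by (simp add: U_gen_closed R_def)
    fix us' ws' assume *: "us' \<in> lists ({\<gamma> \<in> X. is_virtual \<gamma>} \<times> L)" "ws' \<in> lists (L \<times> L)"
      "\<And>\<gamma>. is_virtual \<gamma> \<Longrightarrow> content us' \<gamma> = content ws \<gamma> - int (length (filter (\<lambda>p. snd p = \<gamma>) ws))"
    show "U_gen X (a, b) \<otimes>\<^bsub>R\<^esub> U_prod X (us' @ ws')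
        \<in> straight' (\<lambda>\<gamma>. content ((a, b) # ws) \<gamma> - int (length (filter (\<lambda>p. snd p = \<gamma>) ((a, b) # ws))))"
      by (rule straight_cong[OF gen_mult_word[OF *(1,2) ab]]) (use *(3) in \<open>auto simp: content_def\<close>)
  qed
qed

text \<open>With all multiplicities zero a normal word has no virtual factor, so \<open>x\<close>
  agrees modulo \<open>Irr\<close> with an element coming from the letters. This is the witness
  behind \<open>virt_proj\<close>.\<close>

lemma straight_zero:
  assumes "x \<in> straight' \<kappa>" "\<And>\<gamma>. is_virtual \<gamma> \<Longrightarrow> \<kappa> \<gamma> = 0"
  shows "\<exists>f\<in>carrier (free_alg (L \<times> L)). x \<ominus>\<^bsub>R\<^esub> U_of X f \<in> Irr m0 m1 n"
  using assms(1)
proof (induction rule: straight.induct[where ?m0.0 = m0 and ?m1.0 = m1 and n = n, folded X_def L_def, folded R_def, consumes 1, case_names irr add scale word])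
  case (irr x)
  then have "x \<in> carrier R" using Irr_carrier[of m0 m1 n] by (auto simp: R_def X_def)
  then have "x \<ominus>\<^bsub>R\<^esub> U_of X (\<lambda>w. 0) = x" using U_of_zero[of X, symmetric] by (simp add: R_def[symmetric] a_minus_def)
  then show ?case using irr ring.ring_simprules(2)[OF ring_free_alg, of "L \<times> L"]
    by (intro bexI[of _ "\<lambda>w. 0"]) (auto simp: free_alg_sel(4))
next
  case (add x y)
  obtain f g where fg: "f \<in> carrier (free_alg (L \<times> L))" "g \<in> carrier (free_alg (L \<times> L))"
    "x \<ominus>\<^bsub>R\<^esub> U_of X f \<in> Irr m0 m1 n" "y \<ominus>\<^bsub>R\<^esub> U_of X g \<in> Irr m0 m1 n"
    using add.IH by blast
  have FX: "f \<in> carrier (free_alg (X \<times> X))" "g \<in> carrier (free_alg (X \<times> X))"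
    using fg(1,2) sub by (fastforce simp: free_alg_sel(1) in_lists_conv_set)+
  obtain h k where hk: "h \<in> carrier (free_alg (X \<times> X))" "x = U_of X h" "k \<in> carrier (free_alg (X \<times> X))" "y = U_of X k"
    using straight_carrier[OF add.hyps(1)] straight_carrier[OF add.hyps(2)] by (auto simp: R_def U_carrier)
  have "x \<oplus>\<^bsub>R\<^esub> y \<ominus>\<^bsub>R\<^esub> U_of X (\<lambda>w. f w + g w) = (x \<ominus>\<^bsub>R\<^esub> U_of X f) \<oplus>\<^bsub>R\<^esub> (y \<ominus>\<^bsub>R\<^esub> U_of X g)"
    using FX hk by (simp add: R_def U_of_add U_of_minus add_closed diff_closed algebra_simps)
  also have "\<dots> \<in> Irr m0 m1 n"
    using gen_left_ideal_closed(2)[where R = R] fg(3,4) unfolding Irr_def Let_def R_def X_def by blast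
  finally show ?case using add_closed[OF fg(1,2)] by blast
next
  case (scale x c)
  obtain f where f: "f \<in> carrier (free_alg (L \<times> L))" "x \<ominus>\<^bsub>R\<^esub> U_of X f \<in> Irr m0 m1 n"
    using scale.IH by blast
  have FX: "f \<in> carrier (free_alg (X \<times> X))"
    using f(1) sub by (fastforce simp: free_alg_sel(1) in_lists_conv_set)
  obtain h where h: "h \<in> carrier (free_alg (X \<times> X))" "x = U_of X h"
    using straight_carrier[OF scale.hyps] by (auto simp: R_def U_carrier)
  have "U_scalar X c \<otimes>\<^bsub>R\<^esub> x \<ominus>\<^bsub>R\<^esub> U_of X (\<lambda>w. c * f w) = U_scalar X c \<otimes>\<^bsub>R\<^esub> (x \<ominus>\<^bsub>R\<^esub> U_of X f)"
    using FX h by (simp add: R_def U_scalar_mult U_of_minus scaled_closed diff_closed algebra_simps)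
  also have "\<dots> \<in> Irr m0 m1 n"
    using gen_left_ideal_closed(3)[where R = R, of "U_scalar X c"] f(2) unfolding Irr_def Let_def R_def X_def by simp
  finally show ?case using scaled_closed[OF f(1)] by blast
next
  case (word us ws)
  have "us = []"
  proof (cases us)
    case (Cons p us')
    then have "is_virtual (fst p)" using word.hyps(1) by auto
    then have "content us (fst p) = 0" using word.hyps(3) assms(2) by simp
    then show ?thesis using Cons by (simp add: content_def)
  qed
  moreover have "U_prod X ws \<in> carrier R" "ws \<in> lists (X \<times> X)"
    using words_in_X[of "[]" ws] word.hyps(2) by (simp_all add: U_prod_closed R_def)
  moreover have "\<zero>\<^bsub>R\<^esub> \<in> Irr m0 m1 n" by (simp add: Irr_def Let_def R_def X_def gen_left_ideal_closed(4))
  ultimately show ?case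
    using word.hyps(2) by (intro bexI[of _ "word_elt ws"]) (simp_all add: U_prod_U_of[symmetric] a_minus_def R.r_neg)
qed

end

section \<open>The virtual projection\<close>

lemma gl_ideal_add: "f \<in> gl_ideal X \<Longrightarrow> g \<in> gl_ideal X \<Longrightarrow> (\<lambda>w. f w + g w) \<in> gl_ideal X"
  using additive_subgroup.a_closed[OF ideal.axioms(1)[OF gl_ideal_ideal], of f X g]
  by (simp add: free_alg_sel(5))

lemma gl_ideal_zero: "(\<lambda>w. 0) \<in> gl_ideal X"
  using additive_subgroup.zero_closed[OF ideal.axioms(1)[OF gl_ideal_ideal], of X]
  by (simp add: free_alg_sel(4))

lemma gl_ideal_minus:
  assumes "f \<in> gl_ideal X"
  shows "(\<lambda>w. - f w) \<in> gl_ideal X"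
proof -
  interpret I: ideal "gl_ideal X" "free_alg (X \<times> X)" by (rule gl_ideal_ideal)
  have "(\<lambda>w. - f w) = (\<lambda>w. (-1) * word_elt [] w) \<otimes>\<^bsub>free_alg (X \<times> X)\<^esub> f"
    unfolding scalar_mult by simp
  moreover have "(\<lambda>w. (-1) * word_elt [] w) \<in> carrier (free_alg (X \<times> X))"
    by (rule scaled_closed) simp
  ultimately show ?thesis using I.I_l_closed[OF assms] by metis
qed

text \<open>The part of the larger ideal lying in the smaller free algebra is an ideal there and
  contains the relators of \<open>L\<close>.\<close>

lemma gl_ideal_mono:
  assumes "L \<subseteq> X"
  shows "gl_ideal L \<subseteq> gl_ideal X"
proof -
  interpret FL: ring "free_alg (L \<times> L)" by (rule ring_free_alg)
  interpret I: ideal "gl_ideal X" "free_alg (X \<times> X)" by (rule gl_ideal_ideal)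
  let ?K = "gl_ideal X \<inter> carrier (free_alg (L \<times> L))"
  have FX: "f \<in> carrier (free_alg (X \<times> X))" if "f \<in> carrier (free_alg (L \<times> L))" for f
    using that assms by (fastforce simp: free_alg_sel(1) in_lists_conv_set)
  have "ideal ?K (free_alg (L \<times> L))"
  proof (rule idealI[OF ring_free_alg])
    show "subgroup ?K (add_monoid (free_alg (L \<times> L)))"
    proof
      show "?K \<subseteq> carrier (add_monoid (free_alg (L \<times> L)))" by auto
      show "f \<otimes>\<^bsub>add_monoid (free_alg (L \<times> L))\<^esub> g \<in> ?K" if "f \<in> ?K" "g \<in> ?K" for f g
        using that gl_ideal_add[of f X g] by (auto simp: free_alg_sel(5) add_closed)
      show "\<one>\<^bsub>add_monoid (free_alg (L \<times> L))\<^esub> \<in> ?K"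
        using FL.zero_closed gl_ideal_zero[of X] by (auto simp: free_alg_sel(4))
      show "inv\<^bsub>add_monoid (free_alg (L \<times> L))\<^esub> f \<in> ?K" if "f \<in> ?K" for f
        using that free_alg_a_inv[of f "L \<times> L"] gl_ideal_minus[of f X] scaled_closed[of f "L \<times> L" "-1"]
        by (auto simp: a_inv_def)
    qed
    show "f \<otimes>\<^bsub>free_alg (L \<times> L)\<^esub> a \<in> ?K" "a \<otimes>\<^bsub>free_alg (L \<times> L)\<^esub> f \<in> ?K"
      if "a \<in> ?K" "f \<in> carrier (free_alg (L \<times> L))" for a f
      using that I.I_l_closed[of a f] I.I_r_closed[of a f] FX[of f] FL.m_closed[of f a] FL.m_closed[of a f]
      by (auto simp: free_alg_sel(2))
  qed
  moreover have "{gl_relator x y |x y. x \<in> L \<times> L \<and> y \<in> L \<times> L} \<subseteq> ?K"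
  proof clarify
    fix a b c d assume *: "a \<in> L" "b \<in> L" "c \<in> L" "d \<in> L"
    have "gl_relator (a, b) (c, d) \<in> gl_ideal X"
      by (rule gl_relator_in_ideal) (use * assms in auto)
    moreover have "gl_relator (a, b) (c, d) \<in> carrier (free_alg (L \<times> L))"
      by (rule gl_relator_closed) (use * in auto)
    ultimately show "gl_relator (a, b) (c, d) \<in> ?K" by blast
  qed
  ultimately have "gl_ideal L \<subseteq> ?K"
    unfolding gl_ideal_def[of L] by (rule FL.genideal_minimal)
  then show ?thesis by blast
qed

text \<open>The larger ideal absorbs the smaller one, so the embedding reads the same combination
  over more symbols.\<close>

lemma U_embed_U_of:
  assumes f: "f \<in> carrier (free_alg (letters n \<times> letters n))"
  shows "U_embed m0 m1 n (U_of (letters n) f) = U_of (symbols m0 m1 n) f"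
proof -
  let ?X = "symbols m0 m1 n" and ?L = "letters n"
  have JI: "gl_ideal ?L \<subseteq> gl_ideal ?X" by (rule gl_ideal_mono[OF letters_subset])
  have "\<exists>k\<in>gl_ideal ?X. (\<lambda>w. i w + (j w + f w)) = (\<lambda>w. k w + f w)"
    if "i \<in> gl_ideal ?X" "j \<in> gl_ideal ?L" for i j
    using that gl_ideal_add[of i ?X j] JI by (intro bexI[of _ "\<lambda>w. i w + j w"]) (auto simp: add.assoc)
  moreover have "\<exists>k\<in>gl_ideal ?X. \<exists>j\<in>gl_ideal ?L. (\<lambda>w. i w + f w) = (\<lambda>w. k w + (j w + f w))"
    if "i \<in> gl_ideal ?X" for i
    using that gl_ideal_zero by (intro bexI[of _ i] bexI[of _ "\<lambda>w. 0"]) auto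
  ultimately show ?thesis
    unfolding U_embed_def Let_def U_of_def set_add_def' a_r_coset_def'
    by (auto simp: free_alg_sel(5))
qed

text \<open>If every virtual symbol occurs equally often as first and as second index, straightening
  leaves multiplicities zero, so the choice in \<open>virt_proj\<close> has a witness.\<close>

lemma virt_proj_props:
  assumes "ws \<in> lists (symbols m0 m1 n \<times> symbols m0 m1 n)"
    and "\<And>\<gamma>. is_virtual \<gamma> \<Longrightarrow> length (filter (\<lambda>p. fst p = \<gamma>) ws) = length (filter (\<lambda>p. snd p = \<gamma>) ws)"
  defines "x \<equiv> U_prod (symbols m0 m1 n) ws"
  shows "virt_proj m0 m1 n x \<in> carrier (U (letters n))"
    and "x \<ominus>\<^bsub>U (symbols m0 m1 n)\<^esub> U_embed m0 m1 n (virt_proj m0 m1 n x) \<in> Irr m0 m1 n"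
proof -
  obtain f where f: "f \<in> carrier (free_alg (letters n \<times> letters n))"
    "x \<ominus>\<^bsub>U (symbols m0 m1 n)\<^esub> U_of (symbols m0 m1 n) f \<in> Irr m0 m1 n"
    using straight_zero[OF U_prod_straight[OF assms(1)]] assms(2) unfolding x_def content_def by auto
  then have "U_of (letters n) f \<in> carrier (U (letters n)) \<and>
      x \<ominus>\<^bsub>U (symbols m0 m1 n)\<^esub> U_embed m0 m1 n (U_of (letters n) f) \<in> Irr m0 m1 n"
    by (simp add: U_embed_U_of)
  then have "virt_proj m0 m1 n x \<in> carrier (U (letters n)) \<and>
      x \<ominus>\<^bsub>U (symbols m0 m1 n)\<^esub> U_embed m0 m1 n (virt_proj m0 m1 n x) \<in> Irr m0 m1 n"
    unfolding virt_proj_def by (rule someI)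
  then show "virt_proj m0 m1 n x \<in> carrier (U (letters n))"
    and "x \<ominus>\<^bsub>U (symbols m0 m1 n)\<^esub> U_embed m0 m1 n (virt_proj m0 m1 n x) \<in> Irr m0 m1 n" by auto
qed

section \<open>A Fock space model\<close>

instance sym :: countable by countable_datatype

type_synonym mode = "nat \<times> sym"
type_synonym fstate = "(mode \<Rightarrow> nat) \<times> mode set"
type_synonym fock = "fstate \<Rightarrow> complex"

text \<open>A basis state records the occupation numbers of the even modes and the set of occupied odd
  modes, so the exclusion principle holds by construction. An operator is given by its effect on
  coefficient functions; hence \<open>create m\<close> reads off the coefficient of the state without \<open>m\<close>. The
  odd modes are ordered by their code in order to fix signs.\<close>

definition msgn :: "mode \<Rightarrow> mode set \<Rightarrow> complex" where
  "msgn m A = (- 1) ^ card {k \<in> A. to_nat k < to_nat m}"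

definition create :: "mode \<Rightarrow> fock \<Rightarrow> fock" where
  "create m F = (\<lambda>(N, A).
     if parity (snd m) = 0 then (if N m = 0 then 0 else F (N(m := N m - 1), A))
     else (if m \<in> A then msgn m A * F (N, A - {m}) else 0))"

text \<open>On even modes \<open>create\<close> and \<open>annih\<close> are multiplication by a
  variable and differentiation, hence the factor \<open>N m + 1\<close>; on odd modes they are left
  multiplication and left contraction in an exterior algebra. Each coefficient of the result depends
  on one coefficient of \<open>F\<close>, so arbitrary supports are allowed.\<close>

definition annih :: "mode \<Rightarrow> fock \<Rightarrow> fock" where
  "annih m F = (\<lambda>(N, A).
     if parity (snd m) = 0 then of_nat (N m + 1) * F (N(m := N m + 1), A)
     else (if m \<in> A then 0 else msgn m A * F (N, insert m A)))"

definition fscl :: "complex \<Rightarrow> fock \<Rightarrow> fock" where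
  "fscl c F = (\<lambda>s. c * F s)"

definition psgn :: "sym \<Rightarrow> sym \<Rightarrow> complex" where
  "psgn a b = (- 1) ^ (parity a * parity b)"

lemma parity_cases: "parity a = 0 \<or> parity a = 1"
  by (cases a) auto

lemma psgn_simps [simp]: "psgn a b * psgn a b = 1" "psgn a b * (psgn a b * c) = c"
  unfolding psgn_def by (simp_all flip: power_add mult.assoc)

lemma psgn_commute: "psgn a b = psgn b a"
  by (simp add: psgn_def mult.commute)

text \<open>Moving two operators past two others costs four exchanges of symbols, whose signs
  multiply to the bracket sign.\<close>

lemma gl_sign_psgn: "gl_sign (a, b) (c, d) = psgn b c * psgn a c * psgn b d * psgn a d"
  by (simp add: gl_sign_def psgn_def algebra_simps power_add)

lemma vector_space_fscl: "vector_space fscl"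
  by unfold_locales (auto simp: fscl_def fun_eq_iff algebra_simps)

lemma sum_fun_apply: "(\<Sum>i\<in>I. f i) x = (\<Sum>i\<in>I. f i x)"
  for f :: "'i \<Rightarrow> 'b \<Rightarrow> 'c::comm_monoid_add"
  by (induction I rule: infinite_finite_induct) auto

lemma fscl_simps [simp]: "fscl c (fscl d F) = fscl (c * d) F" "fscl 1 F = F" "fscl c 0 = 0" "fscl 0 F = 0"
  "fscl c (F + G) = fscl c F + fscl c G" "fscl c (F - G) = fscl c F - fscl c G"
  by (auto simp: fscl_def fun_eq_iff algebra_simps)

lemma fscl_sum: "fscl c (sum f I) = (\<Sum>i\<in>I. fscl c (f i))" for f :: "'i \<Rightarrow> fock"
  by (auto simp: fscl_def fun_eq_iff sum_fun_apply sum_distrib_left)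

lemma create_linear [simp]:
  "create m (F + G) = create m F + create m G" "create m (F - G) = create m F - create m G"
  "create m (fscl c F) = fscl c (create m F)" "create m 0 = 0"
  by (auto simp: create_def fscl_def fun_eq_iff algebra_simps)

lemma annih_linear [simp]:
  "annih m (F + G) = annih m F + annih m G" "annih m (F - G) = annih m F - annih m G"
  "annih m (fscl c F) = fscl c (annih m F)" "annih m 0 = 0"
  by (auto simp: annih_def fscl_def fun_eq_iff algebra_simps)

lemma create_sum: "create m (sum f I) = (\<Sum>i\<in>I. create m (f i))" for f :: "'i \<Rightarrow> fock"
  using sum_comp_morphism[of "create m" f I] by (simp add: comp_def)

lemma annih_sum: "annih m (sum f I) = (\<Sum>i\<in>I. annih m (f i))" for f :: "'i \<Rightarrow> fock"
  using sum_comp_morphism[of "annih m" f I] by (simp add: comp_def)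

text \<open>The set of occupied odd modes may be infinite; the order by code leaves finitely many
  modes before \<open>m\<close>, so the exponent in \<open>msgn\<close> is a genuine count.\<close>

lemma finite_before: "finite {k \<in> A. to_nat k < to_nat m}" for A :: "mode set" and m :: mode
proof -
  have "finite (to_nat -` {..<to_nat m} :: mode set)"
    by (rule finite_vimageI) auto
  then show ?thesis by (rule finite_subset[rotated]) (auto simp: less_imp_le)
qed

lemma msgn_square [simp]: "msgn m A * msgn m A = 1" "msgn m A * (msgn m A * c) = c"
  unfolding msgn_def by (simp_all flip: power_add mult.assoc)

lemma msgn_insert:
  "k \<notin> A \<Longrightarrow> msgn m (insert k A) = (if to_nat k < to_nat m then - msgn m A else msgn m A)"
proof -
  assume k: "k \<notin> A"
  have "{l \<in> insert k A. to_nat l < to_nat m}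
      = (if to_nat k < to_nat m then insert k {l \<in> A. to_nat l < to_nat m} else {l \<in> A. to_nat l < to_nat m})"
    by auto
  then show ?thesis using k finite_before[of A m] by (simp add: msgn_def)
qed

lemma msgn_remove:
  "k \<in> A \<Longrightarrow> msgn m (A - {k}) = (if to_nat k < to_nat m then - msgn m A else msgn m A)"
  using msgn_insert[of k "A - {k}" m] by (auto simp: insert_absorb)

lemma to_nat_neq: "\<not> to_nat m < to_nat k \<longleftrightarrow> to_nat k < to_nat m" if "m \<noteq> k" for m k :: mode
proof -
  have "to_nat m \<noteq> to_nat k" using that by simp
  then show ?thesis by linarith
qed

lemma create_create: "create m (create k F) = fscl (psgn (snd m) (snd k)) (create k (create m F))"
proof
  fix s :: fstate
  obtain N A where s: "s = (N, A)" by (cases s)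
  have upd: "N(m := a, k := b) = N(k := b, m := a)" if "m \<noteq> k" for a b
    using that by (simp add: fun_upd_twist)
  have rem: "A - {m} - {k} = A - {k} - {m}" by auto
  show "create m (create k F) s = fscl (psgn (snd m) (snd k)) (create k (create m F)) s"
    using parity_cases[of "snd m"] parity_cases[of "snd k"] to_nat_neq[of m k]
    by (cases "m = k") (auto simp: s create_def psgn_def msgn_remove upd rem fscl_def)
qed

lemma annih_annih: "annih m (annih k F) = fscl (psgn (snd m) (snd k)) (annih k (annih m F))"
proof
  fix s :: fstate
  obtain N A where s: "s = (N, A)" by (cases s)
  have upd: "N(m := a, k := b) = N(k := b, m := a)" if "m \<noteq> k" for a b
    using that by (simp add: fun_upd_twist)
  have ins: "insert m (insert k A) = insert k (insert m A)" by auto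
  show "annih m (annih k F) s = fscl (psgn (snd m) (snd k)) (annih k (annih m F)) s"
    using parity_cases[of "snd m"] parity_cases[of "snd k"] to_nat_neq[of m k]
    by (cases "m = k") (auto simp: s annih_def psgn_def msgn_insert upd ins fscl_def)
qed

lemma annih_create:
  "annih m (create k F) = fscl (psgn (snd m) (snd k)) (create k (annih m F)) + (if m = k then F else 0)"
proof
  fix s :: fstate
  obtain N A where s: "s = (N, A)" by (cases s)
  have upd: "N(m := a, k := b) = N(k := b, m := a)" if "m \<noteq> k" for a b
    using that by (simp add: fun_upd_twist)
  have *: "insert m A - {k} = insert m (A - {k})" if "m \<noteq> k" using that by auto
  show "annih m (create k F) s
      = (fscl (psgn (snd m) (snd k)) (create k (annih m F)) + (if m = k then F else 0)) s"
    using parity_cases[of "snd m"] parity_cases[of "snd k"] to_nat_neq[of m k]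
    by (cases "m = k")
       (auto simp: s annih_def create_def psgn_def msgn_insert msgn_remove upd * insert_absorb fscl_def algebra_simps)
qed

lemma fscl_apply: "fscl c F s = c * F s"
  by (simp add: fscl_def)

text \<open>The pointwise rules also rewrite unapplied sums and differences, which hides them from the
  linearity rules.\<close>

lemmas pointwise = plus_fun_apply zero_fun_apply minus_apply uminus_apply fscl_apply

declare plus_fun_apply [simp del] zero_fun_apply [simp del] minus_apply [simp del] uminus_apply [simp del]

text \<open>The polarization operator: \<open>b\<close> is replaced by \<open>a\<close> inside one
  row, summed over the rows. Nothing passes from one row to another.\<close>

definition fock_act :: "nat \<Rightarrow> sym \<Rightarrow> sym \<Rightarrow> fock \<Rightarrow> fock" where
  "fock_act l a b F = (\<Sum>r=1..l. create (r, a) (annih (r, b) F))"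

lemma fock_act_linear [simp]:
  "fock_act l a b (F + G) = fock_act l a b F + fock_act l a b G"
  "fock_act l a b (F - G) = fock_act l a b F - fock_act l a b G"
  "fock_act l a b (fscl c F) = fscl c (fock_act l a b F)" "fock_act l a b 0 = 0"
  by (simp_all add: fock_act_def sum.distrib sum_subtractf fscl_sum)

text \<open>Exchanging an annihilation with a creation happens twice and produces the two delta
  terms; the exchanges in between contribute signs only.\<close>

lemma create_annih_commute:
  fixes F :: fock and m1 m2 m3 m4 :: mode
  defines "g \<equiv> gl_sign (snd m1, snd m2) (snd m3, snd m4)"
  shows "create m1 (annih m2 (create m3 (annih m4 F)))
    = fscl g (create m3 (annih m4 (create m1 (annih m2 F))))
      + ((if m2 = m3 then create m1 (annih m4 F) else 0)
         - fscl g (if m1 = m4 then create m3 (annih m2 F) else 0))"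
proof -
  let ?p = "\<lambda>m k. psgn (snd m) (snd k)"
  have g: "g = ?p m2 m3 * ?p m1 m3 * ?p m2 m4 * ?p m1 m4"
    by (simp add: g_def gl_sign_psgn)
  have 1: "create m1 (annih m2 (create m3 (annih m4 F)))
      = fscl (?p m2 m3) (create m1 (create m3 (annih m2 (annih m4 F))))
        + (if m2 = m3 then create m1 (annih m4 F) else 0)"
    by (simp add: annih_create)
  have 2: "create m1 (create m3 (annih m2 (annih m4 F)))
      = fscl (?p m1 m3 * ?p m2 m4) (create m3 (create m1 (annih m4 (annih m2 F))))"
    by (simp add: create_create[of m1 m3] annih_annih[of m2 m4] mult.commute)
  have 3: "create m1 (annih m4 G)
      = fscl (?p m1 m4) (annih m4 (create m1 G)) - fscl (?p m1 m4) (if m1 = m4 then G else 0)" for G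
    by (simp add: annih_create[of m4 m1] psgn_commute[of "snd m4" "snd m1"])
  show ?thesis
    unfolding 1 2 3[of "annih m2 F"] g by (simp add: mult_ac add_diff_eq)
qed

lemma fock_act_bracket:
  "fock_act l a b (fock_act l c d F) = fscl (gl_sign (a, b) (c, d)) (fock_act l c d (fock_act l a b F))
    + ((if b = c then fock_act l a d F else 0)
       - fscl (gl_sign (a, b) (c, d)) (if a = d then fock_act l c b F else 0))"
proof -
  let ?g = "gl_sign (a, b) (c, d)"
  let ?C = "\<lambda>r x. create (r, x)" and ?A = "\<lambda>r x. annih (r, x)"
  have "fock_act l a b (fock_act l c d F)
      = (\<Sum>r=1..l. \<Sum>s=1..l. ?C r a (?A r b (?C s c (?A s d F))))"
    by (simp add: fock_act_def create_sum annih_sum)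
  also have "\<dots> = (\<Sum>r=1..l. \<Sum>s=1..l. fscl ?g (?C s c (?A s d (?C r a (?A r b F))))
      + ((if r = s then (if b = c then ?C r a (?A s d F) else 0) else 0)
         - (if r = s then fscl ?g (if a = d then ?C s c (?A r b F) else 0) else 0)))"
    by (subst create_annih_commute) (auto intro!: sum.cong)
  also have "\<dots> = (\<Sum>r=1..l. \<Sum>s=1..l. fscl ?g (?C s c (?A s d (?C r a (?A r b F)))))
      + ((\<Sum>r=1..l. if b = c then ?C r a (?A r d F) else 0)
        - (\<Sum>r=1..l. fscl ?g (if a = d then ?C r c (?A r b F) else 0)))"
    by (simp add: sum.distrib sum_subtractf sum.delta)
  also have "(\<Sum>r=1..l. \<Sum>s=1..l. fscl ?g (?C s c (?A s d (?C r a (?A r b F)))))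
      = fscl ?g (fock_act l c d (fock_act l a b F))"
    by (subst sum.swap) (simp add: fock_act_def create_sum annih_sum fscl_sum)
  also have "(\<Sum>r=1..l. if b = c then ?C r a (?A r d F) else 0) = (if b = c then fock_act l a d F else 0)"
    by (simp add: fock_act_def)
  also have "(\<Sum>r=1..l. fscl ?g (if a = d then ?C r c (?A r b F) else 0))
      = fscl ?g (if a = d then fock_act l c b F else 0)"
    by (simp add: fock_act_def fscl_sum)
  finally show ?thesis .
qed

lemma fock_rep: "super_rep fscl X UNIV (fock_act l)"
proof -
  interpret vector_space fscl by (rule vector_space_fscl)
  show ?thesis
    by unfold_locales (rule fock_act_bracket | simp add: subspace_UNIV)+
qed

section \<open>Occupation numbers and multiplicities of symbols\<close>

definition occ :: "fstate \<Rightarrow> mode \<Rightarrow> nat" where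
  "occ s m = (if parity (snd m) = 0 then fst s m else if m \<in> snd s then 1 else 0)"

lemma create_support:
  assumes "create m F s \<noteq> 0"
  shows "\<exists>s'. F s' \<noteq> 0 \<and> occ s = (occ s')(m := occ s' m + 1)"
proof (cases "parity (snd m) = 0")
  case True
  then show ?thesis using assms
    by (intro exI[of _ "((fst s)(m := fst s m - 1), snd s)"])
       (auto simp: create_def occ_def fun_eq_iff pointwise split: prod.splits if_splits)
next
  case False
  then show ?thesis using assms
    by (intro exI[of _ "(fst s, snd s - {m})"])
       (auto simp: create_def occ_def fun_eq_iff pointwise split: prod.splits if_splits)
qed

lemma annih_support:
  assumes "annih m F s \<noteq> 0"
  shows "\<exists>s'. F s' \<noteq> 0 \<and> occ s' = (occ s)(m := occ s m + 1)"
proof (cases "parity (snd m) = 0")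
  case True
  then show ?thesis using assms
    by (intro exI[of _ "((fst s)(m := fst s m + 1), snd s)"])
       (auto simp: annih_def occ_def fun_eq_iff pointwise split: prod.splits if_splits)
next
  case False
  then show ?thesis using assms
    by (intro exI[of _ "(fst s, insert m (snd s))"])
       (auto simp: annih_def occ_def fun_eq_iff pointwise split: prod.splits if_splits)
qed

text \<open>\<open>k\<close> is the configuration between annihilation and creation; both states
  arise from it by adding one particle to row \<open>r\<close>.\<close>

lemma fock_act_support:
  assumes "fock_act l a b F s \<noteq> 0"
  shows "\<exists>r\<in>{1..l}. \<exists>s' k. F s' \<noteq> 0 \<and> occ s = k((r, a) := k (r, a) + 1)
    \<and> occ s' = k((r, b) := k (r, b) + 1)"
proof -
  have "\<exists>r\<in>{1..l}. create (r, a) (annih (r, b) F) s \<noteq> 0"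
    using assms by (auto simp: fock_act_def sum_fun_apply intro: ccontr)
  then show ?thesis
    using create_support annih_support by (metis (no_types, lifting))
qed

lemma create_annih_same: "create m (annih m F) s = of_nat (occ s m) * F s"
proof -
  have "insert m (A - {m}) = A" if "m \<in> A" for A :: "mode set" using that by auto
  then show ?thesis
    by (auto simp: create_def annih_def occ_def msgn_remove split: prod.splits)
qed

definition deg :: "nat \<Rightarrow> sym \<Rightarrow> fstate \<Rightarrow> nat" where
  "deg l a s = (\<Sum>r=1..l. occ s (r, a))"

text \<open>An integer, so that it may become negative, which forces \<open>F = 0\<close>; the zero
  vector has every degree.\<close>

definition has_deg :: "nat \<Rightarrow> sym \<Rightarrow> int \<Rightarrow> fock \<Rightarrow> bool" where
  "has_deg l a d F \<longleftrightarrow> (\<forall>s. F s \<noteq> 0 \<longrightarrow> int (deg l a s) = d)"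

lemma sum_fun_upd_Suc:
  fixes k :: "mode \<Rightarrow> nat"
  assumes "r \<in> {1..l}"
  shows "(\<Sum>r'=1..l. (k((r, c) := k (r, c) + 1)) (r', a)) = (\<Sum>r'=1..l. k (r', a)) + of_bool (a = c)"
proof -
  have "(\<Sum>r'=1..l. (k((r, c) := k (r, c) + 1)) (r', a))
      = (\<Sum>r'=1..l. k (r', a) + (if r' = r then of_bool (a = c) else 0))"
    by (rule sum.cong) auto
  then show ?thesis using assms by (simp add: sum.distrib sum.delta)
qed

lemma has_deg_act:
  assumes "has_deg l a d F" "d' = d + of_bool (a = b) - of_bool (a = c)"
  shows "has_deg l a d' (fock_act l b c F)"
  unfolding has_deg_def
proof (intro allI impI)
  fix s assume "fock_act l b c F s \<noteq> 0"
  from fock_act_support[OF this] obtain r s' k where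
    r: "r \<in> {1..l}" and s': "F s' \<noteq> 0" and o: "occ s = k((r, b) := k (r, b) + 1)"
       "occ s' = k((r, c) := k (r, c) + 1)"
    by blast
  have "deg l a s = (\<Sum>r'=1..l. k (r', a)) + of_bool (a = b)"
    and "deg l a s' = (\<Sum>r'=1..l. k (r', a)) + of_bool (a = c)"
    unfolding deg_def o by (rule sum_fun_upd_Suc[OF r])+
  moreover have "int (deg l a s') = d" using assms(1) s' unfolding has_deg_def by blast
  ultimately show "int (deg l a s) = d'" using assms(2) by simp
qed

lemma has_deg_neg: "has_deg l a d F \<Longrightarrow> d < 0 \<Longrightarrow> F = 0"
  by (force simp: has_deg_def fun_eq_iff pointwise)

lemma has_deg_kill:
  assumes "has_deg l b d F" "d \<le> 0"
  shows "fock_act l c b F = 0"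
proof (rule ccontr)
  assume "fock_act l c b F \<noteq> 0"
  then obtain s where "fock_act l c b F s \<noteq> 0" by (auto simp: fun_eq_iff pointwise)
  from fock_act_support[OF this] obtain r s' k where
    r: "r \<in> {1..l}" and s': "F s' \<noteq> 0" and o: "occ s' = k((r, b) := k (r, b) + 1)"
    by blast
  have "deg l b s' > 0"
    unfolding deg_def o sum_fun_upd_Suc[OF r] by simp
  moreover have "int (deg l b s') = d" using assms(1) s' unfolding has_deg_def by blast
  ultimately show False using assms(2) by simp
qed

lemma has_deg_diag:
  assumes "has_deg l a d F"
  shows "fock_act l a a F = fscl (of_int d) F"
proof
  fix s
  have "fock_act l a a F s = of_nat (deg l a s) * F s"
    by (simp add: fock_act_def sum_fun_apply create_annih_same deg_def sum_distrib_right)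
  moreover have "F s \<noteq> 0 \<Longrightarrow> of_nat (deg l a s) = (of_int d :: complex)"
    using assms by (metis has_deg_def of_int_of_nat_eq)
  ultimately show "fock_act l a a F s = fscl (of_int d) F s"
    by (cases "F s = 0") (auto simp: fscl_apply)
qed

lemma has_deg_word:
  assumes "has_deg l a d F"
  shows "has_deg l a (d + int (length (filter (\<lambda>p. fst p = a) ws)) - int (length (filter (\<lambda>p. snd p = a) ws)))
    (word_act (fock_act l) ws F)"
proof (induction ws)
  case Nil
  then show ?case using assms by simp
next
  case (Cons p ws)
  show ?case
    by (cases p) (auto intro!: has_deg_act[OF Cons])
qed

lemma irregular_kills:
  assumes F: "\<And>\<gamma>. is_virtual \<gamma> \<Longrightarrow> has_deg l \<gamma> 0 F" and irr: "irregular ws"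
  shows "word_act (fock_act l) ws F = 0"
proof -
  from irr obtain i \<gamma> where i: "i < length ws" and v: "is_virtual \<gamma>"
    and c: "card {j. j \<le> i \<and> snd (rev ws ! j) = \<gamma>} > card {j. j < i \<and> fst (rev ws ! j) = \<gamma>}"
    unfolding irregular_def by blast
  define vs where "vs = drop (length ws - i) ws"
  define us where "us = take (length ws - Suc i) ws"
  define p where "p = ws ! (length ws - Suc i)"
  have ws: "ws = us @ p # vs"
    unfolding us_def vs_def p_def using i
    by (metis Suc_diff_Suc diff_less id_take_nth_drop length_greater_0_conv less_nat_zero_code zero_less_Suc gr_zeroI list.size(3))
  have len: "length vs = i" using i by (simp add: vs_def)
  have rv: "rev ws ! j = rev vs ! j" if "j < i" for j
    using that len by (simp add: ws nth_append)
  have rp: "rev ws ! i = p" using len by (simp add: ws nth_append)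
  have filt: "card {j. j < i \<and> Q (rev ws ! j)} = length (filter Q vs)" for Q
  proof -
    have "{j. j < i \<and> Q (rev ws ! j)} = {j. j < length (rev vs) \<and> Q (rev vs ! j)}"
      using rv len by auto
    then show ?thesis
      by (simp add: length_filter_conv_card[symmetric] rev_filter[symmetric] del: length_rev)
         (simp add: rev_filter[symmetric])
  qed
  have "{j. j \<le> i \<and> snd (rev ws ! j) = \<gamma>} = {j. j < i \<and> snd (rev ws ! j) = \<gamma>} \<union> (if snd p = \<gamma> then {i} else {})"
    using rp by (auto simp: le_less)
  then have "card {j. j \<le> i \<and> snd (rev ws ! j) = \<gamma>}
      = card {j. j < i \<and> snd (rev ws ! j) = \<gamma>} + of_bool (snd p = \<gamma>)"
    by (auto simp: card_insert_if)
  then have c': "length (filter (\<lambda>p. snd p = \<gamma>) vs) + of_bool (snd p = \<gamma>) > length (filter (\<lambda>p. fst p = \<gamma>) vs)"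
    using c filt[of "\<lambda>p. snd p = \<gamma>"] filt[of "\<lambda>p. fst p = \<gamma>"] by simp
  let ?d = "0 + int (length (filter (\<lambda>p. fst p = \<gamma>) vs)) - int (length (filter (\<lambda>p. snd p = \<gamma>) vs))"
  have d: "has_deg l \<gamma> ?d (word_act (fock_act l) vs F)"
    by (rule has_deg_word[OF F[OF v]])
  interpret super_rep fscl UNIV UNIV "fock_act l" by (rule fock_rep)
  have "fock_act l (fst p) (snd p) (word_act (fock_act l) vs F) = 0"
  \<comment> \<open>Before this factor the multiplicity of \<gamma> is at most 0, and it is already
    negative unless the factor itself removes \<gamma>.\<close>
  proof (cases "snd p = \<gamma>")
    case True
    then show ?thesis using has_deg_kill[OF d, of "fst p"] c' by simp
  next
    case False
    then show ?thesis using has_deg_neg[OF d] c' by simp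
  qed
  then show ?thesis
    unfolding ws by (cases p) (simp add: word_zero)
qed

section \<open>Odd words and the Capelli identity\<close>

lemma fock_act_odd:
  assumes "parity a \<noteq> parity b" "parity c \<noteq> parity d"
  shows "fock_act l a b (fock_act l c d F) = (if b = c then fock_act l a d F else 0)
    + (if a = d then fock_act l c b F else 0) - fock_act l c d (fock_act l a b F)"
proof -
  have "gl_sign (a, b) (c, d) = -1"
    using assms parity_cases[of a] parity_cases[of b] parity_cases[of c] parity_cases[of d]
    by (auto simp: gl_sign_def)
  moreover have "fscl (-1) G = - G" for G by (simp add: fscl_def fun_eq_iff pointwise)
  ultimately show ?thesis by (subst fock_act_bracket) simp
qed

lemma fock_act_even:
  assumes "parity a = parity b"
  shows "fock_act l a b (fock_act l c d F) = fock_act l c d (fock_act l a b F)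
    + (if b = c then fock_act l a d F else 0) - (if a = d then fock_act l c b F else 0)"
proof -
  have "gl_sign (a, b) (c, d) = 1"
    using assms parity_cases[of a] parity_cases[of b]
    by (auto simp: gl_sign_def)
  then show ?thesis by (subst fock_act_bracket) (simp add: add_diff_eq)
qed

text \<open>The operators indexed by such a set are odd and pairwise anticommuting.\<close>

definition isotropic :: "(sym \<times> sym) set \<Rightarrow> bool" where
  "isotropic P \<longleftrightarrow> (\<forall>(a, b)\<in>P. parity a \<noteq> parity b) \<and> fst ` P \<inter> snd ` P = {}"

lemma isotropic_subset: "isotropic P \<Longrightarrow> Q \<subseteq> P \<Longrightarrow> isotropic Q"
  unfolding isotropic_def by blast

lemma isotropic_anticommute:
  assumes "isotropic P" "(a, b) \<in> P" "(c, d) \<in> P"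
  shows "fock_act l a b (fock_act l c d F) = - fock_act l c d (fock_act l a b F)"
proof -
  have "parity a \<noteq> parity b" "parity c \<noteq> parity d" "b \<noteq> c" "a \<noteq> d"
    using assms unfolding isotropic_def by (force simp: image_iff)+
  then show ?thesis by (subst fock_act_odd) auto
qed

lemma fscl_add: "fscl a F + fscl b F = fscl (a + b) F"
  by (simp add: fscl_def fun_eq_iff pointwise algebra_simps)

lemma fscl_minus_one: "fscl (-1) F = - F"
  by (simp add: fscl_def fun_eq_iff pointwise)

lemma fock_act_uminus [simp]: "fock_act l a b (- F) = - fock_act l a b F"
  using fock_act_linear(3)[of l a b "-1" F] by (simp only: fscl_minus_one)

lemma self_neg_zero: "F = - F \<Longrightarrow> F = (0 :: fock)"
  by (simp add: fun_eq_iff pointwise)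

lemma isotropic_move:
  assumes "isotropic P" "(a, b) \<in> P" "set us \<subseteq> P"
  shows "word_act (fock_act l) us (fock_act l a b F)
    = fscl ((-1) ^ length us) (fock_act l a b (word_act (fock_act l) us F))"
  using assms(3)
proof (induction us)
  case (Cons p us)
  then show ?case
    using isotropic_anticommute[OF assms(1,2), of "fst p" "snd p"]
    by (cases p) (simp flip: fscl_minus_one)
qed simp

text \<open>Anticommuting up to the equal factor produces the square of an odd operator, which
  equals its own negative.\<close>

lemma isotropic_repeat:
  assumes "isotropic P" "(a, b) \<in> set ws" "set ws \<subseteq> P"
  shows "fock_act l a b (word_act (fock_act l) ws F) = 0"
  using assms(2,3)
proof (induction ws)
  case (Cons p ws)
  obtain c d where p: "p = (c, d)" by (cases p)
  have ab: "(a, b) \<in> P" "(c, d) \<in> P" using Cons.prems p by auto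
  show ?case
  proof (cases "p = (a, b)")
    case True
    then show ?thesis
      using self_neg_zero[OF isotropic_anticommute[OF assms(1) ab(1) ab(1)]] by simp
  next
    case False
    then have "fock_act l a b (word_act (fock_act l) ws F) = 0" using Cons by auto
    then show ?thesis
      using isotropic_anticommute[OF assms(1) ab] by (simp add: p)
  qed
qed simp

text \<open>A derivation that turns every factor into one already present further right kills the word.\<close>

lemma even_kills_word:
  assumes par: "parity a = parity b" and iso: "isotropic P" "set ws \<subseteq> P"
    and x: "fock_act l a b F = 0"
    and suffix: "\<And>us c d vs. ws = us @ (c, d) # vs \<Longrightarrow> (b = c \<longrightarrow> (a, d) \<in> set vs) \<and> (a = d \<longrightarrow> (c, b) \<in> set vs)"
  shows "fock_act l a b (word_act (fock_act l) ws F) = 0"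
  using iso(2) suffix
proof (induction ws)
  case Nil
  then show ?case using x by simp
next
  case (Cons p ws)
  obtain c d where p: "p = (c, d)" by (cases p)
  have "fock_act l a b (word_act (fock_act l) ws F) = 0"
  proof (rule Cons.IH)
    show "set ws \<subseteq> P" using Cons.prems(1) by simp
    show "(b = c' \<longrightarrow> (a, d') \<in> set vs) \<and> (a = d' \<longrightarrow> (c', b) \<in> set vs)" if "ws = us @ (c', d') # vs" for us c' d' vs
      using Cons.prems(2)[of "p # us" c' d' vs] that by simp
  qed
  moreover have "b = c \<Longrightarrow> fock_act l a d (word_act (fock_act l) ws F) = 0"
    and "a = d \<Longrightarrow> fock_act l c b (word_act (fock_act l) ws F) = 0"
    using Cons.prems(2)[of "[]" c d ws] Cons.prems(1) isotropic_repeat[OF iso(1), of _ _ ws]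
    by (auto simp: p)
  ultimately show ?case by (simp add: p fock_act_even[OF par])
qed

lemma word_act_fscl: "word_act (fock_act l) ws (fscl c F) = fscl c (word_act (fock_act l) ws F)"
proof -
  interpret super_rep fscl UNIV UNIV "fock_act l" by (rule fock_rep)
  show ?thesis by (rule word_linear(2)) auto
qed

lemma word_act_zero: "word_act (fock_act l) ws 0 = 0"
  using word_act_fscl[of l ws 0 0] by simp

text \<open>The sign of the rearrangement depends on the permutation only, not on the operators.\<close>

lemma isotropic_permute:
  assumes "mset cs' = mset cs"
  shows "\<exists>\<sigma>::complex. \<sigma> * \<sigma> = 1 \<and> (\<forall>f l F. isotropic (f ` set cs) \<longrightarrow>
    word_act (fock_act l) (map f cs') F = fscl \<sigma> (word_act (fock_act l) (map f cs) F))"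
  using assms
proof (induction cs' arbitrary: cs)
  case Nil
  then have "cs = []" by simp
  then show ?case by (intro exI[of _ 1]) simp
next
  case (Cons c cs')
  have "c \<in> set cs" using Cons.prems by (metis list.set_intros(1) set_mset_mset)
  then obtain us vs where cs: "cs = us @ c # vs" by (meson split_list)
  have "mset cs' = mset (us @ vs)" using Cons.prems by (simp add: cs)
  from Cons.IH[OF this] obtain \<sigma> :: complex where \<sigma>: "\<sigma> * \<sigma> = 1"
    "\<And>f l F. isotropic (f ` set (us @ vs)) \<Longrightarrow>
      word_act (fock_act l) (map f cs') F = fscl \<sigma> (word_act (fock_act l) (map f (us @ vs)) F)"
    by blast
  show ?case
  \<comment> \<open>The sign collects the passage of \<open>c\<close> over \<open>us\<close>. It is
    chosen before \<open>f\<close>, hence shared by all families of operators.\<close>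
  proof (intro exI[of _ "\<sigma> * (-1) ^ length us"] conjI allI impI)
    show "\<sigma> * (-1) ^ length us * (\<sigma> * (-1) ^ length us) = 1"
      using \<sigma>(1) by (simp add: mult.assoc mult.left_commute[of _ \<sigma>] flip: power_add)
    have sq: "(-1) ^ length us * (-1) ^ length us = (1::complex)"
      by (simp flip: power_add)
    fix f :: "'a \<Rightarrow> sym \<times> sym" and l F
    assume iso: "isotropic (f ` set cs)"
    have *: "isotropic (f ` set (us @ vs))" by (rule isotropic_subset[OF iso]) (auto simp: cs)
    obtain a b where ab: "f c = (a, b)" by (cases "f c")
    have "(a, b) \<in> f ` set cs" "set (map f us) \<subseteq> f ` set cs"
      using ab by (auto simp: cs image_iff)
    from isotropic_move[OF iso this, of l "word_act (fock_act l) (map f vs) F"]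
    show "word_act (fock_act l) (map f (c # cs')) F
        = fscl (\<sigma> * (-1) ^ length us) (word_act (fock_act l) (map f cs) F)"
      using \<sigma>(2)[OF *, of l F] sq by (simp add: ab cs mult.assoc)
  qed
qed

text \<open>Each factor passes all later ones. The sign depends on the length alone, so two words
  indexed by the same cells carry equal signs.\<close>

lemma isotropic_rev:
  assumes "isotropic P" "set ws \<subseteq> P"
  shows "word_act (fock_act l) (rev ws) F = fscl (\<Prod>i<length ws. (-1) ^ i) (word_act (fock_act l) ws F)"
  using assms(2)
proof (induction ws)
  case (Cons p ws)
  obtain a b where p: "p = (a, b)" by (cases p)
  have "word_act (fock_act l) (rev ws) (fock_act l a b F)
      = fscl ((-1) ^ length (rev ws)) (fock_act l a b (word_act (fock_act l) (rev ws) F))"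
    by (rule isotropic_move[OF assms(1)]) (use Cons.prems p in auto)
  then show ?case using Cons by (simp add: p mult.commute)
qed simp

text \<open>\<open>s j\<close> is not \<open>z\<close> and \<open>s i\<close> is none of the
  \<open>s m\<close>, so all commutators vanish and the operator reaches \<open>x\<close>.\<close>

lemma row_raising_kill:
  assumes par: "parity (s i) = parity (s j)" and ne: "s j \<noteq> z" "\<And>m. m \<in> set js \<Longrightarrow> s m \<noteq> s i"
    and x: "fock_act l (s i) (s j) x = 0"
  shows "fock_act l (s i) (s j) (word_act (fock_act l) (map (\<lambda>m. (z, s m)) js) x) = 0"
  using ne(2)
proof (induction js)
  case Nil
  then show ?case using x by simp
next
  case (Cons m js)
  then have "s i \<noteq> s m" by (metis list.set_intros(1))
  with Cons ne(1) show ?case by (simp add: fock_act_even[OF par])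
qed

text \<open>For s = s_j the middle pair satisfies e_{s,z} e_{z,s} = e_{s,s} + e_{z,z} - e_{z,s}
  e_{s,z}. Here e_{s,s} counts \<open>d j\<close>, e_{z,z} counts the \<open>k - j\<close> copies of
  \<open>z\<close> already created, and the last term vanishes by the raising condition.\<close>

lemma capelli:
  fixes s :: "nat \<Rightarrow> sym" and z :: sym
  assumes inj: "inj s" and par: "\<And>i. parity (s i) \<noteq> parity z"
    and raise: "\<And>i j. i0 \<le> i \<Longrightarrow> i < j \<Longrightarrow> j \<le> k \<Longrightarrow> fock_act l (s i) (s j) x = 0"
    and ds: "\<And>j. i0 \<le> j \<Longrightarrow> j \<le> k \<Longrightarrow> has_deg l (s j) (d j) x" and dz: "has_deg l z 0 x"
    and i0: "i0 \<le> Suc k"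
  shows "word_act (fock_act l) (rev (map (\<lambda>j. (s j, z)) [i0..<Suc k]))
      (word_act (fock_act l) (map (\<lambda>j. (z, s j)) [i0..<Suc k]) x)
    = fscl (\<Prod>j=i0..k. of_int (d j + int (k - j))) x"
proof -
  let ?u = "\<lambda>js. word_act (fock_act l) (map (\<lambda>j. (z, s j)) js) x"
  have eqp: "parity (s i) = parity (s j)" for i j
    using par[of i] par[of j] parity_cases[of "s i"] parity_cases[of "s j"] parity_cases[of z] by auto
  have ne: "s i \<noteq> z" for i using par by metis
  \<comment> \<open>Passing the factor for j leaves the operator from \<open>s j\<close> to
    \<open>s i\<close> with i < j, which kills the rest by \<open>raise\<close>; finally the
    operator removing \<open>z\<close> meets \<open>x\<close>, where \<open>z\<close> is
    absent.\<close>
  have lower: "fock_act l (s i) z (?u js) = 0"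
    if "i0 \<le> i" "\<And>j. j \<in> set js \<Longrightarrow> i < j \<and> j \<le> k" "distinct js" for i js
    using that(2,3)
  proof (induction js)
    case Nil
    then show ?case using has_deg_kill[OF dz] by simp
  next
    case (Cons j js)
    have "fock_act l (s i) (s j) (?u js) = 0"
    proof (rule row_raising_kill)
      show "fock_act l (s i) (s j) x = 0" using raise[of i j] that(1) Cons.prems by auto
      show "s m \<noteq> s i" if "m \<in> set js" for m
        using that Cons.prems(1)[of m] inj by (auto dest: injD)
    qed (use eqp ne in auto)
    moreover have "s i \<noteq> s j" using Cons.prems(1)[of j] inj by (auto dest: injD)
    moreover have "fock_act l (s i) z (?u js) = 0" using Cons by simp
    ultimately show ?case
      using fock_act_odd[of "s i" z z "s j" l "?u js"] par par[symmetric] by simp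
  qed
  have fst0: "filter (\<lambda>p. fst p = s i) (map (\<lambda>j. (z, s j)) js) = []" for i js
    using ne[symmetric] by (simp add: filter_empty_conv)
  have snd0: "filter (\<lambda>p. snd p = z) (map (\<lambda>j. (z, s j)) js) = []" for js
    using ne by (simp add: filter_empty_conv)
  have "word_act (fock_act l) (rev (map (\<lambda>j. (s j, z)) [i..<Suc k])) (?u [i..<Suc k])
      = fscl (\<Prod>j=i..k. of_int (d j + int (k - j))) x" if "i \<le> Suc k" "i0 \<le> i" for i
    using that
  \<comment> \<open>Downward in the lower end: the pair with index \<open>n\<close> stands in the
    middle of the word, and replacing it by a scalar leaves the word for
    \<open>Suc n\<close>.\<close>
  proof (induction i rule: inc_induct)
    case base
    then show ?case by simp
  next
    case (step n)
    let ?v = "?u [Suc n..<Suc k]"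
    have n: "i0 \<le> n" "n \<le> k" using step by auto
    have snd1: "filter (\<lambda>p. snd p = s n) (map (\<lambda>j. (z, s j)) [Suc n..<Suc k]) = []"
      using inj by (auto simp: filter_empty_conv dest: injD)
    have upt: "[n..<Suc k] = n # [Suc n..<Suc k]" using n(2) by (simp add: upt_conv_Cons)
    have "fock_act l (s n) (s n) ?v = fscl (of_int (d n)) ?v"
      using has_deg_diag[OF has_deg_word[OF ds[OF n], of "map (\<lambda>j. (z, s j)) [Suc n..<Suc k]"]]
      by (simp only: fst0 snd1) simp
    moreover have "fock_act l z z ?v = fscl (of_int (int (k - n))) ?v"
      using has_deg_diag[OF has_deg_word[OF dz, of "map (\<lambda>j. (z, s j)) [Suc n..<Suc k]"]]
      by (simp only: snd0) (simp add: filter_True del: upt_Suc)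
    moreover have "fock_act l (s n) z ?v = 0"
      by (rule lower) (use n in auto)
    ultimately have "fock_act l (s n) z (fock_act l z (s n) ?v) = fscl (of_int (d n + int (k - n))) ?v"
      using fock_act_odd[of "s n" z z "s n" l ?v] par par[symmetric]
      by (simp add: fscl_add del: upt_Suc)
    moreover have "word_act (fock_act l) (rev (map (\<lambda>j. (s j, z)) [Suc n..<Suc k])) ?v
        = fscl (\<Prod>j=Suc n..k. of_int (d j + int (k - j))) x"
      using step by simp
    ultimately show ?case
      using n(2) by (simp add: upt word_act_fscl prod.atLeast_Suc_atMost[of n k] del: upt_Suc)
  qed
  then show ?thesis using i0 by blast
qed

section \<open>Partitions and hooks\<close>

lemma part_antimono:
  assumes "is_partition p" "1 \<le> i" "i \<le> i'"
  shows "part p i' \<le> part p i"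
proof (cases "i' \<le> length p \<and> i < i'")
  case True
  then have "p ! (i - 1) \<ge> p ! (i' - 1)"
    using assms sorted_wrt_nth_less[of "(\<ge>)" p "i - 1" "i' - 1"] by (auto simp: is_partition_def)
  then show ?thesis using True assms by (auto simp: Defs.part_def)
next
  case False
  then show ?thesis using assms by (cases "i = i'") (auto simp: Defs.part_def)
qed

lemma part_pos_iff:
  assumes "is_partition p" "1 \<le> i"
  shows "1 \<le> part p i \<longleftrightarrow> i \<le> length p"
proof (cases "i \<le> length p")
  case True
  then have "p ! (i - 1) \<in> set p" using assms(2) by (intro nth_mem) simp
  then have "p ! (i - 1) \<noteq> 0" using assms(1) by (metis is_partition_def)
  then show ?thesis using True assms(2) by (simp add: Defs.part_def)
qed (simp add: Defs.part_def)

text \<open>Both inequalities say that (i, j) is a cell: by monotonicity the rows of length at least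
  j form an initial segment, of size \<open>conj_part p j\<close>.\<close>

lemma conj_part_galois:
  assumes p: "is_partition p" and i: "1 \<le> i" and j: "1 \<le> j"
  shows "j \<le> part p i \<longleftrightarrow> i \<le> conj_part p j"
proof -
  let ?S = "{i. 1 \<le> i \<and> i \<le> length p \<and> j \<le> part p i}"
  have fin: "finite ?S" by (rule finite_subset[of _ "{..length p}"]) auto
  have len: "k \<le> length p" if "1 \<le> k" "j \<le> part p k" for k
    using part_pos_iff[OF p that(1)] that j by simp
  show ?thesis
  proof
    assume ji: "j \<le> part p i"
    have "{1..i} \<subseteq> ?S"
      using ji part_antimono[OF p, of _ i] len by (auto intro: order_trans)
    then have "card {1..i} \<le> card ?S" by (rule card_mono[OF fin])
    then show "i \<le> conj_part p j" by (simp add: conj_part_def)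
  next
    assume ic: "i \<le> conj_part p j"
    show "j \<le> part p i"
    proof (rule ccontr)
      assume n: "\<not> j \<le> part p i"
      have "?S \<subseteq> {1..<i}"
      proof
        fix k assume k: "k \<in> ?S"
        have "\<not> i \<le> k" using part_antimono[OF p i, of k] k n by auto
        then show "k \<in> {1..<i}" using k by auto
      qed
      then have "card ?S \<le> card {1..<i}" by (rule card_mono[rotated]) simp
      then show False using ic i by (simp add: conj_part_def)
    qed
  qed
qed

lemma conj_part_1: "is_partition p \<Longrightarrow> conj_part p 1 = length p"
proof -
  assume p: "is_partition p"
  have "{i. 1 \<le> i \<and> i \<le> length p \<and> 1 \<le> part p i} = {1..length p}"
    using part_pos_iff[OF p] by auto
  then show ?thesis by (simp add: conj_part_def)
qed

lemma partition_eqI: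
  assumes p: "is_partition p" and q: "is_partition q"
    and eq: "\<And>j. 1 \<le> j \<Longrightarrow> conj_part p j = conj_part q j"
  shows "p = q"
proof (rule nth_equalityI)
  show len: "length p = length q" using eq[of 1] conj_part_1[OF p] conj_part_1[OF q] by simp
  fix k assume k: "k < length p"
  have *: "j \<le> part p (Suc k) \<longleftrightarrow> j \<le> part q (Suc k)" if "1 \<le> j" for j
    using conj_part_galois[OF p _ that, of "Suc k"] conj_part_galois[OF q _ that, of "Suc k"] eq[OF that] by simp
  have "part p (Suc k) \<le> part q (Suc k)"
    using *[of "part p (Suc k)"] by (cases "part p (Suc k) = 0") auto
  moreover have "part q (Suc k) \<le> part p (Suc k)"
    using *[of "part q (Suc k)"] by (cases "part q (Suc k) = 0") auto
  ultimately have "part p (Suc k) = part q (Suc k)" by simp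
  then show "p ! k = q ! k" using k len by (simp add: Defs.part_def)
qed

section \<open>Reading orders of the cells\<close>

definition lex_before :: "nat \<times> nat \<Rightarrow> nat \<times> nat \<Rightarrow> bool" where
  "lex_before c d \<longleftrightarrow> fst c < fst d \<or> fst c = fst d \<and> snd c < snd d"

lemma sorted_cells: "sorted_wrt lex_before (cells p)"
proof -
  have "sorted_wrt lex_before (concat (map (\<lambda>i. map (\<lambda>j. (i, j)) [1..<Suc (part p i)]) [1..<Suc L]))" for L
  proof (induction L)
    case (Suc L)
    have "sorted_wrt (\<lambda>x y. lex_before (i, x) (i, y)) [1..<Suc k]" for i k
      by (rule sorted_wrt_mono_rel[OF _ sorted_wrt_upt]) (simp add: lex_before_def)
    with Suc show ?case
      by (auto simp: sorted_wrt_append sorted_wrt_map lex_before_def simp del: upt_Suc)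
         (auto simp: sorted_wrt_append sorted_wrt_map lex_before_def)
  qed simp
  then show ?thesis by (simp add: cells_def)
qed

lemma distinct_cells: "distinct (cells p)"
proof -
  have "sorted_wrt lex_before cs \<Longrightarrow> distinct cs" for cs
    by (induction cs) (auto simp: lex_before_def)
  then show ?thesis using sorted_cells by blast
qed

lemma set_cells: "set (cells p) = {(i, j). 1 \<le> i \<and> i \<le> length p \<and> 1 \<le> j \<and> j \<le> part p i}"
  by (auto simp: cells_def image_iff simp del: upt_Suc)

lemma set_cells_Sigma: "set (cells p) = Sigma {1..length p} (\<lambda>i. {1..part p i})"
  by (auto simp: set_cells)

lemma length_cells: "length (cells p) = sum_list p"
proof -
  have "length (cells p) = (\<Sum>i\<leftarrow>[1..<Suc (length p)]. part p i)"
    by (simp add: cells_def length_concat comp_def del: upt_Suc)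
  also have "\<dots> = (\<Sum>i\<leftarrow>[0..<length p]. part p (Suc i))"
    by (simp add: map_Suc_upt[symmetric] comp_def del: upt_Suc map_Suc_upt)
  also have "map (\<lambda>i. part p (Suc i)) [0..<length p] = p"
    by (rule nth_equalityI) (auto simp: Defs.part_def)
  finally show ?thesis .
qed

lemma card_row: "card {c \<in> set (cells p). fst c = i} = (if 1 \<le> i then part p i else 0)"
proof -
  have "{c \<in> set (cells p). fst c = i} = (if 1 \<le> i then (\<lambda>j. (i, j)) ` {1..part p i} else {})"
    by (auto simp: set_cells Defs.part_def)
  then show ?thesis by (simp add: card_image inj_on_def)
qed

lemma card_column: "1 \<le> j \<Longrightarrow> card {c \<in> set (cells p). snd c = j} = conj_part p j"
proof -
  assume j: "1 \<le> j"
  have "{c \<in> set (cells p). snd c = j} = (\<lambda>i. (i, j)) ` {i. 1 \<le> i \<and> i \<le> length p \<and> j \<le> part p i}"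
    using j by (auto simp: set_cells)
  then show ?thesis by (simp add: card_image inj_on_def conj_part_def)
qed

lemma cells_column_bound: "is_partition p \<Longrightarrow> c \<in> set (cells p) \<Longrightarrow> 1 \<le> snd c \<and> snd c \<le> part p 1"
  using part_antimono[of p 1] by (fastforce simp: set_cells)

lemma sum_columns:
  fixes g :: "nat \<Rightarrow> nat"
  assumes "is_partition p" "part p 1 \<le> n"
  shows "(\<Sum>c\<in>set (cells p). g (snd c)) = (\<Sum>j=1..n. g j * conj_part p j)"
proof -
  have "(\<Sum>c\<in>set (cells p). g (snd c)) = (\<Sum>j=1..n. \<Sum>c | c \<in> set (cells p) \<and> snd c = j. g (snd c))"
    by (rule sum.group[symmetric]) (use cells_column_bound[OF assms(1)] assms(2) in \<open>force+\<close>)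
  also have "\<dots> = (\<Sum>j=1..n. g j * conj_part p j)"
  proof (rule sum.cong[OF refl])
    fix j assume j: "j \<in> {1..n}"
    have "(\<Sum>c | c \<in> set (cells p) \<and> snd c = j. g (snd c)) = (\<Sum>c | c \<in> set (cells p) \<and> snd c = j. g j)"
      by (rule sum.cong) auto
    then show "(\<Sum>c | c \<in> set (cells p) \<and> snd c = j. g (snd c)) = g j * conj_part p j"
      using card_column[of j p] j by simp
  qed
  finally show ?thesis .
qed

text \<open>Row 1 stands rightmost and acts first, so a further row extends the word on the left.
  The shape is a function, so that the columns of a partition can serve as rows as well.\<close>

definition rows_cells :: "(nat \<Rightarrow> nat) \<Rightarrow> nat \<Rightarrow> (nat \<times> nat) list" where
  "rows_cells p L = concat (map (\<lambda>i. map (\<lambda>j. (i, j)) [1..<Suc (p i)]) (rev [1..<Suc L]))"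

lemma rows_cells_Suc: "rows_cells p (Suc L) = map (\<lambda>j. (Suc L, j)) [1..<Suc (p (Suc L))] @ rows_cells p L"
  by (simp add: rows_cells_def)

lemma rows_cells_0 [simp]: "rows_cells p 0 = []"
  by (simp add: rows_cells_def)

lemma set_rows_cells: "set (rows_cells p L) = Sigma {1..L} (\<lambda>i. {1..p i})"
  by (auto simp: rows_cells_def image_iff simp del: upt_Suc)

lemma distinct_rows_cells: "distinct (rows_cells p L)"
proof (induction L)
  case (Suc L)
  then show ?case
    by (auto simp: rows_cells_Suc distinct_map inj_on_def set_rows_cells simp del: upt_Suc)
qed simp

lemma sorted_rows_cells: "sorted_wrt (\<lambda>c d. fst d \<le> fst c) (rows_cells p L)"
proof (induction L)
  case (Suc L)
  have "sorted_wrt (\<lambda>x y. True) xs" for xs :: "nat list" by (induction xs) auto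
  with Suc show ?case
    by (auto simp: rows_cells_Suc sorted_wrt_append sorted_wrt_map set_rows_cells simp del: upt_Suc)
qed simp

lemma upt_suffix:
  assumes "[a..<b] = us @ t # vs" "t < j" "j < b"
  shows "j \<in> set vs"
proof -
  have s: "sorted_wrt (<) (us @ t # vs)" using assms(1) sorted_wrt_upt by metis
  have "t \<in> set [a..<b]" unfolding assms(1) by simp
  then have "j \<in> set [a..<b]" using assms(2,3) by auto
  then have "j \<in> set us \<or> j = t \<or> j \<in> set vs" unfolding assms(1) by auto
  then show ?thesis using s assms(2) by (auto simp: sorted_wrt_append)
qed

text \<open>Row and column lengths are given as functions because the diagram and its transpose are
  both needed. Row i meets \<open>s j\<close> with multiplicity c j - (i - 1), which
  \<open>capelli\<close> turns into the factor (p i - j) + (c j - i) + 1.\<close>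

lemma hook_rows:
  fixes s z :: "nat \<Rightarrow> sym" and p c :: "nat \<Rightarrow> nat"
  defines "f \<equiv> \<lambda>(i, j). (z i, s j)" and "ft \<equiv> \<lambda>(i, j). (s j, z i)"
  assumes inj: "inj s" "inj z" and par: "\<And>i j. parity (s i) \<noteq> parity (z j)"
    and galois: "\<And>i j. 1 \<le> i \<Longrightarrow> i \<le> K \<Longrightarrow> 1 \<le> j \<Longrightarrow> j \<le> p i \<longleftrightarrow> i \<le> c j"
    and raise: "\<And>i j. 1 \<le> i \<Longrightarrow> i < j \<Longrightarrow> j \<le> p 1 \<Longrightarrow> fock_act l (s i) (s j) x = 0"
    and ds: "\<And>j. 1 \<le> j \<Longrightarrow> j \<le> p 1 \<Longrightarrow> has_deg l (s j) (int (c j)) x"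
    and dz: "\<And>i. 1 \<le> i \<Longrightarrow> i \<le> K \<Longrightarrow> has_deg l (z i) 0 x"
  shows "word_act (fock_act l) (map ft (rev (rows_cells p K))) (word_act (fock_act l) (map f (rows_cells p K)) x)
    = fscl (of_nat (\<Prod>i=1..K. \<Prod>j=1..p i. (p i - j) + (c j - i) + 1)) x"
proof -
  define y where "y L = word_act (fock_act l) (map f (rows_cells p L)) x" for L
  have eqp: "parity (s i) = parity (s j)" for i j
    using par[of i 0] par[of j 0] parity_cases[of "s i"] parity_cases[of "s j"] parity_cases[of "z 0"] by auto
  have ne: "s i \<noteq> z j" for i j using par by metis
  \<comment> \<open>From \<open>galois\<close>: a column reaching row m' reaches every row above
    it.\<close>
  have mono: "p m' \<le> p m" if "1 \<le> m" "m \<le> m'" "m' \<le> K" for m m'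
  proof (cases "p m' = 0")
    case False
    then have "m' \<le> c (p m')" using galois[of m' "p m'"] that by simp
    then show ?thesis using galois[of m "p m'"] that False by simp
  qed simp
  have y_Suc: "y (Suc L) = word_act (fock_act l) (map (\<lambda>j. (z (Suc L), s j)) [1..<Suc (p (Suc L))]) (y L)" for L
    by (simp add: y_def rows_cells_Suc f_def comp_def del: upt_Suc)
  have iso: "isotropic (range (\<lambda>j. (z i, s j)))" for i
    using par[symmetric] ne ne[symmetric] by (auto simp: isotropic_def)
  \<comment> \<open>After \<open>L\<close> rows, for a later row \<open>m\<close>: raising operators
    within its length still kill the vector, each \<open>s j\<close> in that range has been consumed
    \<open>L\<close> times, and \<open>z m\<close> is absent.\<close>
  have inv: "(\<forall>i j. 1 \<le> i \<and> i < j \<and> j \<le> p m \<longrightarrow> fock_act l (s i) (s j) (y L) = 0)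
      \<and> (\<forall>j. 1 \<le> j \<and> j \<le> p m \<longrightarrow> has_deg l (s j) (int (c j) - int L) (y L)) \<and> has_deg l (z m) 0 (y L)"
    if "L < m" "m \<le> K" for L m
    using that
  proof (induction L arbitrary: m)
    case 0
    then show ?case using mono[of 1 m] raise ds dz by (auto simp: y_def)
  next
    case (Suc L)
    let ?ws = "map (\<lambda>j. (z (Suc L), s j)) [1..<Suc (p (Suc L))]"
    have IH: "\<And>i j. 1 \<le> i \<Longrightarrow> i < j \<Longrightarrow> j \<le> p m \<Longrightarrow> fock_act l (s i) (s j) (y L) = 0"
        "\<And>j. 1 \<le> j \<Longrightarrow> j \<le> p m \<Longrightarrow> has_deg l (s j) (int (c j) - int L) (y L)" "has_deg l (z m) 0 (y L)"
      using Suc.IH[of m] Suc.prems by auto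
    have pm: "p m \<le> p (Suc L)" using mono[of "Suc L" m] Suc.prems by simp
    have r: "fock_act l (s i) (s j) (y (Suc L)) = 0" if ij: "1 \<le> i" "i < j" "j \<le> p m" for i j
      unfolding y_Suc
    \<comment> \<open>The operator turns the factor ending in \<open>s i\<close> into the one ending
      in \<open>s j\<close>; since i < j and row \<open>Suc L\<close> is long enough, that one
      occurs further right.\<close>
    proof (rule even_kills_word[OF eqp iso[of "Suc L"]])
      show "fock_act l (s i) (s j) (y L) = 0" using IH(1) ij by simp
      show "set ?ws \<subseteq> range (\<lambda>j. (z (Suc L), s j))" by auto
      show "(s j = c' \<longrightarrow> (s i, d) \<in> set vs) \<and> (s i = d \<longrightarrow> (c', s j) \<in> set vs)"
        if ws: "?ws = us @ (c', d) # vs" for us c' d vs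
      proof -
        obtain us' t vs' where upt: "[1..<Suc (p (Suc L))] = us' @ t # vs'" and cd: "c' = z (Suc L)" "d = s t"
          and vs: "vs = map (\<lambda>j. (z (Suc L), s j)) vs'"
          using ws by (auto simp: map_eq_append_conv map_eq_Cons_conv simp del: upt_Suc)
        have "j \<in> set vs'" if "i = t"
          using upt_suffix[OF upt, of j] that ij pm by simp
        then show ?thesis using cd ne vs inj by (auto dest: injD)
      qed
    qed
    have "has_deg l (s j) (int (c j) - int (Suc L)) (y (Suc L))" if j: "1 \<le> j" "j \<le> p m" for j
    proof -
      have "filter (\<lambda>q. fst q = s j) ?ws = []" using ne[symmetric] by (simp add: filter_empty_conv)
      moreover have "length (filter (\<lambda>q. snd q = s j) ?ws) = length (filter (\<lambda>t. t = j) [1..<Suc (p (Suc L))])"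
        using inj by (simp add: filter_map comp_def inj_eq del: upt_Suc)
      moreover have "\<dots> = 1"
      proof -
        have "{t. t = j} \<inter> set [1..<Suc (p (Suc L))] = {j}" using j pm by auto
        then show ?thesis by (subst distinct_length_filter) (simp_all del: upt_Suc)
      qed
      ultimately show ?thesis
        using has_deg_word[OF IH(2)[OF j], of ?ws] unfolding y_Suc by (simp del: upt_Suc add: algebra_simps)
    qed
    moreover have "has_deg l (z m) 0 (y (Suc L))"
    proof -
      have "filter (\<lambda>q. fst q = z m) ?ws = []" "filter (\<lambda>q. snd q = z m) ?ws = []"
        using ne inj Suc.prems by (auto simp: filter_empty_conv dest: injD)
      then show ?thesis using has_deg_word[OF IH(3), of ?ws] unfolding y_Suc by (simp del: upt_Suc)
    qed
    ultimately show ?case using r by blast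
  qed
  have "word_act (fock_act l) (map ft (rev (rows_cells p L))) (y L)
      = fscl (of_nat (\<Prod>i=1..L. \<Prod>j=1..p i. (p i - j) + (c j - i) + 1)) x" if "L \<le> K" for L
    using that
  proof (induction L)
    case 0
    then show ?case by (simp add: y_def)
  next
    case (Suc L)
    let ?k = "p (Suc L)"
    have I: "\<And>i j. 1 \<le> i \<Longrightarrow> i < j \<Longrightarrow> j \<le> ?k \<Longrightarrow> fock_act l (s i) (s j) (y L) = 0"
        "\<And>j. 1 \<le> j \<Longrightarrow> j \<le> ?k \<Longrightarrow> has_deg l (s j) (int (c j) - int L) (y L)" "has_deg l (z (Suc L)) 0 (y L)"
      using inv[of L "Suc L"] Suc.prems by auto
    have "word_act (fock_act l) (rev (map (\<lambda>j. (s j, z (Suc L))) [1..<Suc ?k])) (y (Suc L))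
        = fscl (\<Prod>j=1..?k. of_int ((int (c j) - int L) + int (?k - j))) (y L)"
      unfolding y_Suc by (rule capelli[OF inj(1) par I]) auto
    also have "(\<Prod>j=1..?k. of_int ((int (c j) - int L) + int (?k - j)))
        = (of_nat (\<Prod>j=1..?k. (?k - j) + (c j - Suc L) + 1) :: complex)"
      unfolding of_nat_prod
    proof (rule prod.cong[OF refl])
      fix j assume "j \<in> {1..?k}"
      then have "Suc L \<le> c j" using galois[of "Suc L" j] Suc.prems by simp
      \<comment> \<open>\<open>c j - L\<close> is the leg plus one; the bound on \<open>c j\<close>
        keeps the subtraction of naturals exact.\<close>
      then have "(int (c j) - int L) + int (?k - j) = int ((?k - j) + (c j - Suc L) + 1)" by simp
      then show "of_int ((int (c j) - int L) + int (?k - j)) = (of_nat ((?k - j) + (c j - Suc L) + 1) :: complex)"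
        by (metis of_int_of_nat_eq)
    qed
    finally have "word_act (fock_act l) (rev (map (\<lambda>j. (s j, z (Suc L))) [1..<Suc ?k])) (y (Suc L))
        = fscl (of_nat (\<Prod>j=1..?k. (?k - j) + (c j - Suc L) + 1)) (y L)" .
    moreover have "map ft (rev (rows_cells p (Suc L)))
        = map ft (rev (rows_cells p L)) @ rev (map (\<lambda>j. (s j, z (Suc L))) [1..<Suc ?k])"
      by (simp add: rows_cells_Suc rev_map[symmetric] ft_def comp_def del: upt_Suc)
    ultimately show ?case
      using Suc by (simp add: word_act_fscl mult.commute del: upt_Suc)
  qed
  then show ?thesis by (simp add: y_def)
qed

section \<open>A highest weight vector in the Fock space\<close>

definition ind :: "fstate \<Rightarrow> fock" where
  "ind s = (\<lambda>t. if t = s then 1 else 0)"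

definition row_state :: "nat list \<Rightarrow> fstate" where
  "row_state p = ((\<lambda>(r, a). if a = Alpha r then part p r else 0), {})"

text \<open>Up to a nonzero factor this is the basis state whose row \<open>r\<close> is occupied by
  the letters 1, ..., \<open>part p r\<close>. The cells are reversed so that in each row smaller
  letters stand further right, as \<open>hwv_raise\<close> uses.\<close>

definition hwv :: "nat list \<Rightarrow> fock" where
  "hwv p = word_act (fock_act (length p)) (map (\<lambda>(i, j). (Lett j, Alpha i)) (rev (cells p))) (ind (row_state p))"

lemma occ_row_state: "occ (row_state p) (r, a) = (if a = Alpha r then part p r else 0)"
  by (auto simp: occ_def row_state_def)

lemma has_deg_ind: "has_deg l a (int (deg l a s)) (ind s)"
  by (simp add: has_deg_def ind_def)

lemma deg_row_state: "deg (length p) a (row_state p) = (case a of Alpha i \<Rightarrow> part p i | _ \<Rightarrow> 0)"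
proof (cases a)
  case (Alpha i)
  have "(\<Sum>r=1..length p. if a = Alpha r then part p r else 0) = (\<Sum>r=1..length p. if r = i then part p r else 0)"
    by (rule sum.cong) (auto simp: Alpha)
  then show ?thesis by (auto simp: Alpha deg_def occ_row_state Defs.part_def)
qed (simp_all add: deg_def occ_row_state)

lemma has_deg_family:
  assumes "distinct cs" "has_deg l a d F"
    "d' = d + int (card {c \<in> set cs. fst (g c) = a}) - int (card {c \<in> set cs. snd (g c) = a})"
  shows "has_deg l a d' (word_act (fock_act l) (map g cs) F)"
proof -
  have "length (filter Q (map g cs)) = card {c \<in> set cs. Q (g c)}" for Q
    using assms(1) by (simp add: filter_map comp_def distinct_length_filter Int_def conj_commute)
  then show ?thesis
    using has_deg_word[OF assms(2), of "map g cs"] assms(3) by simp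
qed

lemma has_deg_hwv:
  "1 \<le> j \<Longrightarrow> has_deg (length p) (Lett j) (int (conj_part p j)) (hwv p)"
  "1 \<le> i \<Longrightarrow> has_deg (length p) (Alpha i) 0 (hwv p)"
  "has_deg (length p) (Beta j) 0 (hwv p)"
  using card_column[of j p] card_row[of p i]
  unfolding hwv_def
  by (auto intro!: has_deg_family[OF _ has_deg_ind]
      simp: distinct_cells deg_row_state case_prod_unfold)

lemma has_deg_hwv_virtual: "is_virtual \<gamma> \<Longrightarrow> has_deg (length p) \<gamma> 0 (hwv p)"
proof (cases \<gamma>)
  case (Alpha i)
  show ?thesis
  proof (cases i)
    \<comment> \<open>The datatype also contains \<open>Alpha 0\<close>, which labels no
      row.\<close>
    case 0
    then show ?thesis
      unfolding hwv_def Alpha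
      by (intro has_deg_family[OF _ has_deg_ind])
         (auto simp: distinct_cells deg_row_state case_prod_unfold Defs.part_def card_row)
  qed (use has_deg_hwv(2) Alpha in auto)
qed (use has_deg_hwv in auto)

text \<open>Replacing the letter j by i < j in row r turns the factor of (r, j) into that of (r, i),
  which occurs further right; a repeated odd factor gives zero.\<close>

lemma hwv_raise:
  assumes "1 \<le> i" "i < j"
  shows "fock_act (length p) (Lett i) (Lett j) (hwv p) = 0"
  unfolding hwv_def
proof (rule even_kills_word[of _ _ "range (\<lambda>(i, j). (Lett j, Alpha i))"])
  let ?ws = "map (\<lambda>(i, j). (Lett j, Alpha i)) (rev (cells p))"
  show "parity (Lett i) = parity (Lett j)" by simp
  show "isotropic (range (\<lambda>(i, j). (Lett j, Alpha i)))" by (auto simp: isotropic_def)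
  show "set ?ws \<subseteq> range (\<lambda>(i, j). (Lett j, Alpha i))" by auto
  show "fock_act (length p) (Lett i) (Lett j) (ind (row_state p)) = 0"
    by (rule has_deg_kill[OF has_deg_ind]) (simp add: deg_row_state)
  show "(Lett j = c \<longrightarrow> (Lett i, d) \<in> set vs) \<and> (Lett i = d \<longrightarrow> (c, Lett j) \<in> set vs)"
    if ws: "?ws = us @ (c, d) # vs" for us c d vs
  proof -
    obtain us' r t vs' where cs: "rev (cells p) = us' @ (r, t) # vs'" and cd: "c = Lett t" "d = Alpha r"
      and vs: "vs = map (\<lambda>(i, j). (Lett j, Alpha i)) vs'"
      using ws by (auto simp: map_eq_append_conv map_eq_Cons_conv)
    have "(r, i) \<in> set vs'" if "t = j"
    proof -
      have "(r, j) \<in> set (rev (cells p))" unfolding cs that by simp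
      then have "(r, i) \<in> set (rev (cells p))" using assms by (auto simp: set_cells)
      moreover have "sorted_wrt (\<lambda>x y. lex_before y x) (us' @ (r, j) # vs')"
        using sorted_cells[of p] unfolding cs[symmetric] that[symmetric] by (simp add: sorted_wrt_rev)
      then have "(r, i) \<notin> set us'" using assms by (auto simp: sorted_wrt_append lex_before_def)
      ultimately show ?thesis using assms that by (auto simp: cs)
    qed
    then show ?thesis using cd vs by (auto intro!: bexI[of _ "(r, i)"] simp: image_iff)
  qed
qed

lemma annih_ind:
  assumes "parity (snd m) = 0"
  shows "annih m (ind (N, A)) = (if N m = 0 then 0 else fscl (of_nat (N m)) (ind (N(m := N m - 1), A)))"
proof
  fix t :: fstate
  obtain N' A' where t: "t = (N', A')" by (cases t)
  have "N'(m := Suc (N' m)) = N \<longleftrightarrow> N m \<noteq> 0 \<and> N' = N(m := N m - 1)"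
  proof
    assume h: "N'(m := Suc (N' m)) = N"
    show "N m \<noteq> 0 \<and> N' = N(m := N m - 1)" unfolding h[symmetric] by simp
  qed auto
  then show "annih m (ind (N, A)) t = (if N m = 0 then 0 else fscl (of_nat (N m)) (ind (N(m := N m - 1), A))) t"
    using assms by (auto simp: t annih_def ind_def pointwise)
qed

lemma create_ind:
  assumes "parity (snd m) = 1" "m \<notin> A"
  shows "create m (ind (N, A)) = fscl (msgn m (insert m A)) (ind (N, insert m A))"
proof
  fix t :: fstate
  obtain N' A' where t: "t = (N', A')" by (cases t)
  have "m \<in> A' \<and> A' - {m} = A \<longleftrightarrow> A' = insert m A"
    using assms(2) by auto
  then show "create m (ind (N, A)) t = fscl (msgn m (insert m A)) (ind (N, insert m A)) t"
    using assms by (auto simp: t create_def ind_def pointwise)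
qed

lemma msgn_nonzero: "msgn m A \<noteq> 0"
  by (simp add: msgn_def)

text \<open>The virtual symbol of row \<open>r\<close> occurs in row \<open>r\<close> only, so the word creating \<open>hwv\<close> moves one
  basis state to a multiple of another.\<close>

lemma row_word_ind:
  assumes "distinct cs" "\<And>r. card {c \<in> set cs. fst c = r} \<le> part p r"
  shows "\<exists>k N. k \<noteq> 0 \<and> word_act (fock_act (length p)) (map (\<lambda>(i, j). (Lett j, Alpha i)) cs) (ind (row_state p))
      = fscl k (ind (N, (\<lambda>(i, j). (i, Lett j)) ` set cs))
    \<and> (\<forall>r r'. N (r', Alpha r) = (if r = r' then part p r - card {c \<in> set cs. fst c = r} else 0))"
  using assms
proof (induction cs)
  case Nil
  then show ?case by (intro exI[of _ 1] exI[of _ "fst (row_state p)"]) (auto simp: row_state_def)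
next
  case (Cons c cs)
  obtain r j where c: "c = (r, j)" by (cases c)
  have "{c' \<in> set cs. fst c' = r'} \<subseteq> {c' \<in> set (c # cs). fst c' = r'}" for r' by auto
  then have sub: "card {c' \<in> set cs. fst c' = r'} \<le> card {c' \<in> set (c # cs). fst c' = r'}" for r'
    by (rule card_mono[rotated]) simp
  then have "card {c' \<in> set cs. fst c' = r'} \<le> part p r'" for r'
    using Cons.prems(2)[of r'] order_trans by blast
  from Cons.IH[OF _ this] Cons.prems(1) obtain k N where k: "k \<noteq> 0"
    and W: "word_act (fock_act (length p)) (map (\<lambda>(i, j). (Lett j, Alpha i)) cs) (ind (row_state p))
      = fscl k (ind (N, (\<lambda>(i, j). (i, Lett j)) ` set cs))"
    and N: "\<And>r r'. N (r', Alpha r) = (if r = r' then part p r - card {c \<in> set cs. fst c = r} else 0)"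
    by auto
  let ?A = "(\<lambda>(i, j). (i, Lett j)) ` set cs"
  have "{c' \<in> set (c # cs). fst c' = r} = insert c {c' \<in> set cs. fst c' = r}" using c by auto
  then have card_r: "card {c' \<in> set (c # cs). fst c' = r} = Suc (card {c' \<in> set cs. fst c' = r})"
    using Cons.prems(1) by simp
  have card_other: "card {c' \<in> set (c # cs). fst c' = r'} = card {c' \<in> set cs. fst c' = r'}" if "r' \<noteq> r" for r'
    using that c by (intro arg_cong[where f = card]) auto
  have less: "card {c' \<in> set cs. fst c' = r} < part p r"
    using Cons.prems(2)[of r] card_r by simp
  then have pos: "N (r, Alpha r) \<noteq> 0" using N by simp
  have r: "r \<in> {1..length p}" using less by (auto simp: Defs.part_def split: if_splits)
  have A: "(r, Lett j) \<notin> ?A" using Cons.prems(1) c by auto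
  have "fock_act (length p) (Lett j) (Alpha r) (ind (N, ?A))
      = (\<Sum>r'=1..length p. if r' = r then create (r, Lett j) (annih (r, Alpha r) (ind (N, ?A))) else 0)"
    unfolding fock_act_def by (rule sum.cong) (auto simp: annih_ind N)
  also have "\<dots> = create (r, Lett j) (annih (r, Alpha r) (ind (N, ?A)))"
    using r by (simp add: sum.delta)
  also have "\<dots> = fscl (of_nat (N (r, Alpha r)) * msgn (r, Lett j) (insert (r, Lett j) ?A))
      (ind (N((r, Alpha r) := N (r, Alpha r) - 1), insert (r, Lett j) ?A))"
    using pos A by (simp add: annih_ind create_ind)
  finally have step: "fock_act (length p) (Lett j) (Alpha r) (ind (N, ?A)) = \<dots>" .
  show ?case
  proof (intro exI conjI allI)
    show "k * (of_nat (N (r, Alpha r)) * msgn (r, Lett j) (insert (r, Lett j) ?A)) \<noteq> 0"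
      using k pos msgn_nonzero by simp
    show "word_act (fock_act (length p)) (map (\<lambda>(i, j). (Lett j, Alpha i)) (c # cs)) (ind (row_state p))
        = fscl (k * (of_nat (N (r, Alpha r)) * msgn (r, Lett j) (insert (r, Lett j) ?A)))
            (ind (N((r, Alpha r) := N (r, Alpha r) - 1), (\<lambda>(i, j). (i, Lett j)) ` set (c # cs)))"
      by (simp add: c W step)
    show "(N((r, Alpha r) := N (r, Alpha r) - 1)) (r2, Alpha r1)
        = (if r1 = r2 then part p r1 - card {c' \<in> set (c # cs). fst c' = r1} else 0)" for r1 r2
      using N[of r2 r1] card_r card_other[of r1] by auto
  qed
qed

lemma hwv_nonzero: "hwv p \<noteq> 0"
proof -
  have "\<exists>k N. k \<noteq> 0 \<and> hwv p = fscl k (ind (N, (\<lambda>(i, j). (i, Lett j)) ` set (rev (cells p))))"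
  proof -
    have "distinct (rev (cells p))" "\<And>r. card {c \<in> set (rev (cells p)). fst c = r} \<le> part p r"
      using card_row[of p] by (simp_all add: distinct_cells)
    from row_word_ind[OF this] show ?thesis unfolding hwv_def by blast
  qed
  then obtain k s where "k \<noteq> 0" "hwv p = fscl k (ind s)" by blast
  then have "hwv p s \<noteq> 0" by (simp add: pointwise ind_def)
  then show ?thesis by (auto simp: pointwise)
qed

section \<open>Vanishing of the virtual monomials\<close>

text \<open>Symbols are replaced inside a row, so its total occupation does not change;
  \<open>Y\<close> is a finite set containing the symbols of the word, which makes that total a
  finite sum.\<close>

lemma row_conserved:
  assumes "finite Y" "ws \<in> lists (Y \<times> Y)" "\<And>s. F s \<noteq> 0 \<Longrightarrow> (\<Sum>a\<in>Y. occ s (r, a)) = d"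
    and "word_act (fock_act l) ws F s \<noteq> 0"
  shows "(\<Sum>a\<in>Y. occ s (r, a)) = d"
  using assms(2,4)
proof (induction ws arbitrary: s rule: list.induct)
  case Nil
  then show ?case using assms(3) by simp
next
  case (Cons p ws)
  obtain a b where p: "p = (a, b)" by (cases p)
  then have ab: "a \<in> Y" "b \<in> Y" and ws: "ws \<in> lists (Y \<times> Y)" using Cons.prems(1) by simp_all
  have "fock_act l a b (word_act (fock_act l) ws F) s \<noteq> 0" using Cons.prems(2) p by simp
  from fock_act_support[OF this] obtain r' s' k where
    s': "word_act (fock_act l) ws F s' \<noteq> 0" and o: "occ s = k((r', a) := k (r', a) + 1)"
       "occ s' = k((r', b) := k (r', b) + 1)"
    by blast
  have upd: "(\<Sum>x\<in>Y. (k((r', c) := k (r', c) + 1)) (r, x)) = (\<Sum>x\<in>Y. k (r, x)) + of_bool (r = r')" if "c \<in> Y" for c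
  proof -
    have "(\<Sum>x\<in>Y. (k((r', c) := k (r', c) + 1)) (r, x)) = (\<Sum>x\<in>Y. k (r, x) + (if x = c then of_bool (r = r') else 0))"
      by (rule sum.cong) auto
    then show ?thesis using that assms(1) by (simp add: sum.distrib sum.delta)
  qed
  show ?case
    using Cons.IH[OF ws s'] upd[OF ab(1)] upd[OF ab(2)] unfolding o by simp
qed

text \<open>Meant for the column indices of distinct odd modes in one row. If \<open>Suc m\<close>
  is in \<open>T\<close>, removing it lowers the left side by \<open>card T\<close>, which is at
  most \<open>Suc m\<close>.\<close>

lemma sum_initial_le:
  fixes T :: "nat set"
  assumes "T \<subseteq> {1..m}"
  shows "\<Sum>{1..card T} \<le> \<Sum>T"
  using assms
proof (induction m arbitrary: T)
  case (Suc m)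
  have fin: "finite T" using Suc.prems finite_subset by blast
  show ?case
  proof (cases "Suc m \<in> T")
    case False
    then have "T \<subseteq> {1..m}" using Suc.prems by (auto simp: le_Suc_eq)
    then show ?thesis by (rule Suc.IH)
  next
    case True
    let ?T = "T - {Suc m}"
    have "?T \<subseteq> {1..m}" using Suc.prems by (auto simp: le_Suc_eq)
    then have "\<Sum>{1..card ?T} \<le> \<Sum>?T" by (rule Suc.IH)
    moreover have "card T = Suc (card ?T)" using fin True by (metis card_Suc_Diff1)
    moreover have "card T \<le> Suc m" using card_mono[OF _ Suc.prems] by simp
    moreover have "\<Sum>T = Suc m + \<Sum>?T" using fin True by (rule sum.remove)
    ultimately show ?thesis by simp
  qed
qed simp

lemma row_strict_ge:
  assumes S: "S \<in> row_strict_tableaux n p" and c: "(i, j) \<in> set (cells p)"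
  shows "j \<le> S (i, j)"
  using c
proof (induction j)
  case (Suc j)
  show ?case
  proof (cases "j = 0")
    case True
    have "S (i, Suc j) \<in> {1..n}" using S Suc.prems by (auto simp: row_strict_tableaux_def)
    then show ?thesis using True by simp
  next
    case False
    then have ij: "(i, j) \<in> set (cells p)" using Suc.prems by (auto simp: set_cells)
    have "S (i, j) < S (i, Suc j)"
      using S ij Suc.prems unfolding row_strict_tableaux_def by blast
    then show ?thesis using Suc.IH[OF ij] by simp
  qed
qed simp

text \<open>If the vector is nonzero, then the exclusion principle for the modes \<open>(r, Beta j)\<close> bounds the
  sum of the column indices of \<open>lam\<close> from below by that of \<open>mu\<close>, while row strictness bounds it from
  above. Equality forces \<open>S\<close> to be the tableau of column indices.\<close>

lemma virtual_vanish:
  assumes lam: "is_partition lam" and mu: "is_partition mu"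
    and n: "part lam 1 \<le> n" "part mu 1 \<le> n"
    and S: "S \<in> row_strict_tableaux n lam" and le: "sum_list mu \<le> sum_list lam"
    and nz: "word_act (fock_act (length mu)) (map (\<lambda>c. (tab_D c, tab_C c)) (cells lam))
       (word_act (fock_act (length mu)) (map (\<lambda>c. (tab_C c, (Lett \<circ> S) c)) (cells lam)) (hwv mu)) \<noteq> 0"
  shows "lam = mu \<and> (\<forall>c\<in>set (cells lam). S c = snd c)"
proof -
  let ?l = "length mu"
  let ?W = "word_act (fock_act ?l)"
  let ?f = "\<lambda>c. (tab_C c, (Lett \<circ> S) c)" and ?g = "\<lambda>c. (tab_D c, tab_C c)"
  define y where "y = ?W (map ?f (cells lam)) (hwv mu)"
  define X where "X = ?W (map ?g (cells lam)) y"
  define cS where "cS j = card {c \<in> set (cells lam). S c = j}" for j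
  have tabs [simp]: "tab_C c = Alpha (fst c)" "tab_D c = Beta (snd c)" for c
    by (simp_all add: tab_C_def tab_D_def case_prod_unfold)
  have X: "X \<noteq> 0" using nz by (simp add: X_def y_def)
  then have y: "y \<noteq> 0" by (auto simp: X_def word_act_zero)
  have S1: "1 \<le> S c \<and> S c \<le> n" if "c \<in> set (cells lam)" for c
    using S that by (auto simp: row_strict_tableaux_def)
  have dy: "has_deg ?l (Lett j) (int (conj_part mu j) - int (cS j)) y" if "1 \<le> j" for j
    unfolding y_def by (rule has_deg_family[OF distinct_cells has_deg_hwv(1)[OF that]]) (simp add: cS_def)
  \<comment> \<open>The word removes letter j exactly \<open>cS j\<close> times, and a nonzero
    vector has no negative multiplicity.\<close>
  have cS_le: "cS j \<le> conj_part mu j" if "1 \<le> j" for j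
    using has_deg_neg[OF dy[OF that]] y by force
  \<comment> \<open>Here the size hypothesis enters: \<open>lam\<close> has at least as many cells
    as there are letters in \<open>hwv mu\<close>, so the bounds \<open>cS_le\<close> are all
    attained.\<close>
  have cS_sum: "(\<Sum>j=1..n. cS j) = (\<Sum>j=1..n. conj_part mu j)"
  proof (rule antisym)
    show "(\<Sum>j=1..n. cS j) \<le> (\<Sum>j=1..n. conj_part mu j)" by (rule sum_mono) (use cS_le in auto)
    have "(\<Sum>j=1..n. conj_part mu j) = sum_list mu"
      using sum_columns[OF mu n(2), of "\<lambda>_. 1"] distinct_card[OF distinct_cells[of mu]] length_cells[of mu] by simp
    also have "\<dots> \<le> (\<Sum>c\<in>set (cells lam). 1)"
      using le distinct_card[OF distinct_cells[of lam]] length_cells[of lam] by simp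
    also have "\<dots> = (\<Sum>j=1..n. \<Sum>c | c \<in> set (cells lam) \<and> S c = j. 1)"
      by (rule sum.group[symmetric]) (use S1 in auto)
    finally show "(\<Sum>j=1..n. conj_part mu j) \<le> (\<Sum>j=1..n. cS j)" by (simp add: cS_def)
  qed
  have content: "cS j = conj_part mu j" if "1 \<le> j" "j \<le> n" for j
  proof (rule sum_mono_inv[OF cS_sum])
    show "cS i \<le> conj_part mu i" if "i \<in> {1..n}" for i using cS_le that by simp
  qed (use that in auto)
  let ?Q = "\<lambda>p. \<Sum>c\<in>set (cells p). snd c"
  have "(\<Sum>c\<in>set (cells lam). S c) = (\<Sum>j=1..n. \<Sum>c | c \<in> set (cells lam) \<and> S c = j. S c)"
    by (rule sum.group[symmetric]) (use S1 in auto)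
  also have "\<dots> = (\<Sum>j=1..n. j * conj_part mu j)"
  proof (rule sum.cong[OF refl])
    fix j assume j: "j \<in> {1..n}"
    have "(\<Sum>c | c \<in> set (cells lam) \<and> S c = j. S c) = (\<Sum>c | c \<in> set (cells lam) \<and> S c = j. j)"
      by (rule sum.cong) auto
    then show "(\<Sum>c | c \<in> set (cells lam) \<and> S c = j. S c) = j * conj_part mu j"
      using content[of j] j by (simp add: cS_def)
  qed
  also have "\<dots> = ?Q mu" using sum_columns[OF mu n(2), of "\<lambda>j. j"] by simp
  finally have sumS: "(\<Sum>c\<in>set (cells lam). S c) = ?Q mu" .
  obtain s where s: "X s \<noteq> 0" using X by (auto simp: fun_eq_iff pointwise)
  let ?m = "part lam 1"
  let ?Y = "Alpha ` {1..max (length lam) (length mu)} \<union> Beta ` {1..?m} \<union> Lett ` {1..n}"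
  have degX: "int (deg ?l a s) = d" if "has_deg ?l a d X" for a d
    using that s unfolding has_deg_def by blast
  have "has_deg ?l (Alpha i) 0 X" if "1 \<le> i" for i
  proof -
    have "has_deg ?l (Alpha i) (int (card {c \<in> set (cells lam). fst c = i})) y"
      unfolding y_def by (rule has_deg_family[OF distinct_cells has_deg_hwv(2)[OF that]]) simp
    then show ?thesis unfolding X_def by (rule has_deg_family[OF distinct_cells]) simp
  qed
  moreover have "has_deg ?l (Lett j) 0 X" if "1 \<le> j" "j \<le> n" for j
    unfolding X_def by (rule has_deg_family[OF distinct_cells dy[OF that(1)]]) (simp add: content[OF that])
  moreover have occ0: "occ s (r, a) = 0" if "r \<in> {1..?l}" "has_deg ?l a 0 X" for r a
  proof -
    have "deg ?l a s = 0" using degX[OF that(2)] by simp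
    then show ?thesis using that(1) unfolding deg_def by (subst (asm) sum_eq_0_iff) auto
  qed
  \<comment> \<open>Among the symbols involved, the surviving state contains only column symbols:
    the letters are used up, and each row symbol is removed as often as it was created.\<close>
  ultimately have zero: "occ s (r, a) = 0" if "r \<in> {1..?l}" "a \<in> ?Y - Beta ` {1..?m}" for r a
    using that by auto
  have degB: "deg ?l (Beta j) s = conj_part lam j" if "1 \<le> j" for j
  proof -
    have "has_deg ?l (Beta j) 0 y"
      unfolding y_def by (rule has_deg_family[OF distinct_cells has_deg_hwv(3)]) simp
    then have "has_deg ?l (Beta j) (int (conj_part lam j)) X"
      unfolding X_def by (rule has_deg_family[OF distinct_cells]) (simp add: card_column[OF that])
    from degX[OF this] show ?thesis by simp
  qed
  have nzW: "?W (map ?g (cells lam) @ map ?f (cells lam) @ map (\<lambda>(i, j). (Lett j, Alpha i)) (rev (cells mu)))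
      (ind (row_state mu)) s \<noteq> 0"
    using s by (simp add: X_def y_def hwv_def)
  have listsY: "map ?g (cells lam) @ map ?f (cells lam) @ map (\<lambda>(i, j). (Lett j, Alpha i)) (rev (cells mu)) \<in> lists (?Y \<times> ?Y)"
  proof -
    have lamY: "Alpha (fst c) \<in> ?Y \<and> Beta (snd c) \<in> ?Y \<and> Lett (S c) \<in> ?Y" if "c \<in> set (cells lam)" for c
      using S1[OF that] cells_column_bound[OF lam that] that by (auto simp: set_cells)
    have muY: "Lett (snd c) \<in> ?Y \<and> Alpha (fst c) \<in> ?Y" if "c \<in> set (cells mu)" for c
      using cells_column_bound[OF mu that] n that by (auto simp: set_cells)
    have "(Beta (snd c), Alpha (fst c)) \<in> ?Y \<times> ?Y" "(Alpha (fst c), Lett (S c)) \<in> ?Y \<times> ?Y"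
      if "c \<in> set (cells lam)" for c
      using lamY[OF that] by blast+
    moreover have "(\<lambda>(i, j). (Lett j, Alpha i)) c \<in> ?Y \<times> ?Y" if "c \<in> set (cells mu)" for c
      using muY[OF that] by (simp only: case_prod_unfold) blast
    ultimately show ?thesis
      unfolding in_lists_conv_set set_append set_map set_rev o_apply tabs by blast
  qed
  have rowsum: "(\<Sum>a\<in>?Y. occ s (r, a)) = part mu r" if r: "r \<in> {1..?l}" for r
  proof (rule row_conserved[OF _ listsY _ nzW])
    show "finite ?Y" by simp
    fix t assume "ind (row_state mu) t \<noteq> 0"
    then have t: "t = row_state mu" by (auto simp: ind_def split: if_splits)
    have "Alpha r \<in> ?Y" using r by auto
    then show "(\<Sum>a\<in>?Y. occ t (r, a)) = part mu r"
      unfolding t occ_row_state by (subst sum.delta) auto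
  qed
  \<comment> \<open>Row r holds \<open>part mu r\<close> particles, all in distinct modes (r, Beta
    j), so the sum of their column indices is smallest when the first \<open>part mu r\<close>
    columns are occupied.\<close>
  have row_ge: "\<Sum>{1..part mu r} \<le> (\<Sum>j=1..?m. j * occ s (r, Beta j))" if "r \<in> {1..?l}" for r
  proof -
    let ?T = "{j \<in> {1..?m}. occ s (r, Beta j) = 1}"
    have occ01: "occ s (r, Beta j) = of_bool (occ s (r, Beta j) = 1)" for j by (simp add: occ_def)
    have "part mu r = (\<Sum>a\<in>Beta ` {1..?m}. occ s (r, a))"
      unfolding rowsum[OF that, symmetric] by (rule sum.mono_neutral_right) (use zero[OF that] in auto)
    also have "\<dots> = (\<Sum>j=1..?m. occ s (r, Beta j))" by (subst sum.reindex) (auto simp: inj_on_def)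
    also have "\<dots> = (\<Sum>j=1..?m. of_bool (occ s (r, Beta j) = 1))" by (rule sum.cong[OF refl occ01])
    also have "\<dots> = card ?T" by (simp add: Int_def)
    finally have "part mu r = card ?T" .
    moreover have "\<Sum>{1..card ?T} \<le> \<Sum>?T" by (rule sum_initial_le[of _ ?m]) auto
    moreover have "(\<Sum>j=1..?m. j * occ s (r, Beta j)) = (\<Sum>j=1..?m. if occ s (r, Beta j) = 1 then j else 0)"
      by (rule sum.cong[OF refl]) (use occ01 in \<open>auto simp: occ_def\<close>)
    moreover have "\<dots> = \<Sum>?T" by (rule sum.inter_filter[symmetric]) simp
    ultimately show ?thesis by simp
  qed
  have "?Q mu = (\<Sum>r=1..?l. \<Sum>{1..part mu r})"
    by (subst sum.Sigma) (auto simp: set_cells_Sigma intro!: sum.cong)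
  also have "\<dots> \<le> (\<Sum>r=1..?l. \<Sum>j=1..?m. j * occ s (r, Beta j))"
    by (rule sum_mono) (rule row_ge)
  also have "\<dots> = (\<Sum>j=1..?m. j * deg ?l (Beta j) s)"
    by (subst sum.swap) (simp add: deg_def sum_distrib_left)
  also have "\<dots> = ?Q lam"
    using sum_columns[OF lam order_refl, of "\<lambda>j. j"] by (simp add: degB)
  finally have "?Q mu \<le> ?Q lam" .
  moreover have ge: "snd c \<le> S c" if "c \<in> set (cells lam)" for c
    using row_strict_ge[OF S, of "fst c" "snd c"] that by simp
  ultimately have "(\<Sum>c\<in>set (cells lam). snd c) = (\<Sum>c\<in>set (cells lam). S c)"
    using sumS sum_mono[of "set (cells lam)" snd S] by (simp add: ge antisym)
  then have eq: "\<forall>c\<in>set (cells lam). S c = snd c"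
    using sum_mono_inv[of snd "set (cells lam)" S] ge by fastforce
  moreover have "lam = mu"
  proof (rule partition_eqI[OF lam mu])
    fix j :: nat assume j: "1 \<le> j"
    show "conj_part lam j = conj_part mu j"
    proof (cases "j \<le> n")
      case True
      have "cS j = conj_part lam j"
        unfolding cS_def card_column[OF j, symmetric] by (rule arg_cong[where f = card]) (use eq in auto)
      then show ?thesis using content[OF j True] by simp
    next
      case False
      then have "\<not> 1 \<le> conj_part lam j" "\<not> 1 \<le> conj_part mu j"
        using conj_part_galois[OF lam order_refl j] conj_part_galois[OF mu order_refl j] n by auto
      then show ?thesis by simp
    qed
  qed
  ultimately show ?thesis by blast
qed

section \<open>Evaluation by hook products\<close>

text \<open>\<open>hook_rows\<close> pairs a word with a reversed one, whereas the monomials use the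
  same order twice. Reordering both words costs the same sign \<sigma> twice, which cancels; the
  reversal leaves a sign depending only on the number of cells.\<close>

lemma paired_words:
  fixes cs cs' :: "'c list" and f ft :: "'c \<Rightarrow> sym \<times> sym"
  assumes perm: "mset cs' = mset cs" and iso: "isotropic (f ` set cs)" "isotropic (ft ` set cs)"
    and val: "word_act (fock_act l) (map ft (rev cs')) (word_act (fock_act l) (map f cs') x) = fscl h x"
  shows "word_act (fock_act l) (map ft cs) (word_act (fock_act l) (map f cs) x)
    = fscl ((\<Prod>i<length cs. (-1) ^ i) * h) x"
proof -
  let ?W = "word_act (fock_act l)" and ?\<rho> = "\<Prod>i<length cs. (-1) ^ i :: complex"
  have len: "length cs' = length cs" and sets: "set cs' = set cs"
    using perm mset_eq_length mset_eq_setD by blast+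
  have \<rho>: "?\<rho> * ?\<rho> = 1"
    by (simp flip: prod.distrib power_add)
  obtain \<sigma> :: complex where \<sigma>: "\<sigma> * \<sigma> = 1" and
    perm_f: "\<And>F. ?W (map f cs') F = fscl \<sigma> (?W (map f cs) F)" and
    perm_ft: "\<And>F. ?W (map ft cs') F = fscl \<sigma> (?W (map ft cs) F)"
    using isotropic_permute[OF perm] iso by blast
  have rev: "?W (map ft (rev cs')) F = fscl (?\<rho> * \<sigma>) (?W (map ft cs) F)" for F
    using isotropic_rev[OF iso(2), of "map ft cs'" l F]
    by (simp add: rev_map sets len perm_ft)
  have "fscl ?\<rho> (?W (map ft cs) (?W (map f cs) x)) = fscl h x"
  proof -
    have "\<sigma> * (?\<rho> * \<sigma>) = ?\<rho>"
      using \<sigma> by (metis mult.commute mult.left_commute mult_1)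
    then show ?thesis
      using val unfolding rev perm_f word_act_fscl fscl_simps(1) by (simp only:)
  qed
  then have "fscl ?\<rho> (fscl ?\<rho> (?W (map ft cs) (?W (map f cs) x))) = fscl ?\<rho> (fscl h x)"
    by (rule arg_cong)
  then show ?thesis using \<rho> by simp
qed

lemma hook_prod_rows: "hook_prod p = (\<Prod>i=1..length p. \<Prod>j=1..part p i. (part p i - j) + (conj_part p j - i) + 1)"
  unfolding hook_prod_def set_cells_Sigma by (subst prod.Sigma) auto

lemma cells_by_columns:
  assumes "is_partition p"
  shows "(\<lambda>(i, j). (j, i)) ` Sigma {1..part p 1} (\<lambda>j. {1..conj_part p j}) = set (cells p)"
proof -
  have "1 \<le> i \<and> 1 \<le> j \<Longrightarrow> j \<le> part p 1 \<and> i \<le> conj_part p j \<longleftrightarrow> i \<le> length p \<and> j \<le> part p i" for i j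
    using conj_part_galois[OF assms, of i j] part_antimono[OF assms, of 1 i] part_pos_iff[OF assms, of i]
    by (metis order_trans order_refl)
  then show ?thesis by (fastforce simp: set_cells image_iff)
qed

text \<open>Transposing the diagram exchanges arm and leg and keeps their sum.\<close>

lemma hook_prod_columns:
  assumes p: "is_partition p"
  shows "hook_prod p = (\<Prod>j=1..part p 1. \<Prod>i=1..conj_part p j. (conj_part p j - i) + (part p i - j) + 1)"
proof -
  have "hook_prod p = (\<Prod>(j, i)\<in>Sigma {1..part p 1} (\<lambda>j. {1..conj_part p j}). (conj_part p j - i) + (part p i - j) + 1)"
    unfolding hook_prod_def cells_by_columns[OF p, symmetric]
    by (subst prod.reindex) (auto simp: inj_on_def intro!: prod.cong)
  then show ?thesis by (subst prod.Sigma) auto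
qed

text \<open>Both inner factors are instances of the same hook computation: letters are turned into the
  symbols of the rows and these into the symbols of the columns.\<close>

lemma virtual_value:
  assumes p: "is_partition p" and S: "\<And>c. c \<in> set (cells p) \<Longrightarrow> S c = snd c"
  shows "word_act (fock_act (length p)) (map (\<lambda>c. ((Lett \<circ> S) c, tab_C c)) (cells p))
     (word_act (fock_act (length p)) (map (\<lambda>c. (tab_C c, tab_D c)) (cells p))
     (word_act (fock_act (length p)) (map (\<lambda>c. (tab_D c, tab_C c)) (cells p))
     (word_act (fock_act (length p)) (map (\<lambda>c. (tab_C c, (Lett \<circ> S) c)) (cells p)) (hwv p))))
    = fscl (of_nat (hook_prod p) * of_nat (hook_prod p)) (hwv p)"
proof -
  let ?l = "length p" and ?cs = "cells p"
  let ?W = "word_act (fock_act ?l)" and ?\<rho> = "\<Prod>i<length (cells p). (-1) ^ i :: complex"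
  have \<rho>: "?\<rho> * ?\<rho> = 1"
    by (simp flip: prod.distrib power_add)
  let ?fA = "\<lambda>(i, j). (Alpha i, Lett j)" and ?fAt = "\<lambda>(i, j). (Lett j, Alpha i)"
  let ?fB = "\<lambda>(i, j). (Beta j, Alpha i)" and ?fBt = "\<lambda>(i, j). (Alpha i, Beta j)"
  have maps: "map (\<lambda>c. ((Lett \<circ> S) c, tab_C c)) ?cs = map ?fAt ?cs"
    "map (\<lambda>c. (tab_C c, (Lett \<circ> S) c)) ?cs = map ?fA ?cs"
    "map (\<lambda>c. (tab_C c, tab_D c)) ?cs = map ?fBt ?cs"
    "map (\<lambda>c. (tab_D c, tab_C c)) ?cs = map ?fB ?cs"
    using S by (auto simp: tab_C_def tab_D_def)
  have iso: "isotropic (?fA ` Z)" "isotropic (?fAt ` Z)" "isotropic (?fB ` Z)" "isotropic (?fBt ` Z)" for Z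
    by (auto simp: isotropic_def)
  let ?cs1 = "rows_cells (part p) (length p)"
  have perm1: "mset ?cs1 = mset ?cs"
    by (subst set_eq_iff_mset_eq_distinct[symmetric])
       (auto simp: distinct_cells distinct_rows_cells set_rows_cells set_cells_Sigma)
  have A: "?W (map ?fAt ?cs) (?W (map ?fA ?cs) (hwv p)) = fscl (?\<rho> * of_nat (hook_prod p)) (hwv p)"
  proof (rule paired_words[OF perm1 iso(1,2)])
    show "?W (map ?fAt (rev ?cs1)) (?W (map ?fA ?cs1) (hwv p)) = fscl (of_nat (hook_prod p)) (hwv p)"
      unfolding hook_prod_rows
      by (rule hook_rows)
         (auto simp: inj_on_def conj_part_galois[OF p] hwv_raise has_deg_hwv)
  qed
  define y where "y = ?W (map ?fA ?cs) (hwv p)"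
  obtain \<sigma> where y1: "y = fscl \<sigma> (?W (map ?fA ?cs1) (hwv p))"
    using isotropic_permute[OF perm1[symmetric]] iso(1) unfolding y_def by blast
  \<comment> \<open>The operator turns the factor of a cell (j, t) into that of (i, t) in the same
    column. This cell exists because row i is at least as long as row j, and its factor stands
    further right in \<open>?cs1\<close>, where row 1 comes last; in \<open>cells\<close> it would
    stand to the left.\<close>
  have raise: "fock_act ?l (Alpha i) (Alpha j) y = 0" if ij: "1 \<le> i" "i < j" for i j
  proof -
    have "fock_act ?l (Alpha i) (Alpha j) (?W (map ?fA ?cs1) (hwv p)) = 0"
    proof (rule even_kills_word[OF _ iso(1)[of "set ?cs1"]])
      show "fock_act ?l (Alpha i) (Alpha j) (hwv p) = 0"
        using ij by (intro has_deg_kill[OF has_deg_hwv(2)]) auto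
      show "(Alpha j = c \<longrightarrow> (Alpha i, d) \<in> set vs) \<and> (Alpha i = d \<longrightarrow> (c, Alpha j) \<in> set vs)"
        if ws: "map ?fA ?cs1 = us @ (c, d) # vs" for us c d vs
      proof -
        obtain us' r t vs' where cs: "?cs1 = us' @ (r, t) # vs'" and cd: "c = Alpha r" "d = Lett t"
          and vs: "vs = map ?fA vs'"
          using ws by (auto simp: map_eq_append_conv map_eq_Cons_conv)
        have "(i, t) \<in> set vs'" if "r = j"
        proof -
          have "(j, t) \<in> set ?cs1" unfolding cs that by simp
          then have "(i, t) \<in> set ?cs1"
            using ij part_antimono[OF p ij(1), of j] by (auto simp: set_rows_cells)
          moreover have "(i, t) \<notin> set us'"
            using sorted_rows_cells[of "part p" "length p"] ij unfolding cs that
            by (auto simp: sorted_wrt_append)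
          ultimately show ?thesis using ij that by (auto simp: cs)
        qed
        then show ?thesis using cd vs by (auto intro!: bexI[of _ "(i, t)"] simp: image_iff)
      qed
    qed auto
    then show ?thesis by (simp add: y1)
  qed
  \<comment> \<open>Columns are read as the rows of the transposed diagram: the symbols of rows are
    now the ones consumed.\<close>
  let ?cs2 = "map (\<lambda>(j, i). (i, j)) (rows_cells (conj_part p) (part p 1))"
  have perm2: "mset ?cs2 = mset ?cs"
    using cells_by_columns[OF p] distinct_rows_cells[of "conj_part p" "part p 1"]
    by (subst set_eq_iff_mset_eq_distinct[symmetric])
       (auto simp: distinct_cells set_rows_cells distinct_map inj_on_def)
  have B: "?W (map ?fBt ?cs) (?W (map ?fB ?cs) y) = fscl (?\<rho> * of_nat (hook_prod p)) y"
  proof (rule paired_words[OF perm2 iso(3,4)])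
    have "?W (map (\<lambda>(j, i). (Alpha i, Beta j)) (rev (rows_cells (conj_part p) (part p 1))))
        (?W (map (\<lambda>(j, i). (Beta j, Alpha i)) (rows_cells (conj_part p) (part p 1))) y)
      = fscl (of_nat (hook_prod p)) y"
      unfolding hook_prod_columns[OF p]
    proof (rule hook_rows)
      show "i \<le> conj_part p j \<longleftrightarrow> j \<le> part p i" if "1 \<le> j" "j \<le> part p 1" "1 \<le> i" for i j
        using conj_part_galois[OF p that(3,1)] by simp
      show "has_deg ?l (Alpha i) (int (part p i)) y" if "1 \<le> i" "i \<le> conj_part p 1" for i
        unfolding y_def
        by (rule has_deg_family[OF distinct_cells has_deg_hwv(2)[OF that(1)]])
           (use card_row[of p i] that in \<open>simp add: case_prod_unfold\<close>)
      show "has_deg ?l (Beta j) 0 y" for j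
        unfolding y_def
        by (rule has_deg_family[OF distinct_cells has_deg_hwv(3)]) (simp add: case_prod_unfold)
    qed (auto simp: inj_on_def raise)
    then show "?W (map ?fBt (rev ?cs2)) (?W (map ?fB ?cs2) y) = fscl (of_nat (hook_prod p)) y"
      by (simp add: rev_map comp_def case_prod_unfold)
  qed
  have "?W (map ?fAt ?cs) (?W (map ?fBt ?cs) (?W (map ?fB ?cs) y))
      = fscl (?\<rho> * of_nat (hook_prod p)) (?W (map ?fAt ?cs) y)"
    unfolding B by (rule word_act_fscl)
  also have "\<dots> = fscl ((?\<rho> * ?\<rho>) * (of_nat (hook_prod p) * of_nat (hook_prod p))) (hwv p)"
    unfolding y_def A fscl_simps(1) by (simp add: mult_ac)
  finally show ?thesis unfolding maps y_def \<rho> by simp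
qed

section \<open>Action of the virtual projection on the Fock space\<close>

text \<open>The annihilator of \<open>F\<close> is a left ideal and contains the irregular
  products.\<close>

lemma Irr_kills:
  assumes F: "\<And>\<gamma>. is_virtual \<gamma> \<Longrightarrow> has_deg l \<gamma> 0 F" and x: "x \<in> Irr m0 m1 n"
  shows "U_act fscl (fock_act l) x F = 0"
proof -
  let ?X = "symbols m0 m1 n"
  interpret W: super_rep fscl ?X UNIV "fock_act l" by (rule fock_rep)
  interpret R: ring "U ?X" by (rule ring_U)
  let ?I = "{x \<in> carrier (U ?X). W.uact x F = 0}"
  have "additive_subgroup ?I (U ?X)"
  proof (rule additive_subgroup.intro, unfold_locales)
    show "?I \<subseteq> carrier (add_monoid (U ?X))" by auto
    show "x \<otimes>\<^bsub>add_monoid (U ?X)\<^esub> y \<in> ?I" if "x \<in> ?I" "y \<in> ?I" for x y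
      using that by (simp add: W.uact_add)
    show "\<one>\<^bsub>add_monoid (U ?X)\<^esub> \<in> ?I" by (simp add: W.uact_zero)
    show "inv\<^bsub>add_monoid (U ?X)\<^esub> x \<in> ?I" if "x \<in> ?I" for x
    proof -
      have "inv\<^bsub>add_monoid (U ?X)\<^esub> x = \<ominus>\<^bsub>U ?X\<^esub> x" by (simp only: a_inv_def)
      also have "\<dots> = \<zero>\<^bsub>U ?X\<^esub> \<ominus>\<^bsub>U ?X\<^esub> x"
        using that R.a_inv_closed[of x] by (simp add: a_minus_def)
      finally show ?thesis using that by (simp add: W.uact_minus W.uact_zero)
    qed
  qed
  moreover have "r \<otimes>\<^bsub>U ?X\<^esub> x \<in> ?I" if r: "r \<in> carrier (U ?X)" and "x \<in> ?I" for r x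
  proof -
    obtain f where "f \<in> carrier (free_alg (?X \<times> ?X))" "r = U_of ?X f" using r by (auto simp: U_carrier)
    then have "W.uact r 0 = 0" using W.comb_linear(2)[of f 0 0] by (simp add: W.uact_U_of)
    then show ?thesis using that by (simp add: W.uact_mult)
  qed
  moreover have "U_prod ?X ws \<in> ?I" if "ws \<in> lists (?X \<times> ?X)" "irregular ws" for ws
    using irregular_kills[OF F that(2)] that(1) by (simp add: W.uact_prod U_prod_closed)
  then have "{U_prod ?X ws |ws. ws \<in> lists (?X \<times> ?X) \<and> irregular ws} \<subseteq> ?I" by blast
  ultimately have "Irr m0 m1 n \<subseteq> ?I"
    unfolding Irr_def Let_def by (rule gen_left_ideal_minimal)
  then show ?thesis using x by auto
qed

lemma virt_proj_act:
  assumes F: "\<And>\<gamma>. is_virtual \<gamma> \<Longrightarrow> has_deg l \<gamma> 0 F"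
    and ws: "ws \<in> lists (symbols m0 m1 n \<times> symbols m0 m1 n)"
    and bal: "\<And>\<gamma>. is_virtual \<gamma> \<Longrightarrow> length (filter (\<lambda>p. fst p = \<gamma>) ws) = length (filter (\<lambda>p. snd p = \<gamma>) ws)"
  shows "U_act fscl (fock_act l) (virt_proj m0 m1 n (U_prod (symbols m0 m1 n) ws)) F = word_act (fock_act l) ws F"
proof -
  let ?X = "symbols m0 m1 n" and ?L = "letters n"
  interpret W: super_rep fscl ?X UNIV "fock_act l" by (rule fock_rep)
  interpret WL: super_rep fscl ?L UNIV "fock_act l" by (rule fock_rep)
  obtain f where f: "f \<in> carrier (free_alg (?L \<times> ?L))" "virt_proj m0 m1 n (U_prod ?X ws) = U_of ?L f"
    using virt_proj_props(1)[OF ws bal] by (auto simp: U_carrier)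
  have fX: "f \<in> carrier (free_alg (?X \<times> ?X))"
    using f(1) letters_subset[of n m0 m1] by (fastforce simp: free_alg_sel(1) in_lists_conv_set)
  have "U_prod ?X ws \<ominus>\<^bsub>U ?X\<^esub> U_of ?X f \<in> Irr m0 m1 n"
    using virt_proj_props(2)[OF ws bal] unfolding f(2) U_embed_U_of[OF f(1)] .
  from Irr_kills[OF F this] have "W.uact (U_prod ?X ws) F - W.uact (U_of ?X f) F = 0"
    using fX U_prod_closed[OF ws] by (simp add: W.uact_minus)
  then show ?thesis
    unfolding f(2) using f(1) fX ws by (simp add: W.uact_prod W.uact_U_of WL.uact_U_of)
qed

section \<open>Comparison of highest weight modules\<close>

text \<open>The conditions concern \<open>v\<close> only, so the given module, the Fock space and
  their product are all covered.\<close>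

locale highest_weight_rep = super_rep scl "letters n" V act
  for scl :: "complex \<Rightarrow> 'v::ab_group_add \<Rightarrow> 'v" and n V act +
  fixes wt :: "nat \<Rightarrow> complex" and v :: 'v
  assumes v_in [simp]: "v \<in> V"
    and raise_v: "1 \<le> i \<Longrightarrow> i < j \<Longrightarrow> j \<le> n \<Longrightarrow> act (Lett i) (Lett j) v = 0"
    and weight_v: "1 \<le> i \<Longrightarrow> i \<le> n \<Longrightarrow> act (Lett i) (Lett i) v = scl (wt i) v"
begin

lemma act_commute:
  assumes "a \<in> letters n" "b \<in> letters n" "c \<in> letters n" "d \<in> letters n" "x \<in> V"
  shows "act a b (act c d x) = act c d (act a b x)
    + (if b = c then act a d x else 0) - (if a = d then act c b x else 0)"
proof -
  have "gl_sign (a, b) (c, d) = 1" using assms by (auto simp: gl_sign_def letters_def)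
  then show ?thesis using act_bracket[OF assms] by (simp add: add_diff_eq)
qed

section \<open>The submodule generated by a highest weight vector\<close>

definition "lowering = {(Lett i, Lett j) |i j. 1 \<le> j \<and> j < i \<and> i \<le> n}"

lemma lowering_subset: "lowering \<subseteq> letters n \<times> letters n"
  by (auto simp: lowering_def letters_def)

lemma lowering_words: "ws \<in> lists lowering \<Longrightarrow> ws \<in> lists (letters n \<times> letters n)"
  using lists_mono[OF lowering_subset] by blast

definition "low_span = span {word ws v |ws. ws \<in> lists lowering}"

lemma low_word: "ws \<in> lists lowering \<Longrightarrow> word ws v \<in> low_span"
  unfolding low_span_def by (rule span_base) blast

lemma subspace_preimage:
  assumes "a \<in> letters n" "b \<in> letters n" "subspace B"
  shows "subspace {x \<in> V. act a b x \<in> B}"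
  using assms act_scale[OF assms(1,2), of 0 0]
  by (intro subspaceI) (auto simp: act_add act_scale subspace_add subspace_scale subspace_0)

lemma act_low_spanI:
  assumes "a \<in> letters n" "b \<in> letters n"
    and "\<And>ws. ws \<in> lists lowering \<Longrightarrow> act a b (word ws v) \<in> low_span"
  shows "x \<in> low_span \<Longrightarrow> act a b x \<in> low_span"
proof -
  have "subspace low_span" by (simp add: low_span_def subspace_span)
  then have "subspace {x \<in> V. act a b x \<in> low_span}" by (rule subspace_preimage[OF assms(1,2)])
  then have "low_span \<subseteq> {x \<in> V. act a b x \<in> low_span}"
    unfolding low_span_def[symmetric] using assms(3) lowering_words
    by (subst (1) low_span_def, intro span_minimal) (blast intro: word_closed v_in)
  then show "x \<in> low_span \<Longrightarrow> act a b x \<in> low_span" by blast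
qed

lemma act_lowering: "(c, d) \<in> lowering \<Longrightarrow> x \<in> low_span \<Longrightarrow> act c d x \<in> low_span"
proof -
  assume cd: "(c, d) \<in> lowering"
  have "act c d (word ws v) \<in> low_span" if "ws \<in> lists lowering" for ws
    using low_word[of "(c, d) # ws"] that cd by simp
  then show "x \<in> low_span \<Longrightarrow> act c d x \<in> low_span"
    using cd lowering_subset act_low_spanI[of c d] by blast
qed

lemma low_span_intros:
  "0 \<in> low_span" "x \<in> low_span \<Longrightarrow> y \<in> low_span \<Longrightarrow> x + y \<in> low_span"
  "x \<in> low_span \<Longrightarrow> y \<in> low_span \<Longrightarrow> x - y \<in> low_span" "x \<in> low_span \<Longrightarrow> scl c x \<in> low_span"
  by (simp_all add: low_span_def span_zero span_add span_diff span_scale)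

text \<open>The generator moves past the first lowering factor. The commutators are generators
  applied to a shorter word, so the induction runs over all generators at once.\<close>

lemma act_low_word:
  assumes "ws \<in> lists lowering" "a \<in> letters n" "b \<in> letters n"
  shows "act a b (word ws v) \<in> low_span"
  using assms
proof (induction ws arbitrary: a b rule: list.induct)
  case Nil
  obtain i j where ij: "a = Lett i" "b = Lett j" "1 \<le> i" "i \<le> n" "1 \<le> j" "j \<le> n"
    using Nil by (auto simp: letters_def)
  have v: "v \<in> low_span" using low_word[of "[]"] by simp
  show ?case
  proof (cases i j rule: linorder_cases)
    case less
    then show ?thesis using raise_v[of i j] ij low_span_intros(1) by simp
  next
    case equal
    then show ?thesis using weight_v[of i] ij v low_span_intros(4) by simp
  next
    case greater
    then have "(a, b) \<in> lowering" using ij by (auto simp: lowering_def)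
    then show ?thesis using act_lowering v by simp
  qed
next
  case (Cons p ws)
  obtain c d where p: "p = (c, d)" by (cases p)
  have cd: "(c, d) \<in> lowering" and ws: "ws \<in> lists lowering" using Cons.prems(1) p by auto
  then have L: "c \<in> letters n" "d \<in> letters n" using lowering_subset by auto
  have V: "word ws v \<in> V" by (rule word_closed[OF lowering_words[OF ws] v_in])
  note IH = Cons.IH[OF ws]
  have "act c d (act a b (word ws v)) \<in> low_span" by (rule act_lowering[OF cd IH[OF Cons.prems(2,3)]])
  then show ?case
    unfolding p word_act_simps act_commute[OF Cons.prems(2,3) L V]
    using IH Cons.prems(2,3) L by (auto intro!: low_span_intros)
qed

lemma act_low_span: "a \<in> letters n \<Longrightarrow> b \<in> letters n \<Longrightarrow> x \<in> low_span \<Longrightarrow> act a b x \<in> low_span"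
  by (rule act_low_spanI) (use act_low_word in auto)

lemma word_low_span: "ws \<in> lists (letters n \<times> letters n) \<Longrightarrow> word ws v \<in> low_span"
proof (induction ws rule: list.induct)
  case Nil
  then show ?case using low_word[of "[]"] by simp
next
  case (Cons p ws)
  then show ?case by (cases p) (simp add: act_low_span)
qed

lemma comb_low_span:
  assumes "f \<in> carrier F"
  shows "comb f v \<in> low_span"
proof -
  have "scl (f w) (word w v) \<in> low_span" if "f w \<noteq> 0" for w
    using that assms by (intro low_span_intros word_low_span) (auto simp: free_alg_sel(1))
  then show ?thesis
    unfolding comb_act_def low_span_def by (intro span_sum) auto
qed

text \<open>The eigenvalue of this operator is raised by every lowering operator, which separates \<open>v\<close>
  from the lowered vectors.\<close>

definition height_op :: "'v \<Rightarrow> 'v" where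
  "height_op x = (\<Sum>k=1..n. scl (of_nat k) (act (Lett k) (Lett k) x))"

definition top_height :: complex where
  "top_height = (\<Sum>k=1..n. of_nat k * wt k)"

lemma letters_Lett: "k \<in> {1..n} \<Longrightarrow> Lett k \<in> letters n"
  by (simp add: letters_def)

lemma height_op_closed: "x \<in> V \<Longrightarrow> height_op x \<in> V"
  unfolding height_op_def by (intro V_intros act_closed letters_Lett)

lemma height_op_add: "x \<in> V \<Longrightarrow> y \<in> V \<Longrightarrow> height_op (x + y) = height_op x + height_op y"
  unfolding height_op_def sum.distrib[symmetric]
  by (rule sum.cong[OF refl]) (simp add: act_add letters_Lett scale_right_distrib)

lemma height_op_scale: "x \<in> V \<Longrightarrow> height_op (scl c x) = scl c (height_op x)"
  unfolding height_op_def scale_sum_right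
  by (rule sum.cong[OF refl]) (simp add: act_scale letters_Lett mult.commute)

lemma height_op_v: "height_op v = scl top_height v"
  unfolding height_op_def top_height_def scale_sum_left
  by (rule sum.cong[OF refl]) (simp add: weight_v)

lemma height_op_act:
  assumes "1 \<le> i" "i \<le> n" "1 \<le> j" "j \<le> n" "x \<in> V"
  shows "height_op (act (Lett i) (Lett j) x)
    = act (Lett i) (Lett j) (height_op x) + scl (of_nat i - of_nat j) (act (Lett i) (Lett j) x)"
proof -
  let ?a = "act (Lett i) (Lett j)"
  have L: "Lett i \<in> letters n" "Lett j \<in> letters n" using assms by (auto simp: letters_def)
  have lin: "?a (\<Sum>k\<in>A. g k) = (\<Sum>k\<in>A. ?a (g k))" if "\<And>k. k \<in> A \<Longrightarrow> g k \<in> V" for g and A :: "nat set"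
    using word_sum[of "[(Lett i, Lett j)]" A g] L that by simp
  have "height_op (?a x) = (\<Sum>k=1..n. scl (of_nat k) (?a (act (Lett k) (Lett k) x))
      + ((if k = i then scl (of_nat k) (?a x) else 0) - (if k = j then scl (of_nat k) (?a x) else 0)))"
    unfolding height_op_def
  proof (rule sum.cong[OF refl])
    fix k assume k: "k \<in> {1..n}"
    show "scl (of_nat k) (act (Lett k) (Lett k) (?a x)) = scl (of_nat k) (?a (act (Lett k) (Lett k) x))
      + ((if k = i then scl (of_nat k) (?a x) else 0) - (if k = j then scl (of_nat k) (?a x) else 0))"
      unfolding act_commute[OF letters_Lett[OF k] letters_Lett[OF k] L assms(5)]
      by (auto simp: scale_right_distrib scale_right_diff_distrib)
  qed
  also have "\<dots> = (\<Sum>k=1..n. scl (of_nat k) (?a (act (Lett k) (Lett k) x)))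
      + (scl (of_nat i) (?a x) - scl (of_nat j) (?a x))"
    using assms by (simp add: sum.distrib sum_subtractf sum.delta)
  also have "(\<Sum>k=1..n. scl (of_nat k) (?a (act (Lett k) (Lett k) x))) = ?a (height_op x)"
    unfolding height_op_def
    by (subst lin) (use assms(5) L in \<open>auto simp: act_scale letters_Lett intro!: sum.cong\<close>)
  finally show ?thesis by (simp add: scale_left_diff_distrib)
qed

text \<open>Each lowering factor adds i - j \<ge> 1 to the eigenvalue, so a nonempty word lies at a
  nonzero distance from the top.\<close>

lemma height_op_word:
  assumes "ws \<in> lists lowering"
  shows "\<exists>m. length ws \<le> m \<and> height_op (word ws v) = scl (top_height + of_nat m) (word ws v)"
  using assms
proof (induction ws rule: list.induct)
  case Nil
  then show ?case by (intro exI[of _ 0]) (simp add: height_op_v)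
next
  case (Cons p ws)
  then have ws: "ws \<in> lists lowering" by simp
  obtain i j where p: "p = (Lett i, Lett j)" and ij: "1 \<le> j" "j < i" "i \<le> n"
    using Cons.prems by (auto simp: lowering_def)
  obtain m where m: "length ws \<le> m" "height_op (word ws v) = scl (top_height + of_nat m) (word ws v)"
    using Cons.IH[OF ws] by blast
  have V: "word ws v \<in> V" by (rule word_closed[OF lowering_words[OF ws] v_in])
  have "height_op (act (Lett i) (Lett j) (word ws v))
      = scl (top_height + of_nat (m + (i - j))) (act (Lett i) (Lett j) (word ws v))"
  proof -
    have "height_op (act (Lett i) (Lett j) (word ws v))
        = scl (top_height + of_nat m + (of_nat i - of_nat j)) (act (Lett i) (Lett j) (word ws v))"
    proof -
      have L: "Lett i \<in> letters n" "Lett j \<in> letters n" using ij by (auto simp: letters_def)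
      have "1 \<le> i" "j \<le> n" using ij by simp_all
      from height_op_act[OF this(1) ij(3,1) this(2) V] show ?thesis
        unfolding m(2) act_scale[OF L V] by (simp only: scale_left_distrib)
    qed
    moreover have "top_height + of_nat m + (of_nat i - of_nat j) = top_height + of_nat (m + (i - j))"
      using ij by (simp add: of_nat_diff)
    ultimately show ?thesis by simp
  qed
  then show ?case using m(1) ij by (intro exI[of _ "m + (i - j)"]) (simp add: p)
qed

text \<open>A linear factor of an annihilating polynomial of \<open>height_op\<close>, with its root
  at distance \<open>m\<close> from the top eigenvalue.\<close>

definition shift_op :: "nat \<Rightarrow> 'v \<Rightarrow> 'v" where
  "shift_op m x = height_op x - scl (top_height + of_nat m) x"

lemma shift_op_closed: "x \<in> V \<Longrightarrow> shift_op m x \<in> V"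
  by (simp add: shift_op_def height_op_closed)

lemma shift_op_add: "x \<in> V \<Longrightarrow> y \<in> V \<Longrightarrow> shift_op m (x + y) = shift_op m x + shift_op m y"
  by (simp add: shift_op_def height_op_add scale_right_distrib)

lemma shift_op_scale: "x \<in> V \<Longrightarrow> shift_op m (scl c x) = scl c (shift_op m x)"
  by (simp add: shift_op_def height_op_scale scale_right_diff_distrib mult.commute)

lemma height_op_diff: "x \<in> V \<Longrightarrow> y \<in> V \<Longrightarrow> height_op (x - y) = height_op x - height_op y"
  using height_op_add[of x "scl (-1) y"] height_op_scale[of y "-1"] V_intros(3)[of y "-1"] by simp

lemma shift_op_commute: "x \<in> V \<Longrightarrow> shift_op m (shift_op k x) = shift_op k (shift_op m x)"
proof -
  assume x: "x \<in> V"
  have *: "shift_op m (shift_op k x) = (height_op (height_op x) - scl (top_height + of_nat k) (height_op x))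
      - (scl (top_height + of_nat m) (height_op x) - scl ((top_height + of_nat m) * (top_height + of_nat k)) x)" for m k
    using x by (simp only: shift_op_def height_op_diff height_op_scale height_op_closed V_intros
        scale_right_diff_distrib scale_scale)
  have swap: "(X - a) - (b - e) = (X - b) - (a - e)" for X a b e :: 'v
    by (simp add: algebra_simps)
  show ?thesis unfolding * by (subst swap) (simp only: mult.commute)
qed

lemma shift_op_zero: "shift_op m 0 = 0"
  using shift_op_scale[of 0 m 0] by simp

lemma shifts_closed: "x \<in> V \<Longrightarrow> foldr shift_op ms x \<in> V"
  by (induction ms) (auto simp: shift_op_closed)

lemma shifts_commute: "x \<in> V \<Longrightarrow> foldr shift_op ms (shift_op k x) = shift_op k (foldr shift_op ms x)"
  by (induction ms) (auto simp: shift_op_commute shifts_closed)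

text \<open>A product of operators \<open>shift_op m\<close> with m > 0, one for each term, kills a
  combination of nonempty lowered words. On a vector of top height the same product is
  multiplication by \<Prod>(-m), which is nonzero.\<close>

lemma lowered_zero:
  assumes x: "x \<in> span {word ws v |ws. ws \<in> lists lowering \<and> ws \<noteq> []}"
    and top: "height_op x = scl top_height x"
  shows "x = 0"
proof -
  let ?S = "{word ws v |ws. ws \<in> lists lowering \<and> ws \<noteq> []}"
  have SV: "?S \<subseteq> V" using lowering_words by (blast intro: word_closed v_in)
  have xV: "x \<in> V" using span_minimal[OF SV subspace_V] x by blast
  have "x \<in> V \<and> (\<exists>ms. 0 \<notin> set ms \<and> foldr shift_op ms x = 0)"
    using x
  proof (induction rule: span_induct_alt)
    case base
    then show ?case by (intro conjI exI[of _ "[]"]) simp_all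
  next
    case (step c s y)
    then obtain ws where ws: "ws \<in> lists lowering" "ws \<noteq> []" "s = word ws v" by blast
    obtain m where m: "length ws \<le> m" "height_op s = scl (top_height + of_nat m) s"
      using height_op_word[OF ws(1)] ws(3) by blast
    obtain ms where y: "y \<in> V" and ms: "0 \<notin> set ms" "foldr shift_op ms y = 0" using step by blast
    have s: "s \<in> V" unfolding ws(3) by (rule word_closed[OF lowering_words[OF ws(1)] v_in])
    have "shift_op m s = 0" by (simp add: shift_op_def m(2))
    then have "foldr shift_op (ms @ [m]) (scl c s + y) = 0"
      using s y ms(2) by (simp add: shift_op_add shift_op_scale shifts_commute shift_op_zero)
    moreover have "0 \<notin> set (ms @ [m])" using ms(1) m(1) ws(2) by (cases ws) auto
    moreover have "scl c s + y \<in> V" using s y by simp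
    ultimately show ?case by blast
  qed
  then obtain ms where ms: "0 \<notin> set ms" "foldr shift_op ms x = 0" by blast
  have "shift_op m x = scl (- of_nat m) x" for m
    by (simp add: shift_op_def top scale_left_distrib)
  have "foldr shift_op ms x = scl (\<Prod>m\<leftarrow>ms. - of_nat m) x"
    using xV by (induction ms) (auto simp: shift_op_scale \<open>\<And>m. shift_op m x = scl (- of_nat m) x\<close> mult.commute)
  moreover have "(\<Prod>m\<leftarrow>ms. - of_nat m) \<noteq> (0 :: complex)"
    using ms(1) by (induction ms) auto
  ultimately show ?thesis using ms(2) by simp
qed

text \<open>Subtracting the multiple of \<open>v\<close> contributed by the empty word leaves a
  lowered vector of top height.\<close>

lemma top_weight_multiple:
  assumes "f \<in> carrier F" "height_op (comb f v) = scl top_height (comb f v)"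
  shows "\<exists>d. comb f v = scl d v"
proof -
  let ?S = "{word ws v |ws. ws \<in> lists lowering \<and> ws \<noteq> []}"
  have "{word ws v |ws. ws \<in> lists lowering} = insert v ?S"
    by (auto intro: exI[of _ "[]"])
  then have "comb f v \<in> span (insert v ?S)"
    using comb_low_span[OF assms(1)] by (simp add: low_span_def)
  then obtain d where d: "comb f v - scl d v \<in> span ?S" by (auto simp: span_insert)
  have "height_op (comb f v - scl d v) = scl top_height (comb f v - scl d v)"
    using assms by (simp add: height_op_diff height_op_scale height_op_v scale_right_diff_distrib mult.commute)
  from lowered_zero[OF d this] show ?thesis by auto
qed

end

section \<open>Comparison through the product module\<close>

lemma product_rep:
  assumes "super_rep scl X V act" "super_rep scl' X V' act'"
  shows "super_rep (\<lambda>c p. (scl c (fst p), scl' c (snd p))) X (V \<times> V')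
    (\<lambda>a b p. (act a b (fst p), act' a b (snd p)))"
proof -
  interpret A: super_rep scl X V act by fact
  interpret B: super_rep scl' X V' act' by fact
  interpret P: vector_space "\<lambda>c p. (scl c (fst p), scl' c (snd p))"
    by unfold_locales (auto simp: A.scale_right_distrib A.scale_left_distrib B.scale_right_distrib B.scale_left_distrib)
  show ?thesis
  proof (unfold_locales, goal_cases)
    case 1
    show ?case by (rule P.subspaceI) (auto simp: zero_prod_def plus_prod_def)
  next
    case (5 a b c d x)
    then show ?case
      using A.act_bracket[of a b c d "fst x"] B.act_bracket[of a b c d "snd x"]
      by (auto simp: plus_prod_def minus_prod_def zero_prod_def)
  qed (auto simp: A.act_add A.act_scale B.act_add B.act_scale)
qed

lemma product_comb:
  "comb_act (\<lambda>c p. (scl c (fst p), scl' c (snd p))) (\<lambda>a b p. (act a b (fst p), act' a b (snd p))) f (x, y)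
    = (comb_act scl act f x, comb_act scl' act' f y)"
proof -
  have "word_act (\<lambda>a b p. (act a b (fst p), act' a b (snd p))) ws (x, y) = (word_act act ws x, word_act act' ws y)" for ws
    by (induction ws) auto
  then show ?thesis
    by (simp add: comb_act_def prod_eq_iff fst_sum snd_sum)
qed

text \<open>The vectors g v with g w = 0 form a submodule \<open>M\<close>. If it contained
  \<open>v\<close>, then (v, 0) would be generated from (v, w) at top height and hence be a multiple
  of (v, w), contradicting v \<noteq> 0 and w \<noteq> 0. So \<open>M\<close> is zero, and f - c,
  which kills \<open>w\<close>, also kills \<open>v\<close>.\<close>

lemma highest_weight_transfer:
  assumes V: "highest_weight_rep scl n V act wt v" and W: "highest_weight_rep scl' n V' act' wt w"
    and nz: "v \<noteq> 0" "w \<noteq> 0"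
    and irred: "\<And>M. M \<subseteq> V \<Longrightarrow> module.subspace scl M \<Longrightarrow>
      (\<And>a b x. a \<in> letters n \<Longrightarrow> b \<in> letters n \<Longrightarrow> x \<in> M \<Longrightarrow> act a b x \<in> M) \<Longrightarrow> M = {0} \<or> M = V"
    and f: "f \<in> carrier (free_alg (letters n \<times> letters n))"
    and fw: "comb_act scl' act' f w = scl' c w"
  shows "comb_act scl act f v = scl c v"
proof -
  interpret V: highest_weight_rep scl n V act wt v by fact
  interpret W: highest_weight_rep scl' n V' act' wt w by fact
  let ?scl = "\<lambda>c p. (scl c (fst p), scl' c (snd p))" and ?act = "\<lambda>a b p. (act a b (fst p), act' a b (snd p))"
  interpret P0: super_rep ?scl "letters n" "V \<times> V'" ?act
    by (rule product_rep) unfold_locales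
  interpret P: highest_weight_rep ?scl n "V \<times> V'" ?act wt "(v, w)"
    by unfold_locales (auto simp: V.raise_v W.raise_v V.weight_v W.weight_v zero_prod_def)
  let ?F = "free_alg (letters n \<times> letters n)"
  define M where "M = {V.comb g v |g. g \<in> carrier ?F \<and> W.comb g w = 0}"
  have "M \<subseteq> V" by (auto simp: M_def)
  moreover have "V.subspace M"
  proof (rule V.subspaceI)
    show "0 \<in> M"
      unfolding M_def using ring.ring_simprules(2)[OF ring_free_alg, of "letters n \<times> letters n"]
      by (auto simp: free_alg_sel(4) intro!: exI[of _ "\<lambda>w. 0"])
    show "x + y \<in> M" if xy: "x \<in> M" "y \<in> M" for x y
    proof -
      obtain g h where "g \<in> carrier ?F" "W.comb g w = 0" "x = V.comb g v" "h \<in> carrier ?F" "W.comb h w = 0" "y = V.comb h v"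
        using xy by (auto simp: M_def)
      then show ?thesis unfolding M_def
        by (intro CollectI exI[of _ "\<lambda>w. g w + h w"]) (simp add: V.comb_add W.comb_add add_closed)
    qed
    show "scl k x \<in> M" if x: "x \<in> M" for k x
    proof -
      obtain g where "g \<in> carrier ?F" "W.comb g w = 0" "x = V.comb g v"
        using x by (auto simp: M_def)
      then show ?thesis unfolding M_def
        by (intro CollectI exI[of _ "\<lambda>w. k * g w"]) (simp add: V.comb_scale W.comb_scale scaled_closed)
    qed
  qed
  moreover have "act a b x \<in> M" if ab: "a \<in> letters n" "b \<in> letters n" and x: "x \<in> M" for a b x
  proof -
    obtain g where g: "g \<in> carrier ?F" "W.comb g w = 0" "x = V.comb g v"
      using x by (auto simp: M_def)
    have e: "word_elt [(a, b)] \<in> carrier ?F" using ab by simp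
    have "act' a b 0 = 0" using W.act_scale[OF ab, of 0 0] by simp
    then show ?thesis unfolding M_def
      using g e ring.ring_simprules(5)[OF ring_free_alg e g(1)]
      by (intro CollectI exI[of _ "word_elt [(a, b)] \<otimes>\<^bsub>?F\<^esub> g"]) (simp add: V.comb_mult W.comb_mult)
  qed
  ultimately have "M = {0} \<or> M = V" by (rule irred)
  moreover have "M \<noteq> V"
  proof
    assume "M = V"
    then have "v \<in> M" using V.v_in by blast
    then obtain g where g: "g \<in> carrier ?F" "W.comb g w = 0" "v = V.comb g v"
      unfolding M_def by blast
    then have gvw: "P0.comb g (v, w) = (v, 0)" by (simp add: product_comb)
    have "act' a b 0 = 0" if "a \<in> letters n" "b \<in> letters n" for a b
      using W.act_scale[OF that, of 0 0] by simp
    then have "P.height_op (v, 0) = (V.height_op v, 0)"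
      by (simp add: P.height_op_def V.height_op_def prod_eq_iff fst_sum snd_sum V.letters_Lett)
    then have "P.height_op (P0.comb g (v, w)) = ?scl P.top_height (P0.comb g (v, w))"
      unfolding gvw by (simp add: V.height_op_v P.top_height_def V.top_height_def)
    from P.top_weight_multiple[OF g(1) this] obtain d where "(v, 0) = (scl d v, scl' d w)"
      unfolding gvw by auto
    then have "v = scl d v" "scl' d w = 0" by auto
    then show False using nz by simp
  qed
  ultimately have M0: "M = {0}" by blast
  have one: "word_elt [] \<in> carrier ?F" by simp
  have cl: "(\<lambda>u. f u - c * word_elt [] u) \<in> carrier ?F" by (intro diff_closed scaled_closed f one)
  have "V.comb (\<lambda>u. f u - c * word_elt [] u) v \<in> M"
    unfolding M_def using cl fw f one
    by (intro CollectI exI[of _ "\<lambda>u. f u - c * word_elt [] u"])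
       (simp add: W.comb_diff W.comb_scale scaled_closed)
  then show ?thesis
    using M0 f one by (simp add: V.comb_diff V.comb_scale scaled_closed)
qed

text \<open>All letters are odd, so the generators between letters are even and the superbracket is
  the ordinary commutator.\<close>

lemma gl_module_rep:
  assumes "gl_module n scl V E"
  shows "super_rep scl (letters n) V (\<lambda>a b. E (idx a) (idx b))"
proof -
  interpret vector_space scl using assms by (simp add: gl_module_def)
  have E: "\<And>i j x. i \<in> {1..n} \<Longrightarrow> j \<in> {1..n} \<Longrightarrow> x \<in> V \<Longrightarrow> E i j x \<in> V"
    "\<And>i j x y. i \<in> {1..n} \<Longrightarrow> j \<in> {1..n} \<Longrightarrow> x \<in> V \<Longrightarrow> y \<in> V \<Longrightarrow> E i j (x + y) = E i j x + E i j y"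
    "\<And>i j x c. i \<in> {1..n} \<Longrightarrow> j \<in> {1..n} \<Longrightarrow> x \<in> V \<Longrightarrow> E i j (scl c x) = scl c (E i j x)"
    "\<And>i j k l x. i \<in> {1..n} \<Longrightarrow> j \<in> {1..n} \<Longrightarrow> k \<in> {1..n} \<Longrightarrow> l \<in> {1..n} \<Longrightarrow> x \<in> V \<Longrightarrow>
      E i j (E k l x) - E k l (E i j x) = (if j = k then E i l x else 0) - (if i = l then E k j x else 0)"
    and sub: "subspace V"
    using assms unfolding gl_module_def by blast+
  have L: "a \<in> letters n \<Longrightarrow> idx a \<in> {1..n} \<and> a = Lett (idx a)" for a by (auto simp: letters_def)
  show ?thesis
  proof (unfold_locales, goal_cases)
    case 1
    show ?case by (rule sub)
  next
    case (2 a b x)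
    then show ?case using L E(1) by blast
  next
    case (3 a b x y)
    then show ?case using L E(2) by blast
  next
    case (4 a b x k)
    then show ?case using L E(3) by blast
  next
    case (5 a b c d x)
    have "gl_sign (a, b) (c, d) = 1" using 5 by (auto simp: gl_sign_def letters_def)
    moreover have "b = c \<longleftrightarrow> idx b = idx c" "a = d \<longleftrightarrow> idx a = idx d" using 5 L by metis+
    ultimately show ?case
      using E(4)[of "idx a" "idx b" "idx c" "idx d" x] L 5 by (simp add: algebra_simps)
  qed
qed

text \<open>At most the tableau of column indices contributes to the sum, and for
  \<open>lam = mu\<close> its value is H^2, which 1/H reduces to H.\<close>

lemma S_elt_act:
  assumes lam: "is_partition lam" and mu: "is_partition mu"
    and n: "part lam 1 \<le> n" "part mu 1 \<le> n" and m: "conj_part lam 1 \<le> m0" "part lam 1 \<le> m1"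
    and le: "sum_list mu \<le> sum_list lam"
  shows "S_elt m0 m1 n lam \<in> carrier (U (letters n))"
    and "U_act fscl (fock_act (length mu)) (S_elt m0 m1 n lam) (hwv mu)
      = fscl ((if lam = mu then 1 else 0) * of_nat (hook_prod lam)) (hwv mu)"
proof -
  let ?X = "symbols m0 m1 n" and ?L = "letters n" and ?RS = "row_strict_tableaux n lam" and ?cs = "cells lam"
  let ?w = "hwv mu" and ?h = "of_nat (hook_prod lam) :: complex"
  let ?W = "word_act (fock_act (length mu))"
  interpret WL: super_rep fscl ?L UNIV "fock_act (length mu)" by (rule fock_rep)
  interpret RL: ring "U ?L" by (rule ring_U)
  define ws where "ws S = map (\<lambda>c. ((Lett \<circ> S) c, tab_C c)) ?cs @ map (\<lambda>c. (tab_C c, tab_D c)) ?cs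
    @ map (\<lambda>c. (tab_D c, tab_C c)) ?cs @ map (\<lambda>c. (tab_C c, (Lett \<circ> S) c)) ?cs" for S :: "nat \<times> nat \<Rightarrow> nat"
  define y where "y S = virt_proj m0 m1 n (U_prod ?X (ws S))" for S
  have len: "length lam \<le> m0" using m(1) conj_part_1[OF lam] by simp
  have symX: "tab_C c \<in> ?X" "tab_D c \<in> ?X" "(Lett \<circ> S) c \<in> ?X" if "c \<in> set ?cs" "S \<in> ?RS" for c S
    using that len m(2) cells_column_bound[OF lam that(1)]
    by (auto simp: symbols_def letters_def tab_C_def tab_D_def set_cells row_strict_tableaux_def split: prod.splits)
  have parts: "map (\<lambda>c. ((Lett \<circ> S) c, tab_C c)) ?cs \<in> lists (?X \<times> ?X)" "map (\<lambda>c. (tab_C c, tab_D c)) ?cs \<in> lists (?X \<times> ?X)"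
    "map (\<lambda>c. (tab_D c, tab_C c)) ?cs \<in> lists (?X \<times> ?X)" "map (\<lambda>c. (tab_C c, (Lett \<circ> S) c)) ?cs \<in> lists (?X \<times> ?X)"
    if "S \<in> ?RS" for S
    unfolding in_lists_conv_set set_map using symX[OF _ that] by blast+
  have wsX: "ws S \<in> lists (?X \<times> ?X)" if "S \<in> ?RS" for S
    unfolding ws_def append_in_lists_conv using parts[OF that] by blast
  \<comment> \<open>C supplies the first index in two of the four words and the second index in the
    other two, D supplies each once, and S contains no virtual symbol.\<close>
  have bal: "length (filter (\<lambda>p. fst p = \<gamma>) (ws S)) = length (filter (\<lambda>p. snd p = \<gamma>) (ws S))" if "is_virtual \<gamma>" for \<gamma> S
  proof -
    have "Lett i \<noteq> \<gamma>" for i using that by auto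
    then show ?thesis by (simp add: ws_def filter_map comp_def)
  qed
  have e_tabs: "e_tab ?X lam (Lett \<circ> S) tab_C \<otimes>\<^bsub>U ?X\<^esub> e_tab ?X lam tab_C tab_D \<otimes>\<^bsub>U ?X\<^esub>
      e_tab ?X lam tab_D tab_C \<otimes>\<^bsub>U ?X\<^esub> e_tab ?X lam tab_C (Lett \<circ> S) = U_prod ?X (ws S)" if "S \<in> ?RS" for S
  proof -
    note p = parts[OF that]
    have "map (\<lambda>c. ((Lett \<circ> S) c, tab_C c)) ?cs @ map (\<lambda>c. (tab_C c, tab_D c)) ?cs \<in> lists (?X \<times> ?X)"
      unfolding append_in_lists_conv using p by blast
    moreover have "(map (\<lambda>c. ((Lett \<circ> S) c, tab_C c)) ?cs @ map (\<lambda>c. (tab_C c, tab_D c)) ?cs)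
        @ map (\<lambda>c. (tab_D c, tab_C c)) ?cs \<in> lists (?X \<times> ?X)"
      unfolding append_in_lists_conv using p by blast
    ultimately show ?thesis
      unfolding e_tab_def by (simp only: U_prod_append p ws_def append_assoc[symmetric])
  qed
  have yL: "y S \<in> carrier (U ?L)" if "S \<in> ?RS" for S
    unfolding y_def by (rule virt_proj_props(1)[OF wsX[OF that] bal])
  have "finite ?RS"
    by (rule finite_subset[of _ "set ?cs \<rightarrow>\<^sub>E {1..n}"]) (auto simp: row_strict_tableaux_def intro: finite_PiE)
  have S_elt: "S_elt m0 m1 n lam = U_scalar ?L (1 / ?h) \<otimes>\<^bsub>U ?L\<^esub> (\<Oplus>\<^bsub>U ?L\<^esub>S\<in>?RS. y S)"
    unfolding S_elt_def Let_def
    by (intro arg_cong2[where f = "monoid.mult (U ?L)"] refl RL.finsum_cong')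
       (use yL e_tabs in \<open>auto simp: y_def\<close>)
  have sum_in: "(\<Oplus>\<^bsub>U ?L\<^esub>S\<in>?RS. y S) \<in> carrier (U ?L)"
    by (rule RL.finsum_closed) (use yL in auto)
  show "S_elt m0 m1 n lam \<in> carrier (U ?L)"
    unfolding S_elt using sum_in by simp
  \<comment> \<open>Tableaux are extensional functions, so the column index is restricted to the
    cells.\<close>
  define S0 where "S0 = restrict snd (set ?cs)"
  have S0: "S0 \<in> ?RS"
    using cells_column_bound[OF lam] n(1)
    by (fastforce simp: S0_def row_strict_tableaux_def)
  have S0_iff: "(\<forall>c\<in>set ?cs. S c = snd c) \<longleftrightarrow> S = S0" if "S \<in> ?RS" for S
  proof
    assume "\<forall>c\<in>set ?cs. S c = snd c"
    moreover have "S \<in> extensional (set ?cs)" using that by (auto simp: row_strict_tableaux_def PiE_def)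
    ultimately show "S = S0"
      by (intro extensionalityI[of _ "set ?cs"]) (auto simp: S0_def)
  qed (simp add: S0_def)
  have act_y: "WL.uact (y S) ?w = (if S = S0 then (if lam = mu then fscl (?h * ?h) ?w else 0) else 0)"
    if S: "S \<in> ?RS" for S
  proof -
    have "WL.uact (y S) ?w = ?W (ws S) ?w"
      unfolding y_def by (rule virt_proj_act[OF has_deg_hwv_virtual wsX[OF S] bal])
    also have "\<dots> = (if S = S0 then (if lam = mu then fscl (?h * ?h) ?w else 0) else 0)"
    proof (cases "lam = mu \<and> S = S0")
      case True
      then have "\<And>c. c \<in> set ?cs \<Longrightarrow> S c = snd c" using S0_iff[OF S] by blast
      from virtual_value[OF lam this] show ?thesis using True by (simp only: ws_def word_act_simps) simp
    next
      case False
      then have "?W (map (\<lambda>c. (tab_D c, tab_C c)) ?cs) (?W (map (\<lambda>c. (tab_C c, (Lett \<circ> S) c)) ?cs) ?w) = 0"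
        using virtual_vanish[OF lam mu n S le] S0_iff[OF S] by blast
      then show ?thesis using False by (simp only: ws_def word_act_simps word_act_zero) auto
    qed
    finally show ?thesis .
  qed
  have "WL.uact (S_elt m0 m1 n lam) ?w = fscl (1 / ?h) (WL.uact (\<Oplus>\<^bsub>U ?L\<^esub>S\<in>?RS. y S) ?w)"
    unfolding S_elt using sum_in by (simp add: WL.uact_mult WL.uact_scalar)
  also have "WL.uact (\<Oplus>\<^bsub>U ?L\<^esub>S\<in>?RS. y S) ?w = (\<Sum>S\<in>?RS. WL.uact (y S) ?w)"
    by (rule WL.uact_finsum) (use \<open>finite ?RS\<close> yL in auto)
  also have "\<dots> = (\<Sum>S\<in>?RS. if S = S0 then (if lam = mu then fscl (?h * ?h) ?w else 0) else 0)"
    by (rule sum.cong[OF refl act_y])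
  also have "\<dots> = (if lam = mu then fscl (?h * ?h) ?w else 0)"
    using \<open>finite ?RS\<close> S0 by (simp add: sum.delta)
  also have "fscl (1 / ?h) \<dots> = fscl ((if lam = mu then 1 else 0) * ?h) ?w"
  proof -
    have "hook_prod lam \<noteq> 0" by (auto simp: hook_prod_def)
    then show ?thesis by simp
  qed
  finally show "WL.uact (S_elt m0 m1 n lam) ?w = fscl ((if lam = mu then 1 else 0) * ?h) ?w" .
qed

lemma hwv_highest_weight:
  assumes "is_partition p"
  shows "highest_weight_rep fscl n UNIV (fock_act (length p)) (schur_weight p) (hwv p)"
proof -
  interpret super_rep fscl "letters n" UNIV "fock_act (length p)" by (rule fock_rep)
  show ?thesis
  proof (unfold_locales, goal_cases)
    case (2 i j)
    then show ?case by (simp add: hwv_raise)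
  next
    case (3 i)
    then show ?case
      using has_deg_diag[OF has_deg_hwv(1)[of i p]] by (simp add: schur_weight_def)
  qed simp
qed

theorem theorem4p51:
  fixes n m0 m1 :: nat
    and lam mu :: "nat list"
    and scl :: "complex \<Rightarrow> 'v::ab_group_add \<Rightarrow> 'v"
    and V :: "'v set"
    and E :: "nat \<Rightarrow> nat \<Rightarrow> 'v \<Rightarrow> 'v"
    and v :: 'v
  assumes "n \<ge> 1"
    and "is_partition lam" and "is_partition mu"
    and "part lam 1 \<le> n" and "part mu 1 \<le> n"
    and "conj_part lam 1 \<le> m0" and "part lam 1 \<le> m1"
    and "is_Schur_module n mu scl V E"
    and "highest_weight_vector n scl V E (schur_weight mu) v"
  shows "(sum_list mu < sum_list lam \<longrightarrow> U_action scl E (S_elt m0 m1 n lam) v = 0) \<and>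
         (sum_list mu = sum_list lam \<longrightarrow>
            U_action scl E (S_elt m0 m1 n lam) v =
              scl ((if lam = mu then 1 else 0) * of_nat (hook_prod lam)) v)"
proof -
  let ?act = "\<lambda>a b. E (idx a) (idx b)" and ?c = "(if lam = mu then 1 else 0) * of_nat (hook_prod lam) :: complex"
  have irred: "irreducible_gl_module n scl V E" using assms(8) by (simp add: is_Schur_module_def)
  then have gl: "gl_module n scl V E" by (simp add: irreducible_gl_module_def)
  interpret VR: super_rep scl "letters n" V ?act by (rule gl_module_rep[OF gl])
  interpret WR: super_rep fscl "letters n" UNIV "fock_act (length mu)" by (rule fock_rep)
  have V: "highest_weight_rep scl n V ?act (schur_weight mu) v"
    by unfold_locales (use assms(9) in \<open>auto simp: highest_weight_vector_def\<close>)
  \<comment> \<open>The inequality of sizes covers both claims: in the strict case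
    \<open>lam\<close> and \<open>mu\<close> differ and the scalar is 0.\<close>
  have main: "U_action scl E (S_elt m0 m1 n lam) v = scl ?c v" if le: "sum_list mu \<le> sum_list lam"
  proof -
    note S = S_elt_act[OF assms(2-7) le]
    obtain f where f: "f \<in> carrier (free_alg (letters n \<times> letters n))" "S_elt m0 m1 n lam = U_of (letters n) f"
      using S(1) by (auto simp: U_carrier)
    have "VR.comb f v = scl ?c v"
    proof (rule highest_weight_transfer[OF V hwv_highest_weight[OF assms(3)] _ hwv_nonzero _ f(1)])
      show "v \<noteq> 0" using assms(9) by (simp add: highest_weight_vector_def)
      show "WR.comb f (hwv mu) = fscl ?c (hwv mu)"
        using S(2) f by (simp add: WR.uact_U_of)
      fix M assume M: "M \<subseteq> V" "VR.subspace M"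
        "\<And>a b x. a \<in> letters n \<Longrightarrow> b \<in> letters n \<Longrightarrow> x \<in> M \<Longrightarrow> E (idx a) (idx b) x \<in> M"
      have "E i j x \<in> M" if "i \<in> {1..n}" "j \<in> {1..n}" "x \<in> M" for i j x
        using M(3)[of "Lett i" "Lett j" x] that by (simp add: letters_def)
      then show "M = {0} \<or> M = V" using irred M(1,2) unfolding irreducible_gl_module_def by blast
    qed
    moreover have "v \<in> V" using assms(9) by (simp add: highest_weight_vector_def)
    ultimately show ?thesis
      unfolding U_action_U_act f(2) using f(1) by (simp add: VR.uact_U_of)
  qed
  show ?thesis
  proof (intro conjI impI)
    assume lt: "sum_list mu < sum_list lam"
    then have "lam \<noteq> mu" by auto
    then show "U_action scl E (S_elt m0 m1 n lam) v = 0" using main lt by simp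
  next
    assume "sum_list mu = sum_list lam"
    then show "U_action scl E (S_elt m0 m1 n lam) v = scl ?c v" using main by simp
  qed
qed

end
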